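(* Let $\mathcal M$ be a large monoidal category, $\mathsf T$ a monoid object in $\mathcal M$, $\mathcal C$ a large category and $\Phi$ a metamodel of $\mathcal M$ in $\mathcal C$. The category $\mathbf{Mod}(\mathsf T,(\mathcal C,\Phi))$ of models of $\mathsf T$ in $\mathcal C$ with respect to $\Phi$ is the apex of the double limit of the lax double functor $\Phi(\mathsf T)\colon\mathbb H\Sigma(\Delta_a^{\mathrm{op}})\to\mathbb{PROF}^{\mathrm{op}}$.
   Context: Sizes: fix universes $\mathcal U_1\in\mathcal U_2\in\mathcal U_3$; "small" and "large" mean being an element of $\mathcal U_1$, $\mathcal U_2$; $\mathbf{SET}$ is the category of large sets. Metamodel. A metamodel of a large monoidal category $\mathcal{M}=(\mathcal M,I,\otimes)$ in a large category $\mathcal{C}$ consists of a functor $\Phi\colon\mathcal{M}^{\mathrm{op}}\times\mathcal{C}^{\mathrm{op}}\times\mathcal{C}\to\mathbf{SET}$, $(X,A,B)\mapsto\Phi_X(A,B)$; an (extra)natural family $(\overline{\phi}_\cdot)_C\colon 1\to\Phi_I(C,C)$; and an (extra)natural family $(\overline{\phi}_{X,Y})_{A,B,C}\colon\Phi_Y(B,C)\times\Phi_X(A,B)\to\Phi_{Y\otimes X}(A,C)$; such that, modulo $\Phi$ applied to the coherence isomorphisms of $\mathcal{M}$, $\overline\phi$ is associative and $\overline{\phi}_\cdot$ is a left and right unit for it. Write $(\phi_\cdot)_{A,B}(f)=\Phi_I(A,f)((\overline\phi_\cdot)_A(\ast))$ for $f\in\mathcal C(A,B)$. Models. A model of $\mathsf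 T=(T,e,m)$ in $\mathcal C$ with respect to $\Phi$ is a pair $(C,\xi)$ with $C\in\mathcal C$, $\xi\in\Phi_T(C,C)$, $(\Phi_e)_{C,C}(\xi)=(\overline\phi_\cdot)_C(\ast)$ and $(\Phi_m)_{C,C}(\xi)=(\overline\phi_{T,T})_{C,C,C}(\xi,\xi)$. A homomorphism $(C,\xi)\to(C',\xi')$ is $f\colon C\to C'$ in $\mathcal C$ with $\Phi_T(C,f)(\xi)=\Phi_T(f,C')(\xi')$. Pseudo double categories. $\mathbb{PROF}^{\mathrm{op}}$ is the pseudo double category whose objects are large categories, vertical morphisms are functors, horizontal morphisms from $\mathcal A$ to $\mathcal B$ are functors $H\colon\mathcal A^{\mathrm{op}}\times\mathcal B\to\mathbf{SET}$, and squares with vertical sides $F\colon\mathcal A\to\mathcal A'$, $G\colon\mathcal B\to\mathcal B'$ and horizontal sides $H$ (top), $H'$ (bottom) are natural transformations $H(A,B)\to H'(FA,GB)$; horizontal identities are hom-functors, and the composite of $H\colon\mathcal A\to\mathcal B$ and $K\colon\mathcal B\to\mathcal D$ is $(A,D)\mapsto\int^{B}K(B,D)\times H(A,B)$. $\Delta_a$ is the augmented simplex category: objects are the finite ordinals $\mathbf n=\{0<\dots<n-1\}$ (including $\mathbf 0=\emptyset$), morphisms are monotone maps, with strict monoidal structure $(\mathbf 0,+)$ by ordinal sum. $\Sigma$ regards a monoidal category as a one-object bicategory, and $\mathbb H$ regards a bicategory as a pseudo double category with only identity vertical morphisms. The lax double functor $\Phi(\mathsf T)$. The monoid $\mathsf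 T$ corresponds (up to isomorphism) to a strong monoidal functor $\mathsf T\colon\Delta_a\to\mathcal M$ with $\mathsf T(\mathbf n)=T^{\otimes n}$, with structure isomorphisms $I\cong\mathsf T(\mathbf 0)$ and $\mathsf T(\mathbf n)\otimes\mathsf T(\mathbf m)\cong\mathsf T(\mathbf{n+m})$, sending $\mathbf 0\to\mathbf 1$ and $\mathbf 2\to\mathbf 1$ to $e$ and $m$ modulo these isomorphisms. $\Phi(\mathsf T)$ sends the unique object to $\mathcal C$, the horizontal morphism $\mathbf n$ to $\Phi_{T^{\otimes n}}\colon\mathcal C^{\mathrm{op}}\times\mathcal C\to\mathbf{SET}$, and the square corresponding to $w\colon\mathbf n\to\mathbf n'$ in $\Delta_a$ to $\Phi_{\mathsf T(w)}\colon\Phi_{T^{\otimes n'}}\to\Phi_{T^{\otimes n}}$; its laxity constraints are given by $\phi_\cdot$ and $\overline\phi$ (followed by $\Phi$ of the structure isomorphisms of $\mathsf T$). Double limits. A vertical double cone over $\Phi(\mathsf T)$ consists of a large category $\mathcal A$ (the apex), a functor $V\colon\mathcal A\to\mathcal C$, and, for each $\mathbf n\in\Delta_a$, a natural transformation $(v_{\mathbf n})_{A,B}\colon\mathcal A(A,B)\to\Phi_{T^{\otimes n}}(VA,VB)$ such that, modulo the structure isomorphisms of $\mathsf T$: $v_{\mathbf 0}(f)=\phi_\cdot(Vf)$ for $f\colon A\to B$ in $\mathcal A$; $v_{\mathbf{n+m}}(g\circ h)=\overline\phi_{T^{\otimes m},T^{\otimes n}}(v_{\mathbf n}(g),v_{\mathbf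 m}(h))$ for composable $h\colon A\to B$, $g\colon B\to D$ in $\mathcal A$ and all $\mathbf n,\mathbf m$; and $v_{\mathbf n}=\Phi_{\mathsf T(w)}\circ v_{\mathbf n'}$ for all $w\colon\mathbf n\to\mathbf n'$ in $\Delta_a$. A double limit (in the sense of Grandis–Paré) of $\Phi(\mathsf T)$ is a vertical double cone $(\mathcal L,U,(u_{\mathbf n})_{\mathbf n})$ such that (a) for each vertical double cone $(\mathcal A,V,(v_{\mathbf n}))$ there is a unique functor $K\colon\mathcal A\to\mathcal L$ with $UK=V$ and $u_{\mathbf n}(Kf)=v_{\mathbf n}(f)$ for all $\mathbf n$ and all morphisms $f$ of $\mathcal A$; and (b) for vertical double cones $(\mathcal A,V,(v_{\mathbf n}))$, $(\mathcal A',V',(v'_{\mathbf n}))$ with corresponding functors $K,K'$, each $H\colon\mathcal A^{\mathrm{op}}\times\mathcal A'\to\mathbf{SET}$ and each natural $\theta_{A,A'}\colon H(A,A')\to\mathcal C(VA,V'A')$ such that $\Phi_{T^{\otimes n}}(VA,\theta(x))(v_{\mathbf n}(\mathrm{id}_A))=\Phi_{T^{\otimes n}}(\theta(x),V'A')(v'_{\mathbf n}(\mathrm{id}_{A'}))$ for all $\mathbf n$ and all $x\in H(A,A')$, there is a unique natural $\sigma_{A,A'}\colon H(A,A')\to\mathcal L(KA,K'A')$ with $U(\sigma(x))=\theta(x)$. *)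

theory Defs
  imports Main "HOL-Library.FuncSet"
begin

text \<open>
  Sizes: a large category is a category whose objects and arrows are the elements of two sets
  over HOL types; those types are arbitrary. A functor to SET is given by subsets of one
  (arbitrary) type and functions between them. All data are total HOL functions, whose values
  matter only on the indicated carriers.
\<close>

section \<open>Categories\<close>

record ('o, 'a) cat =
  Obj :: "'o set"
  Arr :: "'a set"
  Dom :: "'a \<Rightarrow> 'o"
  Cod :: "'a \<Rightarrow> 'o"
  ide :: "'o \<Rightarrow> 'a"
  cmp :: "'a \<Rightarrow> 'a \<Rightarrow> 'a" (infixl "\<cdot>\<index>" 70)

definition hom :: "('o, 'a, 'z) cat_scheme \<Rightarrow> 'o \<Rightarrow> 'o \<Rightarrow> 'a set" where
  "hom C A B = {f \<in> Arr C. Dom C f = A \<and> Cod C f = B}"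

locale category =
  fixes C :: "('o, 'a, 'z) cat_scheme"
  assumes dom_in: "f \<in> Arr C \<Longrightarrow> Dom C f \<in> Obj C"
    and cod_in: "f \<in> Arr C \<Longrightarrow> Cod C f \<in> Obj C"
    and ide_in: "A \<in> Obj C \<Longrightarrow> ide C A \<in> hom C A A"
    and cmp_in: "\<lbrakk>f \<in> hom C A B; g \<in> hom C B D\<rbrakk> \<Longrightarrow> g \<cdot>\<^bsub>C\<^esub> f \<in> hom C A D"
    and ide_left: "f \<in> hom C A B \<Longrightarrow> ide C B \<cdot>\<^bsub>C\<^esub> f = f"
    and ide_right: "f \<in> hom C A B \<Longrightarrow> f \<cdot>\<^bsub>C\<^esub> ide C A = f"
    and cmp_assoc: "\<lbrakk>f \<in> hom C A B; g \<in> hom C B D; h \<in> hom C D E\<rbrakk>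
        \<Longrightarrow> (h \<cdot>\<^bsub>C\<^esub> g) \<cdot>\<^bsub>C\<^esub> f = h \<cdot>\<^bsub>C\<^esub> (g \<cdot>\<^bsub>C\<^esub> f)"

definition opc :: "('o, 'a, 'z) cat_scheme \<Rightarrow> ('o, 'a) cat" where
  "opc C = \<lparr>Obj = Obj C, Arr = Arr C, Dom = Cod C, Cod = Dom C, ide = ide C,
            cmp = (\<lambda>g f. f \<cdot>\<^bsub>C\<^esub> g)\<rparr>"

definition prodc :: "('o, 'a, 'z) cat_scheme \<Rightarrow> ('o2, 'a2, 'z2) cat_scheme
    \<Rightarrow> ('o \<times> 'o2, 'a \<times> 'a2) cat" (infixr "\<times>\<^sub>c" 75) where
  "C \<times>\<^sub>c D = \<lparr>Obj = Obj C \<times> Obj D, Arr = Arr C \<times> Arr D,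
             Dom = map_prod (Dom C) (Dom D), Cod = map_prod (Cod C) (Cod D),
             ide = map_prod (ide C) (ide D),
             cmp = (\<lambda>(g, g') (f, f'). (g \<cdot>\<^bsub>C\<^esub> f, g' \<cdot>\<^bsub>D\<^esub> f'))\<rparr>"

definition is_inverse :: "('o, 'a, 'z) cat_scheme \<Rightarrow> 'a \<Rightarrow> 'a \<Rightarrow> bool" where
  "is_inverse C f g \<longleftrightarrow> g \<in> hom C (Cod C f) (Dom C f)
     \<and> g \<cdot>\<^bsub>C\<^esub> f = ide C (Dom C f) \<and> f \<cdot>\<^bsub>C\<^esub> g = ide C (Cod C f)"

definition iso_hom :: "('o, 'a, 'z) cat_scheme \<Rightarrow> 'o \<Rightarrow> 'o \<Rightarrow> 'a set" where
  "iso_hom C A B = {f \<in> hom C A B. \<exists>g. is_inverse C f g}"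

definition arr_inv :: "('o, 'a, 'z) cat_scheme \<Rightarrow> 'a \<Rightarrow> 'a" where
  "arr_inv C f = (THE g. is_inverse C f g)"

record ('o, 'a, 'p, 'b) ftor =
  fobj :: "'o \<Rightarrow> 'p"
  farr :: "'a \<Rightarrow> 'b"

definition is_functor :: "('o, 'a, 'z) cat_scheme \<Rightarrow> ('p, 'b, 'y) cat_scheme
    \<Rightarrow> ('o, 'a, 'p, 'b, 'x) ftor_scheme \<Rightarrow> bool" where
  "is_functor C D F \<longleftrightarrow>
     (\<forall>A\<in>Obj C. fobj F A \<in> Obj D) \<and>
     (\<forall>A\<in>Obj C. \<forall>B\<in>Obj C. \<forall>f\<in>hom C A B. farr F f \<in> hom D (fobj F A) (fobj F B)) \<and>
     (\<forall>A\<in>Obj C. farr F (ide C A) = ide D (fobj F A)) \<and>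
     (\<forall>A\<in>Obj C. \<forall>B\<in>Obj C. \<forall>E\<in>Obj C. \<forall>f\<in>hom C A B. \<forall>g\<in>hom C B E.
        farr F (g \<cdot>\<^bsub>C\<^esub> f) = farr F g \<cdot>\<^bsub>D\<^esub> farr F f)"

definition functor_eq :: "('o, 'a, 'z) cat_scheme \<Rightarrow> ('o, 'a, 'p, 'b) ftor
    \<Rightarrow> ('o, 'a, 'p, 'b) ftor \<Rightarrow> bool" where
  "functor_eq C F G \<longleftrightarrow> (\<forall>A\<in>Obj C. fobj F A = fobj G A) \<and> (\<forall>f\<in>Arr C. farr F f = farr G f)"

text \<open>Functors to SET.\<close>

record ('o, 'a, 'x) setfun =
  on_obj :: "'o \<Rightarrow> 'x set"
  on_arr :: "'a \<Rightarrow> 'x \<Rightarrow> 'x"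

definition is_setfun :: "('o, 'a, 'z) cat_scheme \<Rightarrow> ('o, 'a, 'x) setfun \<Rightarrow> bool" where
  "is_setfun C F \<longleftrightarrow>
     (\<forall>A\<in>Obj C. \<forall>B\<in>Obj C. \<forall>f\<in>hom C A B. \<forall>x\<in>on_obj F A. on_arr F f x \<in> on_obj F B) \<and>
     (\<forall>A\<in>Obj C. \<forall>x\<in>on_obj F A. on_arr F (ide C A) x = x) \<and>
     (\<forall>A\<in>Obj C. \<forall>B\<in>Obj C. \<forall>E\<in>Obj C. \<forall>f\<in>hom C A B. \<forall>g\<in>hom C B E. \<forall>x\<in>on_obj F A.
        on_arr F (g \<cdot>\<^bsub>C\<^esub> f) x = on_arr F g (on_arr F f x))"

section \<open>Monoidal categories and monoid objects\<close>

record ('o, 'a) moncat = "('o, 'a) cat" +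
  ten :: "'o \<Rightarrow> 'o \<Rightarrow> 'o" (infixl "\<otimes>\<index>" 75)
  tenA :: "'a \<Rightarrow> 'a \<Rightarrow> 'a" (infixl "\<odot>\<index>" 75)
  unit :: "'o"
  assoc :: "'o \<Rightarrow> 'o \<Rightarrow> 'o \<Rightarrow> 'a"
  lunit :: "'o \<Rightarrow> 'a"
  runit :: "'o \<Rightarrow> 'a"

locale monoidal_category = category M for M :: "('o, 'a, 'z) moncat_scheme" +
  assumes tensor_functor:
      "is_functor (M \<times>\<^sub>c M) M \<lparr>fobj = (\<lambda>(X, Y). X \<otimes>\<^bsub>M\<^esub> Y), farr = (\<lambda>(f, g). f \<odot>\<^bsub>M\<^esub> g)\<rparr>"
    and unit_in: "unit M \<in> Obj M"
    and assoc_iso: "\<lbrakk>X \<in> Obj M; Y \<in> Obj M; Z \<in> Obj M\<rbrakk> \<Longrightarrow>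
        assoc M X Y Z \<in> iso_hom M ((X \<otimes>\<^bsub>M\<^esub> Y) \<otimes>\<^bsub>M\<^esub> Z) (X \<otimes>\<^bsub>M\<^esub> (Y \<otimes>\<^bsub>M\<^esub> Z))"
    and lunit_iso: "X \<in> Obj M \<Longrightarrow> lunit M X \<in> iso_hom M (unit M \<otimes>\<^bsub>M\<^esub> X) X"
    and runit_iso: "X \<in> Obj M \<Longrightarrow> runit M X \<in> iso_hom M (X \<otimes>\<^bsub>M\<^esub> unit M) X"
    and assoc_nat: "\<lbrakk>f \<in> hom M X X'; g \<in> hom M Y Y'; h \<in> hom M Z Z'\<rbrakk> \<Longrightarrow>
        assoc M X' Y' Z' \<cdot>\<^bsub>M\<^esub> ((f \<odot>\<^bsub>M\<^esub> g) \<odot>\<^bsub>M\<^esub> h) = (f \<odot>\<^bsub>M\<^esub> (g \<odot>\<^bsub>M\<^esub> h)) \<cdot>\<^bsub>M\<^esub> assoc M X Y Z"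
    and lunit_nat: "f \<in> hom M X X' \<Longrightarrow>
        lunit M X' \<cdot>\<^bsub>M\<^esub> (ide M (unit M) \<odot>\<^bsub>M\<^esub> f) = f \<cdot>\<^bsub>M\<^esub> lunit M X"
    and runit_nat: "f \<in> hom M X X' \<Longrightarrow>
        runit M X' \<cdot>\<^bsub>M\<^esub> (f \<odot>\<^bsub>M\<^esub> ide M (unit M)) = f \<cdot>\<^bsub>M\<^esub> runit M X"
    and pentagon: "\<lbrakk>W \<in> Obj M; X \<in> Obj M; Y \<in> Obj M; Z \<in> Obj M\<rbrakk> \<Longrightarrow>
        (ide M W \<odot>\<^bsub>M\<^esub> assoc M X Y Z) \<cdot>\<^bsub>M\<^esub> assoc M W (X \<otimes>\<^bsub>M\<^esub> Y) Z
            \<cdot>\<^bsub>M\<^esub> (assoc M W X Y \<odot>\<^bsub>M\<^esub> ide M Z)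
        = assoc M W X (Y \<otimes>\<^bsub>M\<^esub> Z) \<cdot>\<^bsub>M\<^esub> assoc M (W \<otimes>\<^bsub>M\<^esub> X) Y Z"
    and triangle: "\<lbrakk>X \<in> Obj M; Y \<in> Obj M\<rbrakk> \<Longrightarrow>
        (ide M X \<odot>\<^bsub>M\<^esub> lunit M Y) \<cdot>\<^bsub>M\<^esub> assoc M X (unit M) Y = runit M X \<odot>\<^bsub>M\<^esub> ide M Y"

record ('o, 'a) monoid_data =
  mon_obj :: "'o"
  mon_unit :: "'a"
  mon_mult :: "'a"

definition monoid_object :: "('o, 'a, 'z) moncat_scheme \<Rightarrow> ('o, 'a) monoid_data \<Rightarrow> bool" where
  "monoid_object M T \<longleftrightarrow>
     (let X = mon_obj T; e = mon_unit T; m = mon_mult T; i = ide M X in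
       X \<in> Obj M \<and> e \<in> hom M (unit M) X \<and> m \<in> hom M (X \<otimes>\<^bsub>M\<^esub> X) X \<and>
       m \<cdot>\<^bsub>M\<^esub> (m \<odot>\<^bsub>M\<^esub> i) = m \<cdot>\<^bsub>M\<^esub> (i \<odot>\<^bsub>M\<^esub> m) \<cdot>\<^bsub>M\<^esub> assoc M X X X \<and>
       m \<cdot>\<^bsub>M\<^esub> (e \<odot>\<^bsub>M\<^esub> i) = lunit M X \<and>
       m \<cdot>\<^bsub>M\<^esub> (i \<odot>\<^bsub>M\<^esub> e) = runit M X)"

section \<open>Metamodels and models\<close>

record ('mo, 'ma, 'co, 'ca, 'x) metamodel_data =
  mm_fun :: "('mo \<times> 'co \<times> 'co, 'ma \<times> 'ca \<times> 'ca, 'x) setfun"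
  mm_unit :: "'co \<Rightarrow> 'x"
  mm_mult :: "'mo \<Rightarrow> 'mo \<Rightarrow> 'co \<Rightarrow> 'co \<Rightarrow> 'co \<Rightarrow> 'x \<Rightarrow> 'x \<Rightarrow> 'x"

text \<open>
  \<open>PhiO P X A B\<close> is $\Phi_X(A,B)$ and \<open>PhiA P t f g\<close> is $\Phi_t(f,g)$;
  \<open>mm_mult P X Y A B D y x\<close> is $(\overline\phi_{X,Y})_{A,B,D}(y,x)$.
\<close>

abbreviation PhiO :: "('mo, 'ma, 'co, 'ca, 'x) metamodel_data \<Rightarrow> 'mo \<Rightarrow> 'co \<Rightarrow> 'co \<Rightarrow> 'x set" where
  "PhiO P X A B \<equiv> on_obj (mm_fun P) (X, A, B)"

abbreviation PhiA :: "('mo, 'ma, 'co, 'ca, 'x) metamodel_data \<Rightarrow> 'ma \<Rightarrow> 'ca \<Rightarrow> 'ca \<Rightarrow> 'x \<Rightarrow> 'x" where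
  "PhiA P t f g \<equiv> on_arr (mm_fun P) (t, f, g)"

locale metamodel = M: monoidal_category M + C: category C
  for M :: "('mo, 'ma, 'z) moncat_scheme" and C :: "('co, 'ca, 'y) cat_scheme"
    and P :: "('mo, 'ma, 'co, 'ca, 'x) metamodel_data" +
  assumes Phi_functor: "is_setfun (opc M \<times>\<^sub>c opc C \<times>\<^sub>c C) (mm_fun P)"
    and unit_in_Phi: "A \<in> Obj C \<Longrightarrow> mm_unit P A \<in> PhiO P (unit M) A A"
    and unit_extranat: "f \<in> hom C A B \<Longrightarrow>
        PhiA P (ide M (unit M)) (ide C A) f (mm_unit P A)
        = PhiA P (ide M (unit M)) f (ide C B) (mm_unit P B)"
    and mult_in_Phi: "\<lbrakk>X \<in> Obj M; Y \<in> Obj M; A \<in> Obj C; B \<in> Obj C; D \<in> Obj C;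
        y \<in> PhiO P Y B D; x \<in> PhiO P X A B\<rbrakk> \<Longrightarrow>
        mm_mult P X Y A B D y x \<in> PhiO P (Y \<otimes>\<^bsub>M\<^esub> X) A D"
    and mult_nat: "\<lbrakk>s \<in> hom M X' X; t \<in> hom M Y' Y; a \<in> hom C A' A; B \<in> Obj C; d \<in> hom C D D';
        y \<in> PhiO P Y B D; x \<in> PhiO P X A B\<rbrakk> \<Longrightarrow>
        mm_mult P X' Y' A' B D' (PhiA P t (ide C B) d y) (PhiA P s a (ide C B) x)
        = PhiA P (t \<odot>\<^bsub>M\<^esub> s) a d (mm_mult P X Y A B D y x)"
    and mult_extranat: "\<lbrakk>X \<in> Obj M; Y \<in> Obj M; A \<in> Obj C; b \<in> hom C B B'; D \<in> Obj C;
        y \<in> PhiO P Y B' D; x \<in> PhiO P X A B\<rbrakk> \<Longrightarrow>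
        mm_mult P X Y A B' D y (PhiA P (ide M X) (ide C A) b x)
        = mm_mult P X Y A B D (PhiA P (ide M Y) b (ide C D) y) x"
    and mult_assoc: "\<lbrakk>X \<in> Obj M; Y \<in> Obj M; Z \<in> Obj M;
        A \<in> Obj C; B \<in> Obj C; D \<in> Obj C; E \<in> Obj C;
        z \<in> PhiO P Z D E; y \<in> PhiO P Y B D; x \<in> PhiO P X A B\<rbrakk> \<Longrightarrow>
        PhiA P (assoc M Z Y X) (ide C A) (ide C E)
          (mm_mult P (Y \<otimes>\<^bsub>M\<^esub> X) Z A D E z (mm_mult P X Y A B D y x))
        = mm_mult P X (Z \<otimes>\<^bsub>M\<^esub> Y) A B E (mm_mult P Y Z B D E z y) x"
    and mult_unit_left: "\<lbrakk>X \<in> Obj M; A \<in> Obj C; B \<in> Obj C; x \<in> PhiO P X A B\<rbrakk> \<Longrightarrow>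
        mm_mult P X (unit M) A B B (mm_unit P B) x
        = PhiA P (lunit M X) (ide C A) (ide C B) x"
    and mult_unit_right: "\<lbrakk>X \<in> Obj M; A \<in> Obj C; B \<in> Obj C; x \<in> PhiO P X A B\<rbrakk> \<Longrightarrow>
        mm_mult P (unit M) X A A B x (mm_unit P A)
        = PhiA P (runit M X) (ide C A) (ide C B) x"

definition mm_phi :: "('mo, 'ma, 'z) moncat_scheme \<Rightarrow> ('co, 'ca, 'y) cat_scheme
    \<Rightarrow> ('mo, 'ma, 'co, 'ca, 'x) metamodel_data \<Rightarrow> 'co \<Rightarrow> 'co \<Rightarrow> 'ca \<Rightarrow> 'x" where
  "mm_phi M C P A B f = PhiA P (ide M (unit M)) (ide C A) f (mm_unit P A)"

definition models :: "('mo, 'ma, 'z) moncat_scheme \<Rightarrow> ('mo, 'ma) monoid_data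
    \<Rightarrow> ('co, 'ca, 'y) cat_scheme \<Rightarrow> ('mo, 'ma, 'co, 'ca, 'x) metamodel_data \<Rightarrow> ('co \<times> 'x) set" where
  "models M T C P = {(A, \<xi>). A \<in> Obj C \<and> \<xi> \<in> PhiO P (mon_obj T) A A \<and>
     PhiA P (mon_unit T) (ide C A) (ide C A) \<xi> = mm_unit P A \<and>
     PhiA P (mon_mult T) (ide C A) (ide C A) \<xi> = mm_mult P (mon_obj T) (mon_obj T) A A A \<xi> \<xi>}"

definition model_hom :: "('mo, 'ma, 'z) moncat_scheme \<Rightarrow> ('mo, 'ma) monoid_data
    \<Rightarrow> ('co, 'ca, 'y) cat_scheme \<Rightarrow> ('mo, 'ma, 'co, 'ca, 'x) metamodel_data
    \<Rightarrow> 'co \<times> 'x \<Rightarrow> 'co \<times> 'x \<Rightarrow> 'ca set" where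
  "model_hom M T C P = (\<lambda>(A, \<xi>) (B, \<zeta>). {f \<in> hom C A B.
     PhiA P (ide M (mon_obj T)) (ide C A) f \<xi> = PhiA P (ide M (mon_obj T)) f (ide C B) \<zeta>})"

text \<open>An arrow of the category of models is a homomorphism together with its source and target.\<close>

definition Mod :: "('mo, 'ma, 'z) moncat_scheme \<Rightarrow> ('mo, 'ma) monoid_data
    \<Rightarrow> ('co, 'ca, 'y) cat_scheme \<Rightarrow> ('mo, 'ma, 'co, 'ca, 'x) metamodel_data
    \<Rightarrow> ('co \<times> 'x, ('co \<times> 'x) \<times> 'ca \<times> ('co \<times> 'x)) cat" where
  "Mod M T C P =
     \<lparr>Obj = models M T C P,
      Arr = {(s, f, t). s \<in> models M T C P \<and> t \<in> models M T C P \<and> f \<in> model_hom M T C P s t},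
      Dom = (\<lambda>(s, f, t). s), Cod = (\<lambda>(s, f, t). t),
      ide = (\<lambda>s. (s, ide C (fst s), s)),
      cmp = (\<lambda>(_, g, r) (s, f, _). (s, g \<cdot>\<^bsub>C\<^esub> f, r))\<rparr>"

definition Mod_forget :: "('co \<times> 'x, ('co \<times> 'x) \<times> 'ca \<times> ('co \<times> 'x), 'co, 'ca) ftor" where
  "Mod_forget = \<lparr>fobj = fst, farr = (\<lambda>(s, f, t). f)\<rparr>"

section \<open>The augmented simplex category\<close>

text \<open>
  An arrow of \<open>Delta_a\<close> from \<open>n\<close> to \<open>n'\<close> is a triple \<open>(n, n', w)\<close> with \<open>w\<close> a monotone map
  \<open>{..<n} \<rightarrow> {..<n'}\<close>, extended by \<open>undefined\<close>.
\<close>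

definition ord_sum :: "nat \<times> nat \<times> (nat \<Rightarrow> nat) \<Rightarrow> nat \<times> nat \<times> (nat \<Rightarrow> nat)
    \<Rightarrow> nat \<times> nat \<times> (nat \<Rightarrow> nat)" where
  "ord_sum = (\<lambda>(n, n', w) (m, m', v).
     (n + m, n' + m', \<lambda>i\<in>{..<n + m}. if i < n then w i else n' + v (i - n)))"

definition ord_id :: "nat \<Rightarrow> nat \<times> nat \<times> (nat \<Rightarrow> nat)" where
  "ord_id n = (n, n, \<lambda>i\<in>{..<n}. i)"

definition Delta_a :: "(nat, nat \<times> nat \<times> (nat \<Rightarrow> nat)) moncat" where
  "Delta_a =
     \<lparr>Obj = UNIV,
      Arr = {(n, n', w). w \<in> {..<n} \<rightarrow>\<^sub>E {..<n'} \<and> mono_on {..<n} w},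
      Dom = (\<lambda>(n, n', w). n), Cod = (\<lambda>(n, n', w). n'),
      ide = ord_id,
      cmp = (\<lambda>(_, n'', v) (n, _, w). (n, n'', compose {..<n} v w)),
      ten = (+), tenA = ord_sum, unit = 0,
      assoc = (\<lambda>n m k. ord_id (n + m + k)), lunit = ord_id, runit = ord_id\<rparr>"

definition to_one :: "nat \<Rightarrow> nat \<times> nat \<times> (nat \<Rightarrow> nat)" where
  "to_one n = (n, 1, \<lambda>i\<in>{..<n}. 0)"

section \<open>Strong monoidal functors and the functor presented by a monoid\<close>

record ('o, 'a, 'p, 'b) monftor = "('o, 'a, 'p, 'b) ftor" +
  mf_unit :: "'b"
  mf_ten :: "'o \<Rightarrow> 'o \<Rightarrow> 'b"

locale strong_monoidal_functor = N: monoidal_category N + M: monoidal_category M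
  for N :: "('n, 'w, 'y) moncat_scheme" and M :: "('o, 'a, 'z) moncat_scheme"
    and S :: "('n, 'w, 'o, 'a) monftor" +
  assumes S_functor: "is_functor N M S"
    and S_unit_iso: "mf_unit S \<in> iso_hom M (unit M) (fobj S (unit N))"
    and S_ten_iso: "\<lbrakk>n \<in> Obj N; m \<in> Obj N\<rbrakk> \<Longrightarrow>
        mf_ten S n m \<in> iso_hom M (fobj S n \<otimes>\<^bsub>M\<^esub> fobj S m) (fobj S (n \<otimes>\<^bsub>N\<^esub> m))"
    and S_ten_nat: "\<lbrakk>w \<in> hom N n n'; v \<in> hom N m m'\<rbrakk> \<Longrightarrow>
        mf_ten S n' m' \<cdot>\<^bsub>M\<^esub> (farr S w \<odot>\<^bsub>M\<^esub> farr S v) = farr S (w \<odot>\<^bsub>N\<^esub> v) \<cdot>\<^bsub>M\<^esub> mf_ten S n m"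
    and S_assoc: "\<lbrakk>n \<in> Obj N; m \<in> Obj N; k \<in> Obj N\<rbrakk> \<Longrightarrow>
        farr S (assoc N n m k) \<cdot>\<^bsub>M\<^esub> mf_ten S (n \<otimes>\<^bsub>N\<^esub> m) k
            \<cdot>\<^bsub>M\<^esub> (mf_ten S n m \<odot>\<^bsub>M\<^esub> ide M (fobj S k))
        = mf_ten S n (m \<otimes>\<^bsub>N\<^esub> k) \<cdot>\<^bsub>M\<^esub> (ide M (fobj S n) \<odot>\<^bsub>M\<^esub> mf_ten S m k)
            \<cdot>\<^bsub>M\<^esub> assoc M (fobj S n) (fobj S m) (fobj S k)"
    and S_lunit: "n \<in> Obj N \<Longrightarrow>
        farr S (lunit N n) \<cdot>\<^bsub>M\<^esub> mf_ten S (unit N) n \<cdot>\<^bsub>M\<^esub> (mf_unit S \<odot>\<^bsub>M\<^esub> ide M (fobj S n))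
        = lunit M (fobj S n)"
    and S_runit: "n \<in> Obj N \<Longrightarrow>
        farr S (runit N n) \<cdot>\<^bsub>M\<^esub> mf_ten S n (unit N) \<cdot>\<^bsub>M\<^esub> (ide M (fobj S n) \<odot>\<^bsub>M\<^esub> mf_unit S)
        = runit M (fobj S n)"

fun tensor_power :: "('o, 'a, 'z) moncat_scheme \<Rightarrow> 'o \<Rightarrow> nat \<Rightarrow> 'o" where
  "tensor_power M X 0 = unit M"
| "tensor_power M X (Suc 0) = X"
| "tensor_power M X (Suc (Suc n)) = tensor_power M X (Suc n) \<otimes>\<^bsub>M\<^esub> X"

definition corresponds_to_monoid :: "('o, 'a, 'z) moncat_scheme \<Rightarrow> ('o, 'a) monoid_data
    \<Rightarrow> (nat, nat \<times> nat \<times> (nat \<Rightarrow> nat), 'o, 'a) monftor \<Rightarrow> bool" where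
  "corresponds_to_monoid M T S \<longleftrightarrow>
     strong_monoidal_functor Delta_a M S \<and>
     (\<forall>n. fobj S n = tensor_power M (mon_obj T) n) \<and>
     farr S (to_one 0) \<cdot>\<^bsub>M\<^esub> mf_unit S = mon_unit T \<and>
     farr S (to_one 2) \<cdot>\<^bsub>M\<^esub> mf_ten S 1 1 = mon_mult T"

section \<open>The pseudo double category of profunctors\<close>

text \<open>
  Horizontal morphisms \<open>A \<rightarrow> B\<close> are functors \<open>opc A \<times>\<^sub>c B \<rightarrow> SET\<close>, horizontal identities
  are hom-functors, horizontal composition is given by coends, i.e. by quotients of sets of
  triples \<open>(B, y, x)\<close> with \<open>y \<in> K(B, D)\<close>, \<open>x \<in> H(A, B)\<close>. The elements of a composite live
  in another HOL type than those of its factors, so these data are not bundled into one record.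
\<close>

type_synonym ('o, 'a, 'p, 'b, 'x) prof = "('o \<times> 'p, 'a \<times> 'b, 'x) setfun"

definition is_prof :: "('o, 'a, 'z) cat_scheme \<Rightarrow> ('p, 'b, 'y) cat_scheme
    \<Rightarrow> ('o, 'a, 'p, 'b, 'x) prof \<Rightarrow> bool" where
  "is_prof A B H \<longleftrightarrow> is_setfun (opc A \<times>\<^sub>c B) H"

definition hom_prof :: "('o, 'a, 'z) cat_scheme \<Rightarrow> ('o, 'a, 'o, 'a, 'a) prof" where
  "hom_prof C = \<lparr>on_obj = (\<lambda>(A, B). hom C A B), on_arr = (\<lambda>(a, b) f. b \<cdot>\<^bsub>C\<^esub> f \<cdot>\<^bsub>C\<^esub> a)\<rparr>"

definition coend_elems :: "('p, 'b, 'y) cat_scheme \<Rightarrow> ('p, 'b, 'q, 'd, 'v) prof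
    \<Rightarrow> ('o, 'a, 'p, 'b, 'u) prof \<Rightarrow> 'o \<Rightarrow> 'q \<Rightarrow> ('p \<times> 'v \<times> 'u) set" where
  "coend_elems B K H X Z =
     {(Y, k, h). Y \<in> Obj B \<and> k \<in> on_obj K (Y, Z) \<and> h \<in> on_obj H (X, Y)}"

definition coend_step :: "('o, 'a, 'z) cat_scheme \<Rightarrow> ('p, 'b, 'y) cat_scheme
    \<Rightarrow> ('q, 'd, 'x) cat_scheme \<Rightarrow> ('p, 'b, 'q, 'd, 'v) prof \<Rightarrow> ('o, 'a, 'p, 'b, 'u) prof
    \<Rightarrow> 'o \<Rightarrow> 'q \<Rightarrow> ('p \<times> 'v \<times> 'u) rel" where
  "coend_step A B D K H X Z =
     {((Y, on_arr K (b, ide D Z) k, h), (Y', k, on_arr H (ide A X, b) h)) | Y Y' b k h.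
        Y \<in> Obj B \<and> Y' \<in> Obj B \<and> b \<in> hom B Y Y' \<and> k \<in> on_obj K (Y', Z) \<and> h \<in> on_obj H (X, Y)}"

definition coend_class :: "('o, 'a, 'z) cat_scheme \<Rightarrow> ('p, 'b, 'y) cat_scheme
    \<Rightarrow> ('q, 'd, 'x) cat_scheme \<Rightarrow> ('p, 'b, 'q, 'd, 'v) prof \<Rightarrow> ('o, 'a, 'p, 'b, 'u) prof
    \<Rightarrow> 'o \<Rightarrow> 'q \<Rightarrow> 'p \<times> 'v \<times> 'u \<Rightarrow> ('p \<times> 'v \<times> 'u) set" where
  "coend_class A B D K H X Z p =
     {q. (p, q) \<in> (coend_step A B D K H X Z \<union> (coend_step A B D K H X Z)\<inverse>)\<^sup>*}"

text \<open>\<open>prof_comp A B D K H\<close> is the composite of \<open>H : A \<rightarrow> B\<close> and \<open>K : B \<rightarrow> D\<close>.\<close>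

definition prof_comp :: "('o, 'a, 'z) cat_scheme \<Rightarrow> ('p, 'b, 'y) cat_scheme
    \<Rightarrow> ('q, 'd, 'x) cat_scheme \<Rightarrow> ('p, 'b, 'q, 'd, 'v) prof \<Rightarrow> ('o, 'a, 'p, 'b, 'u) prof
    \<Rightarrow> ('o, 'a, 'q, 'd, ('p \<times> 'v \<times> 'u) set) prof" where
  "prof_comp A B D K H =
     \<lparr>on_obj = (\<lambda>(X, Z). coend_class A B D K H X Z ` coend_elems B K H X Z),
      on_arr = (\<lambda>(a, d) c. \<Union>(Y, k, h)\<in>c. coend_class A B D K H (Dom A a) (Cod D d)
                  (Y, on_arr K (ide B Y, d) k, on_arr H (a, ide B Y) h))\<rparr>"

text \<open>\<open>square A B A' B' F G H H' \<theta>\<close>: \<open>\<theta>\<close> is a square with vertical sides \<open>F\<close>, \<open>G\<close> and horizontal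
  sides \<open>H\<close> (top), \<open>H'\<close> (bottom).\<close>

definition square :: "('o, 'a, 'z) cat_scheme \<Rightarrow> ('p, 'b, 'y) cat_scheme
    \<Rightarrow> ('o2, 'a2, 'z2) cat_scheme \<Rightarrow> ('p2, 'b2, 'y2) cat_scheme
    \<Rightarrow> ('o, 'a, 'o2, 'a2) ftor \<Rightarrow> ('p, 'b, 'p2, 'b2) ftor
    \<Rightarrow> ('o, 'a, 'p, 'b, 'u) prof \<Rightarrow> ('o2, 'a2, 'p2, 'b2, 'v) prof
    \<Rightarrow> ('o \<Rightarrow> 'p \<Rightarrow> 'u \<Rightarrow> 'v) \<Rightarrow> bool" where
  "square A B A' B' F G H H' \<theta> \<longleftrightarrow>
     (\<forall>X\<in>Obj A. \<forall>Y\<in>Obj B. \<forall>x\<in>on_obj H (X, Y). \<theta> X Y x \<in> on_obj H' (fobj F X, fobj G Y)) \<and>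
     (\<forall>X\<in>Obj A. \<forall>X'\<in>Obj A. \<forall>Y\<in>Obj B. \<forall>Y'\<in>Obj B.
        \<forall>a\<in>hom A X' X. \<forall>b\<in>hom B Y Y'. \<forall>x\<in>on_obj H (X, Y).
          \<theta> X' Y' (on_arr H (a, b) x) = on_arr H' (farr F a, farr G b) (\<theta> X Y x))"

definition id_ftor :: "('o, 'a, 'o, 'a) ftor" where
  "id_ftor = \<lparr>fobj = (\<lambda>X. X), farr = (\<lambda>f. f)\<rparr>"

section \<open>Lax double functors from a monoidal category to profunctors\<close>

text \<open>
  Data of a lax double functor from \<open>\<H>\<Sigma>(N\<^sup>o\<^sup>p)\<close>: the image of the unique object, of the
  horizontal morphisms (the objects of \<open>N\<close>), of the squares (the arrows of \<open>N\<close>, reversed), and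
  the laxity constraints, i.e. squares from the horizontal identity to the image of \<open>unit N\<close> and
  from the composite of \<open>lf_hor m\<close> followed by \<open>lf_hor n\<close> to \<open>lf_hor (n \<otimes> m)\<close>. The only vertical
  morphism is an identity.
\<close>

record ('n, 'w, 'o, 'a, 'x) lax_data =
  lf_cat :: "('o, 'a) cat"
  lf_hor :: "'n \<Rightarrow> ('o, 'a, 'o, 'a, 'x) prof"
  lf_sq :: "'w \<Rightarrow> 'o \<Rightarrow> 'o \<Rightarrow> 'x \<Rightarrow> 'x"
  lf_unit :: "'o \<Rightarrow> 'o \<Rightarrow> 'a \<Rightarrow> 'x"
  lf_comp :: "'n \<Rightarrow> 'n \<Rightarrow> 'o \<Rightarrow> 'o \<Rightarrow> ('o \<times> 'x \<times> 'x) set \<Rightarrow> 'x"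

text \<open>
  \<open>lf_apply F n m A B D y x\<close> is the composition constraint at the class of \<open>(B, y, x)\<close>
  in the coend.
\<close>

definition lf_apply :: "('n, 'w, 'o, 'a, 'x) lax_data \<Rightarrow> 'n \<Rightarrow> 'n \<Rightarrow> 'o \<Rightarrow> 'o \<Rightarrow> 'o \<Rightarrow> 'x \<Rightarrow> 'x \<Rightarrow> 'x" where
  "lf_apply F n m A B D y x =
     lf_comp F n m A D
       (coend_class (lf_cat F) (lf_cat F) (lf_cat F) (lf_hor F n) (lf_hor F m) A D (B, y, x))"

locale lax_double_functor = N: monoidal_category N + C: category "lf_cat F"
  for N :: "('n, 'w, 'z) moncat_scheme" and F :: "('n, 'w, 'o, 'a, 'x) lax_data" +
  assumes hor_prof: "n \<in> Obj N \<Longrightarrow> is_prof (lf_cat F) (lf_cat F) (lf_hor F n)"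
    and sq_square: "w \<in> hom N n n' \<Longrightarrow>
        square (lf_cat F) (lf_cat F) (lf_cat F) (lf_cat F) id_ftor id_ftor
          (lf_hor F n') (lf_hor F n) (lf_sq F w)"
    and sq_ide: "\<lbrakk>n \<in> Obj N; A \<in> Obj (lf_cat F); B \<in> Obj (lf_cat F); x \<in> on_obj (lf_hor F n) (A, B)\<rbrakk>
        \<Longrightarrow> lf_sq F (ide N n) A B x = x"
    and sq_cmp: "\<lbrakk>w \<in> hom N n n'; w' \<in> hom N n' n''; A \<in> Obj (lf_cat F); B \<in> Obj (lf_cat F);
        x \<in> on_obj (lf_hor F n'') (A, B)\<rbrakk>
        \<Longrightarrow> lf_sq F (w' \<cdot>\<^bsub>N\<^esub> w) A B x = lf_sq F w A B (lf_sq F w' A B x)"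
    and unit_square:
        "square (lf_cat F) (lf_cat F) (lf_cat F) (lf_cat F) id_ftor id_ftor
          (hom_prof (lf_cat F)) (lf_hor F (unit N)) (lf_unit F)"
    and comp_square: "\<lbrakk>n \<in> Obj N; m \<in> Obj N\<rbrakk> \<Longrightarrow>
        square (lf_cat F) (lf_cat F) (lf_cat F) (lf_cat F) id_ftor id_ftor
          (prof_comp (lf_cat F) (lf_cat F) (lf_cat F) (lf_hor F n) (lf_hor F m))
          (lf_hor F (n \<otimes>\<^bsub>N\<^esub> m)) (lf_comp F n m)"
    and comp_nat: "\<lbrakk>w \<in> hom N n n'; v \<in> hom N m m';
        A \<in> Obj (lf_cat F); B \<in> Obj (lf_cat F); D \<in> Obj (lf_cat F);
        y \<in> on_obj (lf_hor F n') (B, D); x \<in> on_obj (lf_hor F m') (A, B)\<rbrakk>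
        \<Longrightarrow> lf_sq F (w \<odot>\<^bsub>N\<^esub> v) A D (lf_apply F n' m' A B D y x)
          = lf_apply F n m A B D (lf_sq F w B D y) (lf_sq F v A B x)"
    and comp_assoc: "\<lbrakk>n \<in> Obj N; m \<in> Obj N; k \<in> Obj N;
        A \<in> Obj (lf_cat F); B \<in> Obj (lf_cat F); D \<in> Obj (lf_cat F); E \<in> Obj (lf_cat F);
        z \<in> on_obj (lf_hor F n) (D, E); y \<in> on_obj (lf_hor F m) (B, D);
        x \<in> on_obj (lf_hor F k) (A, B)\<rbrakk>
        \<Longrightarrow> lf_sq F (assoc N n m k) A E
              (lf_apply F n (m \<otimes>\<^bsub>N\<^esub> k) A D E z (lf_apply F m k A B D y x))
          = lf_apply F (n \<otimes>\<^bsub>N\<^esub> m) k A B E (lf_apply F n m B D E z y) x"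
    and comp_unit_left: "\<lbrakk>n \<in> Obj N; A \<in> Obj (lf_cat F); B \<in> Obj (lf_cat F); D \<in> Obj (lf_cat F);
        f \<in> hom (lf_cat F) B D; x \<in> on_obj (lf_hor F n) (A, B)\<rbrakk>
        \<Longrightarrow> lf_apply F (unit N) n A B D (lf_unit F B D f) x
          = lf_sq F (lunit N n) A D (on_arr (lf_hor F n) (ide (lf_cat F) A, f) x)"
    and comp_unit_right: "\<lbrakk>n \<in> Obj N; A \<in> Obj (lf_cat F); B \<in> Obj (lf_cat F); D \<in> Obj (lf_cat F);
        f \<in> hom (lf_cat F) A B; x \<in> on_obj (lf_hor F n) (B, D)\<rbrakk>
        \<Longrightarrow> lf_apply F n (unit N) A B D x (lf_unit F A B f)
          = lf_sq F (runit N n) A D (on_arr (lf_hor F n) (f, ide (lf_cat F) D) x)"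

text \<open>
  $\Phi(\mathsf T)$ for a strong monoidal functor \<open>S\<close>. The composition constraint is the map out
  of the coend induced by $\overline\phi$, hence is computed on any representative of a class.
\<close>

definition Phi_lax :: "('mo, 'ma, 'z) moncat_scheme \<Rightarrow> ('co, 'ca) cat
    \<Rightarrow> ('mo, 'ma, 'co, 'ca, 'x) metamodel_data \<Rightarrow> ('n, 'w, 'mo, 'ma) monftor
    \<Rightarrow> ('n, 'w, 'co, 'ca, 'x) lax_data" where
  "Phi_lax M C P S =
     \<lparr>lf_cat = C,
      lf_hor = (\<lambda>n. \<lparr>on_obj = (\<lambda>(A, B). PhiO P (fobj S n) A B),
                     on_arr = (\<lambda>(a, b). PhiA P (ide M (fobj S n)) a b)\<rparr>),
      lf_sq = (\<lambda>w A B. PhiA P (farr S w) (ide C A) (ide C B)),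
      lf_unit = (\<lambda>A B f. PhiA P (arr_inv M (mf_unit S)) (ide C A) (ide C B) (mm_phi M C P A B f)),
      lf_comp = (\<lambda>n m A D c. PhiA P (arr_inv M (mf_ten S n m)) (ide C A) (ide C D)
         (the_elem ((\<lambda>(B, y, x). mm_mult P (fobj S m) (fobj S n) A B D y x) ` c)))\<rparr>"

section \<open>Double limits\<close>

definition vertical_double_cone :: "('n, 'w, 'z) moncat_scheme \<Rightarrow> ('n, 'w, 'o, 'a, 'x) lax_data
    \<Rightarrow> ('p, 'q) cat \<Rightarrow> ('p, 'q, 'o, 'a) ftor \<Rightarrow> ('n \<Rightarrow> 'p \<Rightarrow> 'p \<Rightarrow> 'q \<Rightarrow> 'x) \<Rightarrow> bool" where
  "vertical_double_cone N F A V v \<longleftrightarrow>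
     category A \<and> is_functor A (lf_cat F) V \<and>
     (\<forall>n\<in>Obj N. square A A (lf_cat F) (lf_cat F) V V (hom_prof A) (lf_hor F n) (v n)) \<and>
     (\<forall>X\<in>Obj A. \<forall>Y\<in>Obj A. \<forall>f\<in>hom A X Y.
        v (unit N) X Y f = lf_unit F (fobj V X) (fobj V Y) (farr V f)) \<and>
     (\<forall>n\<in>Obj N. \<forall>m\<in>Obj N. \<forall>X\<in>Obj A. \<forall>Y\<in>Obj A. \<forall>Z\<in>Obj A. \<forall>h\<in>hom A X Y. \<forall>g\<in>hom A Y Z.
        v (n \<otimes>\<^bsub>N\<^esub> m) X Z (g \<cdot>\<^bsub>A\<^esub> h)
        = lf_apply F n m (fobj V X) (fobj V Y) (fobj V Z) (v n Y Z g) (v m X Y h)) \<and>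
     (\<forall>n\<in>Obj N. \<forall>n'\<in>Obj N. \<forall>w\<in>hom N n n'. \<forall>X\<in>Obj A. \<forall>Y\<in>Obj A. \<forall>f\<in>hom A X Y.
        v n X Y f = lf_sq F w (fobj V X) (fobj V Y) (v n' X Y f))"

definition cone_factor :: "('n, 'w, 'z) moncat_scheme
    \<Rightarrow> ('l, 'k) cat \<Rightarrow> ('l, 'k, 'o, 'a) ftor \<Rightarrow> ('n \<Rightarrow> 'l \<Rightarrow> 'l \<Rightarrow> 'k \<Rightarrow> 'x)
    \<Rightarrow> ('p, 'q) cat \<Rightarrow> ('p, 'q, 'o, 'a) ftor \<Rightarrow> ('n \<Rightarrow> 'p \<Rightarrow> 'p \<Rightarrow> 'q \<Rightarrow> 'x)
    \<Rightarrow> ('p, 'q, 'l, 'k) ftor \<Rightarrow> bool" where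
  "cone_factor N L U u A V v K \<longleftrightarrow>
     is_functor A L K \<and>
     (\<forall>X\<in>Obj A. fobj U (fobj K X) = fobj V X) \<and>
     (\<forall>f\<in>Arr A. farr U (farr K f) = farr V f) \<and>
     (\<forall>n\<in>Obj N. \<forall>X\<in>Obj A. \<forall>Y\<in>Obj A. \<forall>f\<in>hom A X Y.
        u n (fobj K X) (fobj K Y) (farr K f) = v n X Y f)"

text \<open>
  The first argument only names the types carrying the test cones \<open>(A, V, v)\<close>, \<open>(A', V', v')\<close> and
  the test profunctor \<open>H\<close>; in a theorem these are type variables, hence arbitrary.
\<close>

definition double_limit :: "('p \<times> 'q \<times> 'p2 \<times> 'q2 \<times> 'h) itself
    \<Rightarrow> ('n, 'w, 'z) moncat_scheme \<Rightarrow> ('n, 'w, 'o, 'a, 'x) lax_data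
    \<Rightarrow> ('l, 'k) cat \<Rightarrow> ('l, 'k, 'o, 'a) ftor \<Rightarrow> ('n \<Rightarrow> 'l \<Rightarrow> 'l \<Rightarrow> 'k \<Rightarrow> 'x) \<Rightarrow> bool" where
  "double_limit TY N F L U u \<longleftrightarrow>
     lax_double_functor N F \<and>
     vertical_double_cone N F L U u \<and>
     (\<forall>(A :: ('p, 'q) cat) V v. vertical_double_cone N F A V v \<longrightarrow>
        (\<exists>K. cone_factor N L U u A V v K \<and>
             (\<forall>K'. cone_factor N L U u A V v K' \<longrightarrow> functor_eq A K' K))) \<and>
     (\<forall>(A :: ('p, 'q) cat) V v K (A' :: ('p2, 'q2) cat) V' v' K'
        (H :: ('p, 'q, 'p2, 'q2, 'h) prof) \<theta>.
        vertical_double_cone N F A V v \<and> cone_factor N L U u A V v K \<and>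
        vertical_double_cone N F A' V' v' \<and> cone_factor N L U u A' V' v' K' \<and>
        is_prof A A' H \<and>
        square A A' (lf_cat F) (lf_cat F) V V' H (hom_prof (lf_cat F)) \<theta> \<and>
        (\<forall>n\<in>Obj N. \<forall>X\<in>Obj A. \<forall>X'\<in>Obj A'. \<forall>x\<in>on_obj H (X, X').
           on_arr (lf_hor F n) (ide (lf_cat F) (fobj V X), \<theta> X X' x) (v n X X (ide A X))
           = on_arr (lf_hor F n) (\<theta> X X' x, ide (lf_cat F) (fobj V' X')) (v' n X' X' (ide A' X')))
        \<longrightarrow>
        (let lifts = (\<lambda>\<sigma>. square A A' L L K K' H (hom_prof L) \<sigma> \<and>
               (\<forall>X\<in>Obj A. \<forall>X'\<in>Obj A'. \<forall>x\<in>on_obj H (X, X'). farr U (\<sigma> X X' x) = \<theta> X X' x))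
         in \<exists>\<sigma>. lifts \<sigma> \<and>
              (\<forall>\<tau>. lifts \<tau> \<longrightarrow>
                 (\<forall>X\<in>Obj A. \<forall>X'\<in>Obj A'. \<forall>x\<in>on_obj H (X, X'). \<tau> X X' x = \<sigma> X X' x))))"

end

theory Submission
  imports Defs
begin

text \<open>
  Every monotone map with codomain $n+1$ is uniquely $w\oplus(k\to 1)$, so the functor presented by
  $\mathsf T$ is defined by recursion on the codomain, using the $k$-fold multiplications for the
  maps $k\to 1$; functoriality reduces to coherence of the rebracketing isomorphisms
  $T^{\otimes n}\otimes T^{\otimes k}\cong T^{\otimes(n+k)}$.

  Since every object of $\Delta_a$ is a sum of copies of $\mathbf 1$, a vertical double cone is
  determined by its vertical part and its component at $\mathbf 1$: compatibility with sums forces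
  $v_{\mathbf n}(\mathrm{id})$ to be the $n$-fold composite of $\xi = v_{\mathbf 1}(\mathrm{id})$,
  and the maps $\mathbf 0\to\mathbf 1$, $\mathbf 2\to\mathbf 1$ say precisely that $\xi$ is a model.
\<close>

section \<open>Calculation in categories\<close>

text \<open>The functor built from \<open>T\<close> only settles existence. The limit property is
  proved for every \<open>S\<close> with \<open>corresponds_to_monoid M T S\<close>, from strong
  monoidality and the values of \<open>S\<close> at \<open>1\<close>, \<open>to_one 0\<close> and
  \<open>to_one 2\<close>. The equations involve inverses of coherence isomorphisms: on the monoidal
  side through \<open>join\<close> and \<open>nfold\<close>, on the metamodel side because Phi is
  contravariant in \<open>M\<close>, so that the structure isomorphisms of \<open>S\<close> enter
  the laxity constraints inverted. Most such equations are proved by composing both sides with an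
  isomorphism, usually \<open>?h\<close>, that absorbs the inverses, and then cancelling it. Cone
  conditions concern all arrows, not just identities. Naturality gives \<open>v n X Y f\<close> as
  the value at an identity acted on by \<open>f\<close> from either side (a Yoneda argument);
  equality of the two descriptions at \<open>1\<close> is the homomorphism condition. Conversely, a
  homomorphism is defined by a condition at \<open>1\<close>, while the universal cone needs it at
  every ordinal; \<open>iter_hom\<close> propagates it, using extranaturality in the middle
  object.\<close>

definition is_iso :: "('o, 'a, 'z) cat_scheme \<Rightarrow> 'a \<Rightarrow> bool" where
  "is_iso C f \<longleftrightarrow> f \<in> iso_hom C (Dom C f) (Cod C f)"

lemma homI [intro?]: "\<lbrakk>f \<in> Arr C; Dom C f = A; Cod C f = B\<rbrakk> \<Longrightarrow> f \<in> hom C A B"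
  by (simp add: hom_def)

lemma homD:
  assumes "f \<in> hom C A B"
  shows "f \<in> Arr C" "Dom C f = A" "Cod C f = B"
  using assms by (auto simp: hom_def)

lemma iso_homD:
  assumes "f \<in> iso_hom C A B"
  shows "is_iso C f" "f \<in> Arr C" "Dom C f = A" "Cod C f = B"
  using assms by (auto simp: is_iso_def iso_hom_def hom_def)

lemma is_iso_in_iso_hom: "\<lbrakk>is_iso C f; Dom C f = A; Cod C f = B\<rbrakk> \<Longrightarrow> f \<in> iso_hom C A B"
  by (auto simp: is_iso_def)

context category
begin

text \<open>Composability is expressed by equations between \<open>Dom\<close> and
  \<open>Cod\<close> instead of membership in hom-sets, so the simplifier computes types and never
  has to guess a middle object.\<close>

lemma cmp_arr [simp]:
  assumes "f \<in> Arr C" "g \<in> Arr C" "Cod C f = Dom C g"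
  shows "g \<cdot>\<^bsub>C\<^esub> f \<in> Arr C" "Dom C (g \<cdot>\<^bsub>C\<^esub> f) = Dom C f" "Cod C (g \<cdot>\<^bsub>C\<^esub> f) = Cod C g"
  using cmp_in[of f "Dom C f" "Cod C f" g "Cod C g"] assms by (auto simp: hom_def)

lemma ide_arr [simp]:
  assumes "A \<in> Obj C"
  shows "ide C A \<in> Arr C" "Dom C (ide C A) = A" "Cod C (ide C A) = A"
  using ide_in[OF assms] by (auto simp: hom_def)

lemma dom_cod_in [simp]:
  assumes "f \<in> Arr C"
  shows "Dom C f \<in> Obj C" "Cod C f \<in> Obj C"
  using assms by (simp_all add: dom_in cod_in)

lemma cmp_ide [simp]:
  assumes "f \<in> Arr C"
  shows "Cod C f = B \<Longrightarrow> ide C B \<cdot>\<^bsub>C\<^esub> f = f" "Dom C f = A \<Longrightarrow> f \<cdot>\<^bsub>C\<^esub> ide C A = f"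
  using assms ide_left[of f "Dom C f" "Cod C f"] ide_right[of f "Dom C f" "Cod C f"]
  by (auto simp: hom_def)

lemma cmp_cmp:
  assumes "f \<in> Arr C" "g \<in> Arr C" "h \<in> Arr C" "Cod C f = Dom C g" "Cod C g = Dom C h"
  shows "(h \<cdot>\<^bsub>C\<^esub> g) \<cdot>\<^bsub>C\<^esub> f = h \<cdot>\<^bsub>C\<^esub> (g \<cdot>\<^bsub>C\<^esub> f)"
  using cmp_assoc[of f "Dom C f" "Cod C f" g "Cod C g" h "Cod C h"] assms by (auto simp: hom_def)

lemma inverse_unique:
  assumes "f \<in> Arr C" "is_inverse C f g" "is_inverse C f h"
  shows "g = h"
proof -
  have g: "g \<in> Arr C" "Dom C g = Cod C f" "Cod C g = Dom C f" "g \<cdot>\<^bsub>C\<^esub> f = ide C (Dom C f)"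
    and h: "h \<in> Arr C" "Dom C h = Cod C f" "Cod C h = Dom C f" "f \<cdot>\<^bsub>C\<^esub> h = ide C (Cod C f)"
    using assms by (auto simp: is_inverse_def hom_def)
  have "(g \<cdot>\<^bsub>C\<^esub> f) \<cdot>\<^bsub>C\<^esub> h = g \<cdot>\<^bsub>C\<^esub> (f \<cdot>\<^bsub>C\<^esub> h)"
    by (rule cmp_cmp) (use g h assms(1) in simp_all)
  then show ?thesis using g h by simp
qed

lemma arr_inv_inverse:
  assumes "is_iso C f"
  shows "is_inverse C f (arr_inv C f)"
proof -
  obtain g where "f \<in> Arr C" "is_inverse C f g"
    using assms by (auto simp: is_iso_def iso_hom_def hom_def)
  then show ?thesis
    unfolding arr_inv_def by (metis inverse_unique theI)
qed

lemma is_iso_arr: "is_iso C f \<Longrightarrow> f \<in> Arr C"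
  by (auto simp: is_iso_def iso_hom_def hom_def)

lemma arr_inv_arr [simp]:
  assumes "is_iso C f"
  shows "arr_inv C f \<in> Arr C" "Dom C (arr_inv C f) = Cod C f" "Cod C (arr_inv C f) = Dom C f"
    "arr_inv C f \<cdot>\<^bsub>C\<^esub> f = ide C (Dom C f)" "f \<cdot>\<^bsub>C\<^esub> arr_inv C f = ide C (Cod C f)"
  using arr_inv_inverse[OF assms] by (auto simp: is_inverse_def hom_def)

lemma arr_inv_cancel [simp]:
  assumes "is_iso C f" "h \<in> Arr C"
  shows "Cod C h = Dom C f \<Longrightarrow> arr_inv C f \<cdot>\<^bsub>C\<^esub> (f \<cdot>\<^bsub>C\<^esub> h) = h"
    "Cod C h = Cod C f \<Longrightarrow> f \<cdot>\<^bsub>C\<^esub> (arr_inv C f \<cdot>\<^bsub>C\<^esub> h) = h"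
proof -
  note f = is_iso_arr[OF assms(1)]
  { assume *: "Cod C h = Dom C f"
    have "(arr_inv C f \<cdot>\<^bsub>C\<^esub> f) \<cdot>\<^bsub>C\<^esub> h = arr_inv C f \<cdot>\<^bsub>C\<^esub> (f \<cdot>\<^bsub>C\<^esub> h)"
      by (rule cmp_cmp) (use assms f * in auto)
    then show "arr_inv C f \<cdot>\<^bsub>C\<^esub> (f \<cdot>\<^bsub>C\<^esub> h) = h" using assms * by simp }
  { assume *: "Cod C h = Cod C f"
    have "(f \<cdot>\<^bsub>C\<^esub> arr_inv C f) \<cdot>\<^bsub>C\<^esub> h = f \<cdot>\<^bsub>C\<^esub> (arr_inv C f \<cdot>\<^bsub>C\<^esub> h)"
      by (rule cmp_cmp) (use assms f * in auto)
    then show "f \<cdot>\<^bsub>C\<^esub> (arr_inv C f \<cdot>\<^bsub>C\<^esub> h) = h" using assms * by simp }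
qed

lemma is_isoI:
  assumes "f \<in> Arr C" "g \<in> Arr C" "Dom C g = Cod C f" "Cod C g = Dom C f"
    "g \<cdot>\<^bsub>C\<^esub> f = ide C (Dom C f)" "f \<cdot>\<^bsub>C\<^esub> g = ide C (Cod C f)"
  shows "is_iso C f"
  using assms by (auto simp: is_iso_def iso_hom_def hom_def is_inverse_def)

lemma is_iso_inv [simp]: "is_iso C f \<Longrightarrow> is_iso C (arr_inv C f)"
  by (rule is_isoI[of _ f]) (auto simp: is_iso_arr)

lemma is_iso_ide [simp]: "A \<in> Obj C \<Longrightarrow> is_iso C (ide C A)"
  by (rule is_isoI[of _ "ide C A"]) auto

lemma is_iso_cmp [simp]:
  assumes "is_iso C f" "is_iso C g" "Cod C f = Dom C g"
  shows "is_iso C (g \<cdot>\<^bsub>C\<^esub> f)"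
  using assms is_iso_arr[OF assms(1)] is_iso_arr[OF assms(2)]
  by (intro is_isoI[of _ "arr_inv C f \<cdot>\<^bsub>C\<^esub> arr_inv C g"]) (simp_all add: cmp_cmp)

text \<open>Main device for equations containing inverses: \<open>h\<close> is chosen so that the
  inverses disappear after composing with it.\<close>

lemma iso_cancel_right:
  assumes "f \<cdot>\<^bsub>C\<^esub> h = g \<cdot>\<^bsub>C\<^esub> h" "is_iso C h" "f \<in> Arr C" "g \<in> Arr C" "Cod C h = Dom C f" "Cod C h = Dom C g"
  shows "f = g"
proof -
  note h = is_iso_arr[OF assms(2)]
  have "f = (f \<cdot>\<^bsub>C\<^esub> h) \<cdot>\<^bsub>C\<^esub> arr_inv C h" using assms(2,3,5) h by (simp add: cmp_cmp)
  also have "\<dots> = (g \<cdot>\<^bsub>C\<^esub> h) \<cdot>\<^bsub>C\<^esub> arr_inv C h" by (simp add: assms(1))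
  also have "\<dots> = g" using assms(2,4,6) h by (simp add: cmp_cmp)
  finally show ?thesis .
qed

lemma iso_cancel_left:
  assumes "h \<cdot>\<^bsub>C\<^esub> f = h \<cdot>\<^bsub>C\<^esub> g" "is_iso C h" "f \<in> Arr C" "g \<in> Arr C" "Cod C f = Dom C h" "Cod C g = Dom C h"
  shows "f = g"
proof -
  have "f = arr_inv C h \<cdot>\<^bsub>C\<^esub> (h \<cdot>\<^bsub>C\<^esub> f)" using assms(2,3,5) by simp
  also have "\<dots> = arr_inv C h \<cdot>\<^bsub>C\<^esub> (h \<cdot>\<^bsub>C\<^esub> g)" by (simp add: assms(1))
  also have "\<dots> = g" using assms(2,4,6) by simp
  finally show ?thesis .
qed

end

section \<open>Coherence in monoidal categories\<close>

context monoidal_category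
begin

lemma ten_obj [simp]: "\<lbrakk>X \<in> Obj M; Y \<in> Obj M\<rbrakk> \<Longrightarrow> X \<otimes>\<^bsub>M\<^esub> Y \<in> Obj M"
  using tensor_functor by (auto simp: is_functor_def prodc_def)

lemma tenA_arr [simp]:
  assumes "f \<in> Arr M" "g \<in> Arr M"
  shows "f \<odot>\<^bsub>M\<^esub> g \<in> Arr M" "Dom M (f \<odot>\<^bsub>M\<^esub> g) = Dom M f \<otimes>\<^bsub>M\<^esub> Dom M g"
    "Cod M (f \<odot>\<^bsub>M\<^esub> g) = Cod M f \<otimes>\<^bsub>M\<^esub> Cod M g"
proof -
  have "f \<odot>\<^bsub>M\<^esub> g \<in> hom M (Dom M f \<otimes>\<^bsub>M\<^esub> Dom M g) (Cod M f \<otimes>\<^bsub>M\<^esub> Cod M g)" (is ?hom)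
  proof -
    let ?F = "\<lparr>fobj = (\<lambda>(X, Y). X \<otimes>\<^bsub>M\<^esub> Y), farr = (\<lambda>(f, g). f \<odot>\<^bsub>M\<^esub> g)\<rparr>"
    have "\<forall>A\<in>Obj (M \<times>\<^sub>c M). \<forall>B\<in>Obj (M \<times>\<^sub>c M). \<forall>f\<in>hom (M \<times>\<^sub>c M) A B.
          farr ?F f \<in> hom M (fobj ?F A) (fobj ?F B)"
      using tensor_functor unfolding is_functor_def by blast
    from this[rule_format, of "(Dom M f, Dom M g)" "(Cod M f, Cod M g)" "(f, g)"]
    show ?hom using assms by (simp add: prodc_def hom_def)
  qed
  then show "f \<odot>\<^bsub>M\<^esub> g \<in> Arr M" "Dom M (f \<odot>\<^bsub>M\<^esub> g) = Dom M f \<otimes>\<^bsub>M\<^esub> Dom M g"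
    "Cod M (f \<odot>\<^bsub>M\<^esub> g) = Cod M f \<otimes>\<^bsub>M\<^esub> Cod M g" by (auto simp: hom_def)
qed

lemma tenA_ide [simp]: "\<lbrakk>X \<in> Obj M; Y \<in> Obj M\<rbrakk> \<Longrightarrow> ide M X \<odot>\<^bsub>M\<^esub> ide M Y = ide M (X \<otimes>\<^bsub>M\<^esub> Y)"
  using tensor_functor by (auto simp: is_functor_def prodc_def)

lemma interchange:
  assumes "f \<in> Arr M" "f' \<in> Arr M" "g \<in> Arr M" "g' \<in> Arr M" "Cod M f' = Dom M f" "Cod M g' = Dom M g"
  shows "(f \<odot>\<^bsub>M\<^esub> g) \<cdot>\<^bsub>M\<^esub> (f' \<odot>\<^bsub>M\<^esub> g') = (f \<cdot>\<^bsub>M\<^esub> f') \<odot>\<^bsub>M\<^esub> (g \<cdot>\<^bsub>M\<^esub> g')"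
proof -
  let ?F = "\<lparr>fobj = (\<lambda>(X, Y). X \<otimes>\<^bsub>M\<^esub> Y), farr = (\<lambda>(f, g). f \<odot>\<^bsub>M\<^esub> g)\<rparr>"
  have "\<forall>A\<in>Obj (M \<times>\<^sub>c M). \<forall>B\<in>Obj (M \<times>\<^sub>c M). \<forall>E\<in>Obj (M \<times>\<^sub>c M). \<forall>f\<in>hom (M \<times>\<^sub>c M) A B. \<forall>g\<in>hom (M \<times>\<^sub>c M) B E.
        farr ?F (g \<cdot>\<^bsub>(M \<times>\<^sub>c M)\<^esub> f) = farr ?F g \<cdot>\<^bsub>M\<^esub> farr ?F f"
    using tensor_functor unfolding is_functor_def by blast
  from this[rule_format, of "(Dom M f', Dom M g')" "(Cod M f', Cod M g')" "(Cod M f, Cod M g)" "(f', g')" "(f, g)"]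
  show ?thesis using assms by (simp add: prodc_def hom_def)
qed

text \<open>Normal forms under \<open>cmp_cmp\<close> are associated to the right, so a redex
  usually has a tail \<open>h\<close> behind it. This and the other \<open>_cmp\<close> variants
  rewrite in that position.\<close>

lemma interchange_cmp:
  assumes "f \<in> Arr M" "f' \<in> Arr M" "g \<in> Arr M" "g' \<in> Arr M" "Cod M f' = Dom M f" "Cod M g' = Dom M g"
    "h \<in> Arr M" "Cod M h = Dom M f' \<otimes>\<^bsub>M\<^esub> Dom M g'"
  shows "(f \<odot>\<^bsub>M\<^esub> g) \<cdot>\<^bsub>M\<^esub> ((f' \<odot>\<^bsub>M\<^esub> g') \<cdot>\<^bsub>M\<^esub> h) = ((f \<cdot>\<^bsub>M\<^esub> f') \<odot>\<^bsub>M\<^esub> (g \<cdot>\<^bsub>M\<^esub> g')) \<cdot>\<^bsub>M\<^esub> h"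
  using assms by (simp add: interchange flip: cmp_cmp)

lemma is_iso_tenA [simp]:
  assumes "is_iso M f" "is_iso M g"
  shows "is_iso M (f \<odot>\<^bsub>M\<^esub> g)"
  using assms is_iso_arr[OF assms(1)] is_iso_arr[OF assms(2)]
  by (intro is_isoI[of _ "arr_inv M f \<odot>\<^bsub>M\<^esub> arr_inv M g"]) (simp_all add: interchange)

lemma unit_obj [simp]: "unit M \<in> Obj M"
  by (rule unit_in)

lemma assoc_arr [simp]:
  assumes "X \<in> Obj M" "Y \<in> Obj M" "Z \<in> Obj M"
  shows "is_iso M (assoc M X Y Z)" "assoc M X Y Z \<in> Arr M"
    "Dom M (assoc M X Y Z) = (X \<otimes>\<^bsub>M\<^esub> Y) \<otimes>\<^bsub>M\<^esub> Z" "Cod M (assoc M X Y Z) = X \<otimes>\<^bsub>M\<^esub> (Y \<otimes>\<^bsub>M\<^esub> Z)"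
  using iso_homD[OF assoc_iso[OF assms]] by auto

lemma lunit_arr [simp]:
  assumes "X \<in> Obj M"
  shows "is_iso M (lunit M X)" "lunit M X \<in> Arr M" "Dom M (lunit M X) = unit M \<otimes>\<^bsub>M\<^esub> X" "Cod M (lunit M X) = X"
  using iso_homD[OF lunit_iso[OF assms]] by auto

lemma runit_arr [simp]:
  assumes "X \<in> Obj M"
  shows "is_iso M (runit M X)" "runit M X \<in> Arr M" "Dom M (runit M X) = X \<otimes>\<^bsub>M\<^esub> unit M" "Cod M (runit M X) = X"
  using iso_homD[OF runit_iso[OF assms]] by auto

lemma assoc_natural:
  assumes "f \<in> Arr M" "g \<in> Arr M" "h \<in> Arr M" "Cod M f = X" "Cod M g = Y" "Cod M h = Z"
  shows "assoc M X Y Z \<cdot>\<^bsub>M\<^esub> ((f \<odot>\<^bsub>M\<^esub> g) \<odot>\<^bsub>M\<^esub> h)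
    = (f \<odot>\<^bsub>M\<^esub> (g \<odot>\<^bsub>M\<^esub> h)) \<cdot>\<^bsub>M\<^esub> assoc M (Dom M f) (Dom M g) (Dom M h)"
  using assms by (intro assoc_nat) (auto simp: hom_def)

lemma assoc_natural_cmp:
  assumes "f \<in> Arr M" "g \<in> Arr M" "h \<in> Arr M" "Cod M f = X" "Cod M g = Y" "Cod M h = Z"
    "k \<in> Arr M" "Cod M k = (Dom M f \<otimes>\<^bsub>M\<^esub> Dom M g) \<otimes>\<^bsub>M\<^esub> Dom M h"
  shows "assoc M X Y Z \<cdot>\<^bsub>M\<^esub> (((f \<odot>\<^bsub>M\<^esub> g) \<odot>\<^bsub>M\<^esub> h) \<cdot>\<^bsub>M\<^esub> k)
    = (f \<odot>\<^bsub>M\<^esub> (g \<odot>\<^bsub>M\<^esub> h)) \<cdot>\<^bsub>M\<^esub> (assoc M (Dom M f) (Dom M g) (Dom M h) \<cdot>\<^bsub>M\<^esub> k)"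
proof -
  have "assoc M X Y Z \<cdot>\<^bsub>M\<^esub> (((f \<odot>\<^bsub>M\<^esub> g) \<odot>\<^bsub>M\<^esub> h) \<cdot>\<^bsub>M\<^esub> k)
      = (assoc M X Y Z \<cdot>\<^bsub>M\<^esub> ((f \<odot>\<^bsub>M\<^esub> g) \<odot>\<^bsub>M\<^esub> h)) \<cdot>\<^bsub>M\<^esub> k"
    using assms by (auto simp: cmp_cmp)
  then show ?thesis using assms assoc_natural[OF assms(1-6)] by (simp add: cmp_cmp)
qed

lemma lunit_natural:
  "\<lbrakk>f \<in> Arr M; Cod M f = X\<rbrakk> \<Longrightarrow> lunit M X \<cdot>\<^bsub>M\<^esub> (ide M (unit M) \<odot>\<^bsub>M\<^esub> f) = f \<cdot>\<^bsub>M\<^esub> lunit M (Dom M f)"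
  by (intro lunit_nat) (auto simp: hom_def)

lemma runit_natural:
  "\<lbrakk>f \<in> Arr M; Cod M f = X\<rbrakk> \<Longrightarrow> runit M X \<cdot>\<^bsub>M\<^esub> (f \<odot>\<^bsub>M\<^esub> ide M (unit M)) = f \<cdot>\<^bsub>M\<^esub> runit M (Dom M f)"
  by (intro runit_nat) (auto simp: hom_def)

text \<open>Naturality of \<open>lunit\<close> recovers an arrow from its tensor product with the
  identity of the unit.\<close>

lemma unit_tenA_faithful:
  assumes "ide M (unit M) \<odot>\<^bsub>M\<^esub> f = ide M (unit M) \<odot>\<^bsub>M\<^esub> g" "f \<in> Arr M" "g \<in> Arr M"
    "Dom M f = Dom M g" "Cod M f = Cod M g"
  shows "f = g"
proof (rule iso_cancel_right)
  show "f \<cdot>\<^bsub>M\<^esub> lunit M (Dom M f) = g \<cdot>\<^bsub>M\<^esub> lunit M (Dom M f)"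
    by (metis assms lunit_natural)
qed (use assms in simp_all)

lemma tenA_unit_faithful:
  assumes "f \<odot>\<^bsub>M\<^esub> ide M (unit M) = g \<odot>\<^bsub>M\<^esub> ide M (unit M)" "f \<in> Arr M" "g \<in> Arr M"
    "Dom M f = Dom M g" "Cod M f = Cod M g"
  shows "f = g"
proof (rule iso_cancel_right)
  show "f \<cdot>\<^bsub>M\<^esub> runit M (Dom M f) = g \<cdot>\<^bsub>M\<^esub> runit M (Dom M f)"
    by (metis assms runit_natural)
qed (use assms in simp_all)

text \<open>Kelly: the next three coherence laws, once part of the definition, follow from pentagon and triangle.\<close>

lemma lunit_ten:
  assumes [simp]: "X \<in> Obj M" "Y \<in> Obj M"
  shows "lunit M (X \<otimes>\<^bsub>M\<^esub> Y) \<cdot>\<^bsub>M\<^esub> assoc M (unit M) X Y = lunit M X \<odot>\<^bsub>M\<^esub> ide M Y"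
proof -
  let ?I = "unit M" and ?i = "ide M (unit M)"
  let ?h = "assoc M ?I (?I \<otimes>\<^bsub>M\<^esub> X) Y \<cdot>\<^bsub>M\<^esub> (assoc M ?I ?I X \<odot>\<^bsub>M\<^esub> ide M Y)"
  \<comment> \<open>Both sides are tensored with the unit \<open>?I\<close> on the left and compared
    on the source of \<open>?h\<close>. The pentagon for \<open>?I\<close>, \<open>?I\<close>,
    \<open>X\<close>, \<open>Y\<close> then applies, and two triangles turn it into the
    claim.\<close>
  have "(?i \<odot>\<^bsub>M\<^esub> (lunit M (X \<otimes>\<^bsub>M\<^esub> Y) \<cdot>\<^bsub>M\<^esub> assoc M ?I X Y)) \<cdot>\<^bsub>M\<^esub> ?h
      = (?i \<odot>\<^bsub>M\<^esub> lunit M (X \<otimes>\<^bsub>M\<^esub> Y)) \<cdot>\<^bsub>M\<^esub> ((?i \<odot>\<^bsub>M\<^esub> assoc M ?I X Y) \<cdot>\<^bsub>M\<^esub> assoc M ?I (?I \<otimes>\<^bsub>M\<^esub> X) Y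
          \<cdot>\<^bsub>M\<^esub> (assoc M ?I ?I X \<odot>\<^bsub>M\<^esub> ide M Y))"
    by (simp add: cmp_cmp interchange interchange_cmp)
  also have "\<dots> = ((?i \<odot>\<^bsub>M\<^esub> lunit M (X \<otimes>\<^bsub>M\<^esub> Y)) \<cdot>\<^bsub>M\<^esub> assoc M ?I ?I (X \<otimes>\<^bsub>M\<^esub> Y)) \<cdot>\<^bsub>M\<^esub> assoc M (?I \<otimes>\<^bsub>M\<^esub> ?I) X Y"
    by (subst pentagon) (simp_all add: cmp_cmp)
  also have "\<dots> = (runit M ?I \<odot>\<^bsub>M\<^esub> (ide M X \<odot>\<^bsub>M\<^esub> ide M Y)) \<cdot>\<^bsub>M\<^esub> assoc M (?I \<otimes>\<^bsub>M\<^esub> ?I) X Y"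
    by (simp add: triangle)
  also have "\<dots> = assoc M ?I X Y \<cdot>\<^bsub>M\<^esub> ((runit M ?I \<odot>\<^bsub>M\<^esub> ide M X) \<odot>\<^bsub>M\<^esub> ide M Y)"
    by (subst assoc_natural) simp_all
  also have "\<dots> = assoc M ?I X Y \<cdot>\<^bsub>M\<^esub> (((?i \<odot>\<^bsub>M\<^esub> lunit M X) \<odot>\<^bsub>M\<^esub> ide M Y) \<cdot>\<^bsub>M\<^esub> (assoc M ?I ?I X \<odot>\<^bsub>M\<^esub> ide M Y))"
    by (simp add: interchange triangle)
  also have "\<dots> = (?i \<odot>\<^bsub>M\<^esub> (lunit M X \<odot>\<^bsub>M\<^esub> ide M Y)) \<cdot>\<^bsub>M\<^esub> ?h"
    by (simp add: assoc_natural_cmp)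
  finally have "?i \<odot>\<^bsub>M\<^esub> (lunit M (X \<otimes>\<^bsub>M\<^esub> Y) \<cdot>\<^bsub>M\<^esub> assoc M ?I X Y) = ?i \<odot>\<^bsub>M\<^esub> (lunit M X \<odot>\<^bsub>M\<^esub> ide M Y)"
    by (rule iso_cancel_right) simp_all
  then show ?thesis by (rule unit_tenA_faithful) simp_all
qed

lemma runit_ten:
  assumes [simp]: "X \<in> Obj M" "Y \<in> Obj M"
  shows "(ide M X \<odot>\<^bsub>M\<^esub> runit M Y) \<cdot>\<^bsub>M\<^esub> assoc M X Y (unit M) = runit M (X \<otimes>\<^bsub>M\<^esub> Y)"
proof -
  let ?I = "unit M" and ?i = "ide M (unit M)"
  let ?a = "assoc M X Y ?I"
  \<comment> \<open>Mirror image of \<open>lunit_ten\<close>: tensor with the unit on the right and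
    cancel the associator on the left, using the pentagon for \<open>X\<close>, \<open>Y\<close>,
    \<open>?I\<close>, \<open>?I\<close>.\<close>
  have "?a \<cdot>\<^bsub>M\<^esub> (((ide M X \<odot>\<^bsub>M\<^esub> runit M Y) \<cdot>\<^bsub>M\<^esub> ?a) \<odot>\<^bsub>M\<^esub> ?i)
      = ?a \<cdot>\<^bsub>M\<^esub> (((ide M X \<odot>\<^bsub>M\<^esub> runit M Y) \<odot>\<^bsub>M\<^esub> ?i) \<cdot>\<^bsub>M\<^esub> (?a \<odot>\<^bsub>M\<^esub> ?i))"
    by (simp add: interchange)
  also have "\<dots> = (ide M X \<odot>\<^bsub>M\<^esub> (runit M Y \<odot>\<^bsub>M\<^esub> ?i)) \<cdot>\<^bsub>M\<^esub> (assoc M X (Y \<otimes>\<^bsub>M\<^esub> ?I) ?I \<cdot>\<^bsub>M\<^esub> (?a \<odot>\<^bsub>M\<^esub> ?i))"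
    by (simp add: assoc_natural_cmp)
  also have "\<dots> = (ide M X \<odot>\<^bsub>M\<^esub> (ide M Y \<odot>\<^bsub>M\<^esub> lunit M ?I)) \<cdot>\<^bsub>M\<^esub>
      ((ide M X \<odot>\<^bsub>M\<^esub> assoc M Y ?I ?I) \<cdot>\<^bsub>M\<^esub> assoc M X (Y \<otimes>\<^bsub>M\<^esub> ?I) ?I \<cdot>\<^bsub>M\<^esub> (?a \<odot>\<^bsub>M\<^esub> ?i))"
    by (simp add: cmp_cmp interchange interchange_cmp triangle)
  also have "\<dots> = ((ide M X \<odot>\<^bsub>M\<^esub> (ide M Y \<odot>\<^bsub>M\<^esub> lunit M ?I)) \<cdot>\<^bsub>M\<^esub> assoc M X Y (?I \<otimes>\<^bsub>M\<^esub> ?I)) \<cdot>\<^bsub>M\<^esub> assoc M (X \<otimes>\<^bsub>M\<^esub> Y) ?I ?I"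
    by (subst pentagon) (simp_all add: cmp_cmp)
  also have "\<dots> = (?a \<cdot>\<^bsub>M\<^esub> ((ide M X \<odot>\<^bsub>M\<^esub> ide M Y) \<odot>\<^bsub>M\<^esub> lunit M ?I)) \<cdot>\<^bsub>M\<^esub> assoc M (X \<otimes>\<^bsub>M\<^esub> Y) ?I ?I"
    by (subst assoc_natural) simp_all
  also have "\<dots> = ?a \<cdot>\<^bsub>M\<^esub> (runit M (X \<otimes>\<^bsub>M\<^esub> Y) \<odot>\<^bsub>M\<^esub> ?i)"
    by (simp add: triangle cmp_cmp)
  finally have "((ide M X \<odot>\<^bsub>M\<^esub> runit M Y) \<cdot>\<^bsub>M\<^esub> ?a) \<odot>\<^bsub>M\<^esub> ?i = runit M (X \<otimes>\<^bsub>M\<^esub> Y) \<odot>\<^bsub>M\<^esub> ?i"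
    by (rule iso_cancel_left) simp_all
  then show ?thesis by (rule tenA_unit_faithful) simp_all
qed

lemma lunit_unit: "lunit M (unit M) = runit M (unit M)"
proof -
  let ?I = "unit M" and ?i = "ide M (unit M)"
  \<comment> \<open>Naturality of \<open>lunit\<close> at its own component identifies
    \<open>?i \<odot> lunit M ?I\<close> with \<open>lunit M (?I \<otimes> ?I)\<close>. Hence
    \<open>lunit_ten\<close> and the triangle have the same left-hand side.\<close>
  have "lunit M ?I \<cdot>\<^bsub>M\<^esub> (?i \<odot>\<^bsub>M\<^esub> lunit M ?I) = lunit M ?I \<cdot>\<^bsub>M\<^esub> lunit M (?I \<otimes>\<^bsub>M\<^esub> ?I)"
    by (subst lunit_natural) simp_all
  then have "?i \<odot>\<^bsub>M\<^esub> lunit M ?I = lunit M (?I \<otimes>\<^bsub>M\<^esub> ?I)"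
    by (rule iso_cancel_left) simp_all
  then have "lunit M ?I \<odot>\<^bsub>M\<^esub> ?i = runit M ?I \<odot>\<^bsub>M\<^esub> ?i"
    using lunit_ten[of ?I ?I] triangle[of ?I ?I] by simp
  then show ?thesis by (rule tenA_unit_faithful) simp_all
qed

end

section \<open>The augmented simplex category\<close>

lemma Delta_a_simps [simp]:
  "Obj Delta_a = UNIV" "ide Delta_a = ord_id" "ten Delta_a = (+)" "tenA Delta_a = ord_sum"
  "unit Delta_a = 0" "assoc Delta_a n m k = ord_id (n + m + k)" "lunit Delta_a = ord_id"
  "runit Delta_a = ord_id" "Dom Delta_a (n, n', w) = n" "Cod Delta_a (n, n', w) = n'"
  "cmp Delta_a (n', n'', v) (n, k, w) = (n, n'', compose {..<n} v w)"
  by (simp_all add: Delta_a_def)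

lemma in_Arr_Delta_a: "(n, n', w) \<in> Arr Delta_a \<longleftrightarrow> w \<in> {..<n} \<rightarrow>\<^sub>E {..<n'} \<and> mono_on {..<n} w"
  by (simp add: Delta_a_def)

lemma in_hom_Delta_a:
  "x \<in> hom Delta_a n n' \<longleftrightarrow> (\<exists>w. x = (n, n', w) \<and> w \<in> {..<n} \<rightarrow>\<^sub>E {..<n'} \<and> mono_on {..<n} w)"
  by (cases x) (auto simp: hom_def in_Arr_Delta_a)

lemma ord_id_hom: "ord_id n \<in> hom Delta_a n n"
  by (auto simp: in_hom_Delta_a ord_id_def mono_on_def)

lemma to_one_hom: "to_one n \<in> hom Delta_a n 1"
  by (auto simp: in_hom_Delta_a to_one_def mono_on_def)

lemma cmp_hom_Delta_a:
  assumes "w \<in> hom Delta_a n n'" "v \<in> hom Delta_a n' n''"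
  shows "v \<cdot>\<^bsub>Delta_a\<^esub> w \<in> hom Delta_a n n''"
  using assms
  by (auto simp: in_hom_Delta_a compose_def mono_on_def PiE_def Pi_def extensional_def)

lemma ord_sum_hom:
  assumes "w \<in> hom Delta_a n n'" "v \<in> hom Delta_a m m'"
  shows "ord_sum w v \<in> hom Delta_a (n + m) (n' + m')"
proof -
  obtain f g where w: "w = (n, n', f)" "f \<in> {..<n} \<rightarrow>\<^sub>E {..<n'}" "mono_on {..<n} f"
    and v: "v = (m, m', g)" "g \<in> {..<m} \<rightarrow>\<^sub>E {..<m'}" "mono_on {..<m} g"
    using assms by (auto simp: in_hom_Delta_a)
  have f: "f i < n'" if "i < n" for i using w that by auto
  have g: "g i < m'" if "i < m" for i using v that by auto
  have fg: "f i \<le> n' + g j" if "i < n" for i j using f[OF that] by simp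
  have f': "f i < n' + m'" if "i < n" for i using f[OF that] by simp
  have g': "g (i - n) < m'" if "i < n + m" "\<not> i < n" for i using g[of "i - n"] that by simp
  have mg: "g (i - n) \<le> g (j - n)" if "i \<le> j" "j < n + m" "\<not> i < n" for i j
    using v(3) that by (intro mono_onD[of "{..<m}" g]) auto
  show ?thesis
    using w(3) unfolding w v in_hom_Delta_a ord_sum_def
    by (auto simp: mono_on_def fg f' g' mg)
qed

lemma cmp_assoc_Delta_a:
  assumes "f \<in> hom Delta_a a b" "g \<in> hom Delta_a b c" "h \<in> hom Delta_a c d"
  shows "(h \<cdot>\<^bsub>Delta_a\<^esub> g) \<cdot>\<^bsub>Delta_a\<^esub> f = h \<cdot>\<^bsub>Delta_a\<^esub> (g \<cdot>\<^bsub>Delta_a\<^esub> f)"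
  using assms by (auto simp: in_hom_Delta_a compose_def fun_eq_iff)

lemma cmp_ide_Delta_a:
  assumes "f \<in> hom Delta_a n n'"
  shows "ord_id n' \<cdot>\<^bsub>Delta_a\<^esub> f = f" "f \<cdot>\<^bsub>Delta_a\<^esub> ord_id n = f"
  using assms by (auto simp: in_hom_Delta_a ord_id_def compose_def fun_eq_iff PiE_def extensional_def)

lemma ord_sum_id [simp]: "ord_sum (ord_id n) (ord_id m) = ord_id (n + m)"
  by (auto simp: ord_sum_def ord_id_def fun_eq_iff)

lemma ord_sum_cmp:
  assumes "w \<in> hom Delta_a n n'" "v \<in> hom Delta_a m m'" "w' \<in> hom Delta_a n' n''" "v' \<in> hom Delta_a m' m''"
  shows "ord_sum (w' \<cdot>\<^bsub>Delta_a\<^esub> w) (v' \<cdot>\<^bsub>Delta_a\<^esub> v) = ord_sum w' v' \<cdot>\<^bsub>Delta_a\<^esub> ord_sum w v"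
proof -
  obtain f g f' g' where w: "w = (n, n', f)" "w' = (n', n'', f')" "f \<in> {..<n} \<rightarrow>\<^sub>E {..<n'}"
    and v: "v = (m, m', g)" "v' = (m', m'', g')" "g \<in> {..<m} \<rightarrow>\<^sub>E {..<m'}"
    using assms by (auto simp: in_hom_Delta_a)
  have f: "f i < n'" "f i < n' + m'" if "i < n" for i using w(3) that by (auto intro: trans_less_add1)
  have g: "g (i - n) < m'" if "i < n + m" "\<not> i < n" for i
    using v(3) that by (auto simp: PiE_def Pi_def)
  show ?thesis unfolding w v
    by (auto simp: ord_sum_def compose_def fun_eq_iff f g)
qed

lemma ord_sum_assoc:
  assumes "u \<in> hom Delta_a n n'" "v \<in> hom Delta_a m m'" "w \<in> hom Delta_a k k'"
  shows "ord_sum (ord_sum u v) w = ord_sum u (ord_sum v w)"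
  using assms by (auto simp: in_hom_Delta_a ord_sum_def fun_eq_iff add.assoc)

lemma ord_sum_0_left: "w \<in> hom Delta_a n n' \<Longrightarrow> ord_sum (ord_id 0) w = w"
  by (auto simp: in_hom_Delta_a ord_sum_def ord_id_def fun_eq_iff PiE_def extensional_def)

lemma ord_sum_0_right: "w \<in> hom Delta_a n n' \<Longrightarrow> ord_sum w (ord_id 0) = w"
  by (auto simp: in_hom_Delta_a ord_sum_def ord_id_def fun_eq_iff PiE_def extensional_def)

lemma ord_id_iso: "ord_id n \<in> iso_hom Delta_a n n"
proof -
  have "is_inverse Delta_a (ord_id n) (ord_id n)"
    using ord_id_hom[of n] cmp_ide_Delta_a[OF ord_id_hom[of n]]
    by (auto simp: is_inverse_def homD(2,3)[OF ord_id_hom])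
  then show ?thesis using ord_id_hom[of n] unfolding iso_hom_def by blast
qed

lemma category_Delta_a: "category Delta_a"
proof
  show "Dom Delta_a f \<in> Obj Delta_a" "Cod Delta_a f \<in> Obj Delta_a" for f by simp_all
qed (auto intro: ord_id_hom cmp_hom_Delta_a cmp_assoc_Delta_a simp: cmp_ide_Delta_a)

lemma prodc_simps:
  "Obj (C \<times>\<^sub>c D) = Obj C \<times> Obj D"
  "x \<in> hom (C \<times>\<^sub>c D) A B \<longleftrightarrow> fst x \<in> hom C (fst A) (fst B) \<and> snd x \<in> hom D (snd A) (snd B)"
  "ide (C \<times>\<^sub>c D) A = (ide C (fst A), ide D (snd A))"
  "y \<cdot>\<^bsub>(C \<times>\<^sub>c D)\<^esub> x = (fst y \<cdot>\<^bsub>C\<^esub> fst x, snd y \<cdot>\<^bsub>D\<^esub> snd x)"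
  by (cases x; cases A; cases B; force simp: hom_def prodc_def case_prod_beta)+

lemma monoidal_Delta_a: "monoidal_category Delta_a"
proof (intro monoidal_category.intro[OF category_Delta_a] monoidal_category_axioms.intro)
  show "is_functor (Delta_a \<times>\<^sub>c Delta_a) Delta_a
     \<lparr>fobj = \<lambda>(X, Y). X \<otimes>\<^bsub>Delta_a\<^esub> Y, farr = \<lambda>(f, g). f \<odot>\<^bsub>Delta_a\<^esub> g\<rparr>"
    unfolding is_functor_def prodc_simps
    by (intro conjI ballI) (auto simp: prodc_simps case_prod_beta
        simp del: split_paired_All split_paired_Ex intro!: ord_sum_hom ord_sum_cmp)
next
  fix X X' Y Y' Z Z' f g h
  assume f: "f \<in> hom Delta_a X X'" "g \<in> hom Delta_a Y Y'" "h \<in> hom Delta_a Z Z'"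
  have "ord_sum f (ord_sum g h) \<in> hom Delta_a (X + Y + Z) (X' + Y' + Z')"
    using ord_sum_hom[OF f(1) ord_sum_hom[OF f(2,3)]] by (simp add: add.assoc)
  then show "assoc Delta_a X' Y' Z' \<cdot>\<^bsub>Delta_a\<^esub> ((f \<odot>\<^bsub>Delta_a\<^esub> g) \<odot>\<^bsub>Delta_a\<^esub> h) =
      (f \<odot>\<^bsub>Delta_a\<^esub> (g \<odot>\<^bsub>Delta_a\<^esub> h)) \<cdot>\<^bsub>Delta_a\<^esub> assoc Delta_a X Y Z"
    by (simp add: cmp_ide_Delta_a ord_sum_assoc[OF f])
qed (auto simp: ord_id_iso cmp_ide_Delta_a ord_sum_0_left ord_sum_0_right add.assoc
       cmp_ide_Delta_a[OF ord_id_hom] intro: ord_id_iso[unfolded add.assoc])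

section \<open>Decomposition of monotone maps\<close>

lemma hom_Delta_a_0: "w \<in> hom Delta_a n 0 \<longleftrightarrow> n = 0 \<and> w = ord_id 0"
  by (cases n) (auto simp: in_hom_Delta_a ord_id_def mono_on_def PiE_eq_empty_iff restrict_def)

text \<open>The ordinal \<open>1\<close> is terminal; this identifies composites ending at
  \<open>1\<close> without computing the underlying functions.\<close>

lemma hom_Delta_a_1: "w \<in> hom Delta_a n 1 \<longleftrightarrow> w = to_one n"
  by (auto simp: in_hom_Delta_a to_one_def mono_on_def fun_eq_iff PiE_def extensional_def Pi_def)

lemma to_one_1: "to_one 1 = ord_id 1"
  using hom_Delta_a_1[of "ord_id 1" 1] ord_id_hom[of 1] by simp

text \<open>The domain is cut where the values first reach \<open>a\<close>; by monotonicity the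
  indices with values below \<open>a\<close> form an initial segment.\<close>

lemma ord_sum_decompose:
  assumes "w \<in> hom Delta_a n (a + b)"
  obtains n1 n2 w1 w2 where "n = n1 + n2" "w1 \<in> hom Delta_a n1 a" "w2 \<in> hom Delta_a n2 b"
    "w = ord_sum w1 w2"
proof -
  obtain f where w: "w = (n, a + b, f)" "f \<in> {..<n} \<rightarrow>\<^sub>E {..<a + b}" "mono_on {..<n} f"
    using assms by (auto simp: in_hom_Delta_a)
  \<comment> \<open>The disjunct \<open>i = n\<close> guarantees that the minimum exists when all
    values lie below \<open>a\<close>; the second summand then has empty domain.\<close>
  define p where "p = (LEAST i. i = n \<or> f i \<ge> a)"
  have p: "p \<le> n" "p = n \<or> f p \<ge> a"
    unfolding p_def
    by (rule Least_le, simp) (rule LeastI[of "\<lambda>i. i = n \<or> f i \<ge> a" n], simp)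
  have lo: "f i < a" if "i < p" for i
    using not_less_Least[of i "\<lambda>i. i = n \<or> f i \<ge> a"] that unfolding p_def by auto
  have hi: "f i \<ge> a" if "p \<le> i" "i < n" for i
    using p that w(3) by (auto simp: mono_on_def) (meson dual_order.strict_trans2 le_trans lessThan_iff)
  have up: "f i < a + b" if "i < n" for i using w(2) that by auto
  let ?w1 = "(p, a, \<lambda>i\<in>{..<p}. f i)" and ?w2 = "(n - p, b, \<lambda>i\<in>{..<n - p}. f (p + i) - a)"
  have "?w1 \<in> hom Delta_a p a"
    using w(3) lo p(1) by (auto simp: in_hom_Delta_a mono_on_def)
  moreover have "?w2 \<in> hom Delta_a (n - p) b"
    using hi up p(1) by (auto simp: in_hom_Delta_a less_diff_conv2 add.commute
        intro!: mono_onI diff_le_mono mono_onD[OF w(3)])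
  moreover have "w = ord_sum ?w1 ?w2"
    using w(2) p(1) hi unfolding w(1)
    by (auto simp: ord_sum_def fun_eq_iff PiE_def extensional_def)
  moreover have "n = p + (n - p)" using p(1) by simp
  ultimately show ?thesis using that by blast
qed

text \<open>If the two cuts differed, at the smaller one one description would give a value below
  \<open>a\<close> and the other a value of at least \<open>a\<close>.\<close>

lemma ord_sum_eqD:
  assumes "ord_sum w v = ord_sum w' v'" "w \<in> hom Delta_a n a" "v \<in> hom Delta_a m b"
    "w' \<in> hom Delta_a n' a" "v' \<in> hom Delta_a m' b"
  shows "n = n'" "m = m'" "w = w'" "v = v'"
proof -
  obtain f g where w: "w = (n, a, f)" "f \<in> {..<n} \<rightarrow>\<^sub>E {..<a}"
    and v: "v = (m, b, g)" "g \<in> {..<m} \<rightarrow>\<^sub>E {..<b}"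
    using assms by (auto simp: in_hom_Delta_a)
  obtain f' g' where w': "w' = (n', a, f')" "f' \<in> {..<n'} \<rightarrow>\<^sub>E {..<a}"
    and v': "v' = (m', b, g')" "g' \<in> {..<m'} \<rightarrow>\<^sub>E {..<b}"
    using assms by (auto simp: in_hom_Delta_a)
  have nm: "n + m = n' + m'" using assms(1) by (simp add: w v w' v' ord_sum_def)
  have eq: "(if i < n then f i else a + g (i - n)) = (if i < n' then f' i else a + g' (i - n'))"
    if "i < n + m" for i
    using assms(1) that by (auto simp: w v w' v' ord_sum_def fun_eq_iff split: if_splits)
  have f: "f i < a" if "i < n" for i using w that by auto
  have f': "f' i < a" if "i < n'" for i using w' that by auto
  show n: "n = n'"
  proof (rule ccontr)
    assume "n \<noteq> n'"
    then consider "n < n'" | "n' < n" by linarith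
    then show False
    proof cases
      case 1 then show False using eq[of n] f'[of n] nm by auto
    next
      case 2 then show False using eq[of n'] f[of n'] nm by auto
    qed
  qed
  show m: "m = m'" using n nm by simp
  have "f i = f' i" for i
    using eq[of i] n w w' by (cases "i < n") (auto simp: PiE_def extensional_def)
  then show "w = w'" using w w' n by (simp add: fun_eq_iff)
  have "g i = g' i" for i
    using eq[of "n + i"] n m v v' by (cases "i < m") (auto simp: PiE_def extensional_def)
  then show "v = v'" using v v' m by (simp add: fun_eq_iff)
qed

text \<open>The fibre over the largest element of the codomain is a final segment, here of length
  \<open>k\<close>. Splitting it off step by step exhibits every arrow as a sum of maps into
  \<open>1\<close>.\<close>

lemma hom_Delta_a_induct [consumes 1, case_names empty snoc]:
  assumes "w \<in> hom Delta_a n n'"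
    and "P 0 0 (ord_id 0)"
    and "\<And>p n' w k. \<lbrakk>w \<in> hom Delta_a p n'; P p n' w\<rbrakk> \<Longrightarrow> P (p + k) (Suc n') (ord_sum w (to_one k))"
  shows "P n n' w"
  using assms(1)
proof (induction n' arbitrary: n w)
  case 0
  then show ?case using assms(2) by (simp add: hom_Delta_a_0)
next
  case (Suc n')
  then have "w \<in> hom Delta_a n (n' + 1)" by simp
  then obtain p k w' w2 where w: "n = p + k" "w' \<in> hom Delta_a p n'" "w2 \<in> hom Delta_a k 1"
    "w = ord_sum w' w2"
    by (rule ord_sum_decompose)
  then show ?case using assms(3) Suc.IH by (simp only: hom_Delta_a_1)
qed

section \<open>The strong monoidal functor presented by a monoid\<close>

locale monoid_in_monoidal_category = monoidal_category M for M :: "('o, 'a, 'z) moncat_scheme" (structure) +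
  fixes T :: "('o, 'a) monoid_data"
  assumes monoid_object: "monoid_object M T"
begin

abbreviation \<X> :: 'o where "\<X> \<equiv> mon_obj T"
abbreviation \<eta> :: 'a where "\<eta> \<equiv> mon_unit T"
abbreviation \<mu> :: 'a where "\<mu> \<equiv> mon_mult T"
abbreviation pow :: "nat \<Rightarrow> 'o" where "pow \<equiv> tensor_power M \<X>"

lemma monoid_arr [simp]:
  "\<X> \<in> Obj M" "\<eta> \<in> Arr M" "Dom M \<eta> = unit M" "Cod M \<eta> = \<X>"
  "\<mu> \<in> Arr M" "Dom M \<mu> = \<X> \<otimes> \<X>" "Cod M \<mu> = \<X>"
  using monoid_object by (auto simp: monoid_object_def Let_def hom_def)

lemma monoid_assoc: "\<mu> \<cdot> (\<mu> \<odot> ide M \<X>) = \<mu> \<cdot> ((ide M \<X> \<odot> \<mu>) \<cdot> assoc M \<X> \<X> \<X>)"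
  using monoid_object by (simp add: monoid_object_def Let_def cmp_cmp)

lemma monoid_units: "\<mu> \<cdot> (\<eta> \<odot> ide M \<X>) = lunit M \<X>" "\<mu> \<cdot> (ide M \<X> \<odot> \<eta>) = runit M \<X>"
  using monoid_object by (simp_all add: monoid_object_def Let_def)

section \<open>Tensor powers, rebracketing and iterated multiplication\<close>

lemma pow_obj [simp]: "pow n \<in> Obj M"
proof (induction n)
  case (Suc n)
  then show ?case by (cases n) simp_all
qed simp

text \<open>The case distinction is forced by \<open>tensor_power M \<X> 1 = \<X>\<close>, which is not \<open>unit M \<otimes> \<X>\<close>.\<close>

definition snoc :: "nat \<Rightarrow> 'a" where
  "snoc n = (if n = 0 then lunit M \<X> else ide M (pow (Suc n)))"

declare tensor_power.simps(2,3) [simp del]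

lemma snoc_arr [simp]:
  "is_iso M (snoc n)" "snoc n \<in> Arr M" "Dom M (snoc n) = pow n \<otimes> \<X>" "Cod M (snoc n) = pow (Suc n)"
proof -
  have "snoc n \<in> iso_hom M (pow n \<otimes> \<X>) (pow (Suc n))"
  proof (cases n)
    case 0
    then show ?thesis
      using lunit_iso[of \<X>] by (simp add: snoc_def tensor_power.simps)
  next
    case (Suc k)
    then have "pow (Suc n) = pow n \<otimes> \<X>" by (simp add: tensor_power.simps)
    then show ?thesis using Suc by (intro is_iso_in_iso_hom) (simp_all add: snoc_def)
  qed
  from iso_homD[OF this] show "is_iso M (snoc n)" "snoc n \<in> Arr M"
    "Dom M (snoc n) = pow n \<otimes> \<X>" "Cod M (snoc n) = pow (Suc n)" by auto
qed

text \<open>The canonical isomorphism \<open>pow p \<otimes> pow k\<close> to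
  \<open>pow (p + k)\<close>, built by carrying the last factor of the second power across. Later
  calculations use the inverse-free form \<open>join_snoc\<close>.\<close>

primrec join :: "nat \<Rightarrow> nat \<Rightarrow> 'a" where
  "join p 0 = runit M (pow p)"
| "join p (Suc k) = snoc (p + k) \<cdot> ((join p k \<odot> ide M \<X>) \<cdot>
     (arr_inv M (assoc M (pow p) (pow k) \<X>) \<cdot> (ide M (pow p) \<odot> arr_inv M (snoc k))))"

text \<open>Iterated multiplication bracketed to the left, starting from the unit. The case of a
  single factor is not separate, so that it is the identity is a consequence of the left unit law
  (\<open>nfold_1\<close>).\<close>

primrec nfold :: "nat \<Rightarrow> 'a" where
  "nfold 0 = \<eta>"
| "nfold (Suc n) = \<mu> \<cdot> ((nfold n \<odot> ide M \<X>) \<cdot> arr_inv M (snoc n))"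

lemma join_arr [simp]:
  "is_iso M (join p k)" "join p k \<in> Arr M" "Dom M (join p k) = pow p \<otimes> pow k"
  "Cod M (join p k) = pow (p + k)"
  by (induction k) simp_all

lemma nfold_arr [simp]: "nfold n \<in> Arr M" "Dom M (nfold n) = pow n" "Cod M (nfold n) = \<X>"
  by (induction n) simp_all

lemma join_snoc:
  "join p (Suc k) \<cdot> ((ide M (pow p) \<odot> snoc k) \<cdot> assoc M (pow p) (pow k) \<X>)
   = snoc (p + k) \<cdot> (join p k \<odot> ide M \<X>)"
  by (simp add: cmp_cmp interchange_cmp)

lemma join_snoc_cmp:
  assumes "f \<in> Arr M" "Cod M f = (pow p \<otimes> pow k) \<otimes> \<X>"
  shows "join p (Suc k) \<cdot> ((ide M (pow p) \<odot> snoc k) \<cdot> (assoc M (pow p) (pow k) \<X> \<cdot> f))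
   = snoc (p + k) \<cdot> ((join p k \<odot> ide M \<X>) \<cdot> f)"
  using assms by (simp add: cmp_cmp interchange_cmp)

lemma nfold_snoc: "nfold (Suc p) \<cdot> snoc p = \<mu> \<cdot> (nfold p \<odot> ide M \<X>)"
  by (simp add: cmp_cmp)

lemma join_1: "join n (Suc 0) = snoc n"
proof (rule iso_cancel_right)
  \<comment> \<open>Since \<open>snoc 0\<close> is the left unitor, the triangle turns the right
    unitor \<open>join n 0\<close>, tensored with \<open>\<X>\<close>, into the isomorphism being
    cancelled.\<close>
  have "lunit M \<X> = snoc 0" by (simp add: snoc_def)
  then show "join n (Suc 0) \<cdot> ((ide M (pow n) \<odot> snoc 0) \<cdot> assoc M (pow n) (pow 0) \<X>)
      = snoc n \<cdot> ((ide M (pow n) \<odot> snoc 0) \<cdot> assoc M (pow n) (pow 0) \<X>)"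
    using triangle[of "pow n" \<X>] join_snoc[of n 0] by (simp del: join.simps(2))
qed (simp_all add: tensor_power.simps(2))

lemma nfold_1: "nfold (Suc 0) = ide M \<X>"
  using nfold_snoc[of 0] by (simp add: snoc_def monoid_units flip: cmp_cmp)

declare join.simps(2) [simp del] nfold.simps(2) [simp del]

lemma join_0_left: "join 0 n = lunit M (pow n)"
proof (induction n)
  case 0
  \<comment> \<open>\<open>join 0 0\<close> is by definition a right unitor, so the two unitors at
    the unit object have to agree.\<close>
  show ?case by (simp add: lunit_unit)
next
  case (Suc n)
  let ?h = "(ide M (pow 0) \<odot> snoc n) \<cdot> assoc M (pow 0) (pow n) \<X>"
  have "join 0 (Suc n) \<cdot> ?h = snoc n \<cdot> (lunit M (pow n) \<odot> ide M \<X>)"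
    by (simp only: join_snoc Suc) simp
  also have "\<dots> = snoc n \<cdot> (lunit M (pow n \<otimes> \<X>) \<cdot> assoc M (unit M) (pow n) \<X>)"
    by (simp add: lunit_ten)
  also have "\<dots> = (lunit M (pow (Suc n)) \<cdot> (ide M (unit M) \<odot> snoc n)) \<cdot> assoc M (unit M) (pow n) \<X>"
    by (subst lunit_natural) (simp_all add: cmp_cmp)
  also have "\<dots> = lunit M (pow (Suc n)) \<cdot> ?h"
    by (simp add: cmp_cmp)
  finally show ?case
    by (rule iso_cancel_right) simp_all
qed

text \<open>Induction on the last exponent: the base case is \<open>runit_ten\<close>, and the step
  uses the pentagon for \<open>pow n\<close>, \<open>pow m\<close>, \<open>pow k\<close> and
  \<open>\<X>\<close>.\<close>

lemma join_assoc:
  "join (n + m) k \<cdot> (join n m \<odot> ide M (pow k))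
   = join n (m + k) \<cdot> ((ide M (pow n) \<odot> join m k) \<cdot> assoc M (pow n) (pow m) (pow k))"
proof (induction k)
  case 0
  have "join (n + m) 0 \<cdot> (join n m \<odot> ide M (pow 0)) = join n m \<cdot> runit M (pow n \<otimes> pow m)"
    using runit_natural[of "join n m"] by simp
  then show ?case by (simp add: runit_ten)
next
  case (Suc k)
  let ?A = "pow n" and ?B = "pow m" and ?D = "pow k"
  let ?iA = "ide M ?A" and ?iX = "ide M \<X>"
  \<comment> \<open>\<open>?h\<close> assembles \<open>pow (Suc k)\<close> from \<open>pow k\<close>
    and \<open>\<X>\<close>, starting with \<open>\<X>\<close> outermost, so that the induction
    hypothesis can act on the remaining three powers.\<close>
  let ?h = "(ide M (?A \<otimes> ?B) \<odot> snoc k) \<cdot> assoc M (?A \<otimes> ?B) ?D \<X>"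
  have "(join (n + m) (Suc k) \<cdot> (join n m \<odot> ide M (pow (Suc k)))) \<cdot> ?h
      = join (n + m) (Suc k) \<cdot> ((ide M (pow (n + m)) \<odot> snoc k) \<cdot>
          ((join n m \<odot> (ide M ?D \<odot> ?iX)) \<cdot> assoc M (?A \<otimes> ?B) ?D \<X>))"
    by (simp add: cmp_cmp interchange_cmp)
  also have "(join n m \<odot> (ide M ?D \<odot> ?iX)) \<cdot> assoc M (?A \<otimes> ?B) ?D \<X>
      = assoc M (pow (n + m)) ?D \<X> \<cdot> ((join n m \<odot> ide M ?D) \<odot> ?iX)"
    by (subst assoc_natural) simp_all
  also have "join (n + m) (Suc k) \<cdot> ((ide M (pow (n + m)) \<odot> snoc k) \<cdot> \<dots>)
      = snoc (n + m + k) \<cdot> ((join (n + m) k \<cdot> (join n m \<odot> ide M ?D)) \<odot> ?iX)"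
    by (subst join_snoc_cmp) (simp_all add: interchange)
  also have "\<dots> = snoc (n + m + k) \<cdot>
      ((join n (m + k) \<cdot> ((?iA \<odot> join m k) \<cdot> assoc M ?A ?B ?D)) \<odot> ?iX)"
    by (simp only: Suc)
  also have "\<dots> = snoc (n + (m + k)) \<cdot> ((join n (m + k) \<odot> ?iX) \<cdot>
      (((?iA \<odot> join m k) \<odot> ?iX) \<cdot> (assoc M ?A ?B ?D \<odot> ?iX)))"
    by (simp add: interchange add.assoc)
  also have "\<dots> = join n (Suc (m + k)) \<cdot> ((?iA \<odot> snoc (m + k)) \<cdot> (assoc M ?A (pow (m + k)) \<X> \<cdot>
      (((?iA \<odot> join m k) \<odot> ?iX) \<cdot> (assoc M ?A ?B ?D \<odot> ?iX))))"
    by (subst join_snoc_cmp) (simp_all add: add.assoc)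
  also have "\<dots> = join n (Suc (m + k)) \<cdot> ((?iA \<odot> snoc (m + k)) \<cdot> ((?iA \<odot> (join m k \<odot> ?iX)) \<cdot>
      (assoc M ?A (?B \<otimes> ?D) \<X> \<cdot> (assoc M ?A ?B ?D \<odot> ?iX))))"
    by (subst assoc_natural_cmp) simp_all
  also have "\<dots> = join n (Suc (m + k)) \<cdot> ((?iA \<odot> (snoc (m + k) \<cdot> (join m k \<odot> ?iX))) \<cdot>
      (assoc M ?A (?B \<otimes> ?D) \<X> \<cdot> (assoc M ?A ?B ?D \<odot> ?iX)))"
    by (simp add: interchange_cmp)
  also have "snoc (m + k) \<cdot> (join m k \<odot> ?iX) = join m (Suc k) \<cdot> ((ide M ?B \<odot> snoc k) \<cdot> assoc M ?B ?D \<X>)"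
    by (simp only: join_snoc)
  also have "join n (Suc (m + k)) \<cdot> ((?iA \<odot> \<dots>) \<cdot>
      (assoc M ?A (?B \<otimes> ?D) \<X> \<cdot> (assoc M ?A ?B ?D \<odot> ?iX)))
    = join n (Suc (m + k)) \<cdot> ((?iA \<odot> (join m (Suc k) \<cdot> (ide M ?B \<odot> snoc k))) \<cdot>
      ((?iA \<odot> assoc M ?B ?D \<X>) \<cdot> assoc M ?A (?B \<otimes> ?D) \<X> \<cdot> (assoc M ?A ?B ?D \<odot> ?iX)))"
    by (simp add: cmp_cmp interchange_cmp)
  also have "\<dots> = join n (Suc (m + k)) \<cdot> ((?iA \<odot> join m (Suc k)) \<cdot>
      (((?iA \<odot> (ide M ?B \<odot> snoc k)) \<cdot> assoc M ?A ?B (?D \<otimes> \<X>)) \<cdot> assoc M (?A \<otimes> ?B) ?D \<X>))"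
    by (subst pentagon) (simp_all add: cmp_cmp interchange_cmp)
  also have "(?iA \<odot> (ide M ?B \<odot> snoc k)) \<cdot> assoc M ?A ?B (?D \<otimes> \<X>)
      = assoc M ?A ?B (pow (Suc k)) \<cdot> (ide M (?A \<otimes> ?B) \<odot> snoc k)"
    using assoc_natural[of ?iA "ide M ?B" "snoc k" ?A ?B "pow (Suc k)"] by simp
  also have "join n (Suc (m + k)) \<cdot> ((?iA \<odot> join m (Suc k)) \<cdot> (\<dots> \<cdot> assoc M (?A \<otimes> ?B) ?D \<X>))
      = (join n (m + Suc k) \<cdot> ((?iA \<odot> join m (Suc k)) \<cdot> assoc M ?A ?B (pow (Suc k)))) \<cdot> ?h"
    by (simp add: cmp_cmp)
  finally show ?case
    by (rule iso_cancel_right) (simp_all add: add.assoc)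
qed

text \<open>General associativity of the monoid: the base case is its right unit law, and each step
  of the induction on \<open>k\<close> uses \<open>monoid_assoc\<close> once.\<close>

lemma nfold_join: "nfold (n + k) \<cdot> join n k = \<mu> \<cdot> (nfold n \<odot> nfold k)"
proof (induction k)
  case 0
  have "\<mu> \<cdot> (nfold n \<odot> \<eta>) = \<mu> \<cdot> ((ide M \<X> \<odot> \<eta>) \<cdot> (nfold n \<odot> ide M (unit M)))"
    by (simp add: interchange)
  also have "\<dots> = (\<mu> \<cdot> (ide M \<X> \<odot> \<eta>)) \<cdot> (nfold n \<odot> ide M (unit M))"
    by (simp add: cmp_cmp)
  also have "\<dots> = nfold n \<cdot> runit M (pow n)"
    by (simp add: monoid_units runit_natural)
  finally show ?case by simp
next
  case (Suc k)
  let ?A = "pow n" and ?D = "pow k" and ?iX = "ide M \<X>"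
  let ?h = "(ide M ?A \<odot> snoc k) \<cdot> assoc M ?A ?D \<X>"
  have "(nfold (n + Suc k) \<cdot> join n (Suc k)) \<cdot> ?h = nfold (Suc (n + k)) \<cdot> (join n (Suc k) \<cdot> ?h)"
    by (simp add: cmp_cmp)
  also have "\<dots> = (nfold (Suc (n + k)) \<cdot> snoc (n + k)) \<cdot> (join n k \<odot> ?iX)"
    by (simp add: join_snoc cmp_cmp)
  also have "\<dots> = \<mu> \<cdot> ((nfold (n + k) \<cdot> join n k) \<odot> ?iX)"
    by (simp add: nfold_snoc cmp_cmp interchange)
  also have "\<dots> = (\<mu> \<cdot> (\<mu> \<odot> ?iX)) \<cdot> ((nfold n \<odot> nfold k) \<odot> ?iX)"
    by (simp add: Suc cmp_cmp interchange)
  also have "\<dots> = \<mu> \<cdot> ((?iX \<odot> \<mu>) \<cdot> (assoc M \<X> \<X> \<X> \<cdot> ((nfold n \<odot> nfold k) \<odot> ?iX)))"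
    by (simp add: monoid_assoc cmp_cmp)
  also have "\<dots> = \<mu> \<cdot> ((?iX \<odot> \<mu>) \<cdot> ((nfold n \<odot> (nfold k \<odot> ?iX)) \<cdot> assoc M ?A ?D \<X>))"
    by (subst assoc_natural) simp_all
  also have "\<dots> = \<mu> \<cdot> ((nfold n \<odot> (\<mu> \<cdot> (nfold k \<odot> ?iX))) \<cdot> assoc M ?A ?D \<X>)"
    by (simp add: interchange_cmp)
  also have "\<dots> = (\<mu> \<cdot> (nfold n \<odot> nfold (Suc k))) \<cdot> ?h"
    by (simp add: cmp_cmp interchange_cmp flip: nfold_snoc)
  finally show ?case
    by (rule iso_cancel_right) simp_all
qed

text \<open>The decomposition chosen by \<open>SOME\<close> exists and is unique for arrows of \<open>Delta_a\<close> with codomain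
  \<open>Suc n'\<close>; other arguments give junk.\<close>

primrec act :: "nat \<Rightarrow> nat \<times> nat \<times> (nat \<Rightarrow> nat) \<Rightarrow> 'a" where
  "act 0 w = ide M (unit M)"
| "act (Suc n') w =
     (case (SOME (p, k, w'). w' \<in> hom Delta_a p n' \<and> w = ord_sum w' (to_one k)) of
        (p, k, w') \<Rightarrow> snoc n' \<cdot> ((act n' w' \<odot> nfold k) \<cdot> arr_inv M (join p k)))"

section \<open>Monoidality and functoriality of the action on tensor powers\<close>

lemma act_ord_sum:
  assumes "w \<in> hom Delta_a p n'"
  shows "act (Suc n') (ord_sum w (to_one k)) = snoc n' \<cdot> ((act n' w \<odot> nfold k) \<cdot> arr_inv M (join p k))"
proof -
  have "(SOME (p', k', w'). w' \<in> hom Delta_a p' n' \<and> ord_sum w (to_one k) = ord_sum w' (to_one k'))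
      = (p, k, w)"
    by (rule some_equality) (use assms in \<open>auto dest: ord_sum_eqD[OF _ _ to_one_hom _ to_one_hom]\<close>)
  then show ?thesis by simp
qed

declare act.simps(2) [simp del]

lemma act_arr [simp]:
  assumes "w \<in> hom Delta_a n n'"
  shows "act n' w \<in> Arr M" "Dom M (act n' w) = pow n" "Cod M (act n' w) = pow n'"
  using assms by (induction rule: hom_Delta_a_induct) (simp_all add: act_ord_sum)

text \<open>Naturality of the structure isomorphisms. The last block of \<open>v\<close> is also the
  last block of the whole sum, because \<open>ord_sum\<close> is associative;
  \<open>join_assoc\<close> is the matching statement for tensor powers.\<close>

lemma join_act:
  assumes w: "w \<in> hom Delta_a n n'" and "v \<in> hom Delta_a m m'"
  shows "join n' m' \<cdot> (act n' w \<odot> act m' v) = act (n' + m') (ord_sum w v) \<cdot> join n m"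
  using assms(2)
proof (induction rule: hom_Delta_a_induct)
  case empty
  then show ?case using w runit_natural[of "act n' w"] by (simp add: ord_sum_0_right[OF w])
next
  case (snoc m m' v k)
  note v = snoc.hyps
  note wv = ord_sum_hom[OF w v]
  note wvk = ord_sum_hom[OF wv to_one_hom[of k]]
  note vk = ord_sum_hom[OF v to_one_hom[of k]]
  note [simp] = act_arr[OF w] act_arr[OF v] act_arr[OF wv] act_arr[OF vk, simplified] act_arr[OF wvk, simplified]
  note assoc' = ord_sum_assoc[OF w v to_one_hom[of k], symmetric]
  let ?A = "pow n"
  let ?h = "(ide M ?A \<odot> join m k) \<cdot> assoc M ?A (pow m) (pow k)"
  have "(join n' (Suc m') \<cdot> (act n' w \<odot> act (Suc m') (ord_sum v (to_one k)))) \<cdot> ?h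
      = join n' (Suc m') \<cdot> ((ide M (pow n') \<odot> snoc m') \<cdot>
          ((act n' w \<odot> (act m' v \<odot> nfold k)) \<cdot> assoc M ?A (pow m) (pow k)))"
    by (simp add: act_ord_sum[OF v] cmp_cmp interchange_cmp)
  also have "(act n' w \<odot> (act m' v \<odot> nfold k)) \<cdot> assoc M ?A (pow m) (pow k)
      = assoc M (pow n') (pow m') \<X> \<cdot> ((act n' w \<odot> act m' v) \<odot> nfold k)"
    by (subst assoc_natural) simp_all
  also have "join n' (Suc m') \<cdot> ((ide M (pow n') \<odot> snoc m') \<cdot> \<dots>)
      = snoc (n' + m') \<cdot> ((join n' m' \<cdot> (act n' w \<odot> act m' v)) \<odot> nfold k)"
    by (subst join_snoc_cmp) (simp_all add: interchange)
  also have "\<dots> = snoc (n' + m') \<cdot> ((act (n' + m') (ord_sum w v) \<odot> nfold k) \<cdot> (join n m \<odot> ide M (pow k)))"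
    by (simp add: snoc.IH interchange)
  also have "\<dots> = act (Suc (n' + m')) (ord_sum w (ord_sum v (to_one k))) \<cdot>
      (join (n + m) k \<cdot> (join n m \<odot> ide M (pow k)))"
    by (simp add: assoc' act_ord_sum[OF wv] cmp_cmp)
  also have "\<dots> = (act (n' + Suc m') (ord_sum w (ord_sum v (to_one k))) \<cdot> join n (m + k)) \<cdot> ?h"
    by (simp add: join_assoc cmp_cmp assoc' add.assoc)
  finally show ?case
    by (rule iso_cancel_right) (simp_all add: assoc' add.assoc)
qed

text \<open>Functoriality in the case where the outer map goes to \<open>1\<close>, in view of
  \<open>act_to_one\<close>. It comes first because \<open>act_cmp\<close> needs it on the last
  block.\<close>

lemma nfold_act: "w \<in> hom Delta_a n n' \<Longrightarrow> nfold n' \<cdot> act n' w = nfold n"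
proof (induction rule: hom_Delta_a_induct)
  case empty
  show ?case by simp
next
  case (snoc p n' w k)
  note w = snoc.hyps
  note [simp] = act_arr[OF w]
  have "nfold (Suc n') \<cdot> act (Suc n') (ord_sum w (to_one k))
      = (nfold (Suc n') \<cdot> snoc n') \<cdot> ((act n' w \<odot> nfold k) \<cdot> arr_inv M (join p k))"
    by (simp add: act_ord_sum[OF w] cmp_cmp)
  also have "\<dots> = (\<mu> \<cdot> ((nfold n' \<cdot> act n' w) \<odot> nfold k)) \<cdot> arr_inv M (join p k)"
    by (simp add: nfold_snoc cmp_cmp interchange_cmp)
  also have "\<dots> = (nfold (p + k) \<cdot> join p k) \<cdot> arr_inv M (join p k)"
    by (simp only: snoc.IH nfold_join)
  also have "\<dots> = nfold (p + k)"
    by (simp add: cmp_cmp)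
  finally show ?case .
qed

text \<open>Induction on the outer map. The inner map is cut along the decomposition
  \<open>p + k\<close> of its codomain, so the composite is computed blockwise: the first block by
  the induction hypothesis, the last by \<open>nfold_act\<close>.\<close>

lemma act_cmp:
  assumes "w \<in> hom Delta_a n n'" "v \<in> hom Delta_a n' n''"
  shows "act n'' (v \<cdot>\<^bsub>Delta_a\<^esub> w) = act n'' v \<cdot> act n' w"
  using assms(2,1)
proof (induction arbitrary: n w rule: hom_Delta_a_induct)
  case empty
  then show ?case by (simp add: hom_Delta_a_0)
next
  case (snoc p n'' v k)
  note v = snoc.hyps
  obtain n1 n2 w1 w2 where n: "n = n1 + n2" and w1: "w1 \<in> hom Delta_a n1 p"
    and w2: "w2 \<in> hom Delta_a n2 k" and w: "w = ord_sum w1 w2"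
    using snoc.prems by (rule ord_sum_decompose)
  note w12 = ord_sum_hom[OF w1 w2]
  note vw = cmp_hom_Delta_a[OF w1 v]
  note vk = ord_sum_hom[OF v to_one_hom[of k]]
  note [simp] = act_arr[OF w1] act_arr[OF w2] act_arr[OF w12] act_arr[OF v] act_arr[OF vw] act_arr[OF vk, simplified]
  have "to_one k \<cdot>\<^bsub>Delta_a\<^esub> w2 = to_one n2"
    using cmp_hom_Delta_a[OF w2 to_one_hom] by (simp only: hom_Delta_a_1)
  then have "ord_sum v (to_one k) \<cdot>\<^bsub>Delta_a\<^esub> w = ord_sum (v \<cdot>\<^bsub>Delta_a\<^esub> w1) (to_one n2)"
    using ord_sum_cmp[OF w1 w2 v to_one_hom] w by simp
  then have "act (Suc n'') (ord_sum v (to_one k) \<cdot>\<^bsub>Delta_a\<^esub> w) \<cdot> join n1 n2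
      = snoc n'' \<cdot> ((act n'' v \<cdot> act p w1) \<odot> nfold n2)"
    by (simp add: act_ord_sum[OF vw] snoc.IH[OF w1] cmp_cmp)
  also have "\<dots> = snoc n'' \<cdot> ((act n'' v \<odot> nfold k) \<cdot> (act p w1 \<odot> act k w2))"
    by (simp add: interchange nfold_act[OF w2])
  also have "\<dots> = act (Suc n'') (ord_sum v (to_one k)) \<cdot> (join p k \<cdot> (act p w1 \<odot> act k w2))"
    by (simp add: act_ord_sum[OF v] cmp_cmp)
  also have "\<dots> = (act (Suc n'') (ord_sum v (to_one k)) \<cdot> act (p + k) w) \<cdot> join n1 n2"
    by (simp add: join_act[OF w1 w2] w cmp_cmp)
  finally show ?case
    using act_arr[OF cmp_hom_Delta_a[OF snoc.prems vk, simplified]] n w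
    by (elim iso_cancel_right) simp_all
qed

lemma act_id: "act n (ord_id n) = ide M (pow n)"
proof (induction n)
  case (Suc n)
  have "ord_id (Suc n) = ord_sum (ord_id n) (to_one (Suc 0))"
    using to_one_1 by simp
  then show ?case
    by (simp add: act_ord_sum[OF ord_id_hom] Suc nfold_1 join_1)
qed simp

text \<open>With an empty first block, \<open>snoc 0\<close> and \<open>join 0 k\<close> are both
  left unitors, which cancel by naturality.\<close>

lemma act_to_one: "act (Suc 0) (to_one k) = nfold k"
proof -
  have "act (Suc 0) (to_one k) = act (Suc 0) (ord_sum (ord_id 0) (to_one k))"
    by (simp add: ord_sum_0_left[OF to_one_hom])
  also have "\<dots> = (snoc 0 \<cdot> (ide M (unit M) \<odot> nfold k)) \<cdot> arr_inv M (lunit M (pow k))"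
    by (simp add: act_ord_sum[OF ord_id_hom] join_0_left cmp_cmp)
  also have "\<dots> = nfold k"
    by (simp add: snoc_def lunit_natural cmp_cmp)
  finally show ?thesis .
qed

definition monoid_functor :: "(nat, nat \<times> nat \<times> (nat \<Rightarrow> nat), 'o, 'a) monftor" where
  "monoid_functor = \<lparr>fobj = pow, farr = (\<lambda>w. act (Cod Delta_a w) w), mf_unit = ide M (unit M), mf_ten = join\<rparr>"

theorem corresponds_monoid_functor: "corresponds_to_monoid M T monoid_functor"
proof -
  interpret D: monoidal_category Delta_a by (rule monoidal_Delta_a)
  note simps = monoid_functor_def act_arr act_id
  have "strong_monoidal_functor Delta_a M monoid_functor"
  proof
    show "is_functor Delta_a M monoid_functor"
      unfolding is_functor_def
    proof (intro conjI ballI)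
      fix A B E f g assume f: "f \<in> hom Delta_a A B" and g: "g \<in> hom Delta_a B E"
      show "farr monoid_functor (g \<cdot>\<^bsub>Delta_a\<^esub> f) = farr monoid_functor g \<cdot> farr monoid_functor f"
        using act_cmp[OF f g] homD[OF f] homD[OF g] by (simp add: simps)
    next
      fix A B f assume f: "f \<in> hom Delta_a A B"
      show "farr monoid_functor f \<in> hom M (fobj monoid_functor A) (fobj monoid_functor B)"
        using act_arr[OF f] homD[OF f] by (simp add: simps hom_def)
    qed (auto simp: simps homD[OF ord_id_hom])
  next
    fix w n n' v m m' assume w: "w \<in> hom Delta_a n n'" and v: "v \<in> hom Delta_a m m'"
    show "mf_ten monoid_functor n' m' \<cdot> (farr monoid_functor w \<odot> farr monoid_functor v) =
       farr monoid_functor (w \<odot>\<^bsub>Delta_a\<^esub> v) \<cdot> mf_ten monoid_functor n m"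
      using join_act[OF w v] homD[OF w] homD[OF v] homD[OF ord_sum_hom[OF w v]] by (simp add: simps)
  next
    fix n m k
    show "farr monoid_functor (assoc Delta_a n m k) \<cdot> mf_ten monoid_functor (n \<otimes>\<^bsub>Delta_a\<^esub> m) k \<cdot>
          (mf_ten monoid_functor n m \<odot> ide M (fobj monoid_functor k))
        = mf_ten monoid_functor n (m \<otimes>\<^bsub>Delta_a\<^esub> k) \<cdot>
          (ide M (fobj monoid_functor n) \<odot> mf_ten monoid_functor m k) \<cdot>
          assoc M (fobj monoid_functor n) (fobj monoid_functor m) (fobj monoid_functor k)"
      using join_assoc[of n m k] by (simp add: simps homD[OF ord_id_hom] cmp_cmp add.assoc)
  qed (auto simp: simps homD[OF ord_id_hom] join_0_left add.assoc intro!: is_iso_in_iso_hom)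
  moreover have "nfold 2 \<cdot> join (Suc 0) (Suc 0) = \<mu>"
    using nfold_snoc[of "Suc 0"] by (simp add: join_1 nfold_1 numeral_2_eq_2)
  ultimately show ?thesis
    by (simp add: corresponds_to_monoid_def monoid_functor_def act_to_one homD[OF to_one_hom])
qed

end

section \<open>The lax double functor of a metamodel\<close>

lemma (in category) opc_prodc_simps:
  "Obj (opc C \<times>\<^sub>c D) = Obj C \<times> Obj D"
  "(f, g) \<in> hom (opc C \<times>\<^sub>c D) (A, B) (A', B') \<longleftrightarrow> f \<in> hom C A' A \<and> g \<in> hom D B B'"
  "ide (opc C \<times>\<^sub>c D) (A, B) = (ide C A, ide D B)"
  "(f', g') \<cdot>\<^bsub>(opc C \<times>\<^sub>c D)\<^esub> (f, g) = (f \<cdot>\<^bsub>C\<^esub> f', g' \<cdot>\<^bsub>D\<^esub> g)"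
  by (auto simp: opc_def prodc_def hom_def)

lemma is_profI:
  assumes "category C"
    and "\<And>A B A' B' f g x. \<lbrakk>f \<in> hom C A' A; g \<in> hom D B B'; A \<in> Obj C; A' \<in> Obj C; B \<in> Obj D; B' \<in> Obj D;
        x \<in> on_obj H (A, B)\<rbrakk> \<Longrightarrow> on_arr H (f, g) x \<in> on_obj H (A', B')"
    and "\<And>A B x. \<lbrakk>A \<in> Obj C; B \<in> Obj D; x \<in> on_obj H (A, B)\<rbrakk> \<Longrightarrow> on_arr H (ide C A, ide D B) x = x"
    and "\<And>A B A' B' A'' B'' f g f' g' x. \<lbrakk>f \<in> hom C A' A; g \<in> hom D B B'; f' \<in> hom C A'' A'; g' \<in> hom D B' B'';
        A \<in> Obj C; A' \<in> Obj C; A'' \<in> Obj C; B \<in> Obj D; B' \<in> Obj D; B'' \<in> Obj D;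
        x \<in> on_obj H (A, B)\<rbrakk> \<Longrightarrow> on_arr H (f \<cdot>\<^bsub>C\<^esub> f', g' \<cdot>\<^bsub>D\<^esub> g) x = on_arr H (f', g') (on_arr H (f, g) x)"
  shows "is_prof C D H"
proof -
  interpret category C by fact
  show ?thesis
    unfolding is_prof_def is_setfun_def
    by (auto simp: opc_prodc_simps assms(2,3,4))
qed

lemma is_profD:
  assumes "is_prof C D H" "category C"
    "f \<in> hom C A' A" "g \<in> hom D B B'" "A \<in> Obj C" "A' \<in> Obj C" "B \<in> Obj D" "B' \<in> Obj D"
    "x \<in> on_obj H (A, B)"
  shows "on_arr H (f, g) x \<in> on_obj H (A', B')"
proof -
  interpret category C by fact
  have "\<forall>A\<in>Obj (opc C \<times>\<^sub>c D). \<forall>B\<in>Obj (opc C \<times>\<^sub>c D). \<forall>f\<in>hom (opc C \<times>\<^sub>c D) A B. \<forall>x\<in>on_obj H A. on_arr H f x \<in> on_obj H B"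
    using assms(1) unfolding is_prof_def is_setfun_def by blast
  from this[rule_format, of "(A, B)" "(A', B')" "(f, g)" x] show ?thesis
    using assms by (simp add: opc_prodc_simps)
qed

text \<open>Descent to the coend: \<open>g\<close> respects the generating relation, hence its
  equivalence closure. The singleton form is what lets \<open>the_elem\<close> in
  \<open>Phi_lax\<close> be evaluated.\<close>

lemma coend_class_image:
  assumes "\<And>q r. (q, r) \<in> coend_step A B D K H X Z \<Longrightarrow> g q = g r"
  shows "g ` coend_class A B D K H X Z p = {g p}"
proof -
  have eq: "g q = g p" if "(p, q) \<in> (coend_step A B D K H X Z \<union> (coend_step A B D K H X Z)\<inverse>)\<^sup>*" for q
    using that
  proof (induction rule: rtrancl_induct)
    case (step q r)
    then show ?case using assms[of q r] assms[of r q] by auto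
  qed simp
  have "g ` coend_class A B D K H X Z p = (\<lambda>_. g p) ` coend_class A B D K H X Z p"
    by (rule image_cong[OF refl], rule eq) (simp add: coend_class_def)
  moreover have "p \<in> coend_class A B D K H X Z p" by (simp add: coend_class_def)
  ultimately show ?thesis by (simp only: image_constant)
qed

text \<open>Both ends of a generating step are well typed, since profunctors respect their carriers.
  This matters because \<open>prof_comp\<close> acts through all members of a class.\<close>

lemma coend_class_elems:
  assumes "is_prof B D K" "is_prof A B H" "category A" "category B" "category D"
    and "X \<in> Obj A" "Z \<in> Obj D" "p \<in> coend_elems B K H X Z"
  shows "coend_class A B D K H X Z p \<subseteq> coend_elems B K H X Z"
proof -
  interpret A: category A by fact
  interpret B: category B by fact
  interpret D: category D by fact
  have step: "q \<in> coend_elems B K H X Z \<and> r \<in> coend_elems B K H X Z" if "(q, r) \<in> coend_step A B D K H X Z" for q r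
    using that assms(6,7) unfolding coend_step_def coend_elems_def
    by (auto intro!: is_profD[OF assms(1,4)] is_profD[OF assms(2,3)] B.ide_in A.ide_in D.ide_in)
  have "q \<in> coend_elems B K H X Z"
    if "(p, q) \<in> (coend_step A B D K H X Z \<union> (coend_step A B D K H X Z)\<inverse>)\<^sup>*" for q
    using that by (induction rule: rtrancl_induct) (use assms(8) step in auto)
  then show ?thesis by (auto simp: coend_class_def)
qed

section \<open>Laws of a metamodel in terms of domains and codomains\<close>

context metamodel
begin

lemma triple_simps:
  "Obj (opc M \<times>\<^sub>c opc C \<times>\<^sub>c C) = Obj M \<times> Obj C \<times> Obj C"
  "(t, f, g) \<in> hom (opc M \<times>\<^sub>c opc C \<times>\<^sub>c C) (X, A, B) (X', A', B')
     \<longleftrightarrow> (t \<in> Arr M \<and> Dom M t = X' \<and> Cod M t = X) \<and> (f \<in> Arr C \<and> Dom C f = A' \<and> Cod C f = A) \<and>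
       (g \<in> Arr C \<and> Dom C g = B \<and> Cod C g = B')"
  "ide (opc M \<times>\<^sub>c opc C \<times>\<^sub>c C) (X, A, B) = (ide M X, ide C A, ide C B)"
  "(t', f', g') \<cdot>\<^bsub>(opc M \<times>\<^sub>c opc C \<times>\<^sub>c C)\<^esub> (t, f, g) = (t \<cdot>\<^bsub>M\<^esub> t', f \<cdot>\<^bsub>C\<^esub> f', g' \<cdot>\<^bsub>C\<^esub> g)"
  by (auto simp: opc_def prodc_def hom_def)

lemma PhiA_in [simp]:
  assumes "t \<in> Arr M" "f \<in> Arr C" "g \<in> Arr C" "x \<in> PhiO P (Cod M t) (Cod C f) (Dom C g)"
    "Dom M t = X" "Dom C f = A" "Cod C g = B"
  shows "PhiA P t f g x \<in> PhiO P X A B"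
proof -
  have "\<forall>A\<in>Obj (opc M \<times>\<^sub>c opc C \<times>\<^sub>c C). \<forall>B\<in>Obj (opc M \<times>\<^sub>c opc C \<times>\<^sub>c C). \<forall>f\<in>hom (opc M \<times>\<^sub>c opc C \<times>\<^sub>c C) A B.
      \<forall>x\<in>on_obj (mm_fun P) A. on_arr (mm_fun P) f x \<in> on_obj (mm_fun P) B"
    using Phi_functor unfolding is_setfun_def by blast
  from this[rule_format, of "(Cod M t, Cod C f, Dom C g)" "(X, A, B)" "(t, f, g)" x]
  show ?thesis using assms by (auto simp: triple_simps)
qed

lemma PhiA_ide [simp]:
  assumes "X \<in> Obj M" "A \<in> Obj C" "B \<in> Obj C" "x \<in> PhiO P X A B"
  shows "PhiA P (ide M X) (ide C A) (ide C B) x = x"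
proof -
  have "\<forall>A\<in>Obj (opc M \<times>\<^sub>c opc C \<times>\<^sub>c C).
      \<forall>x\<in>on_obj (mm_fun P) A. on_arr (mm_fun P) (ide (opc M \<times>\<^sub>c opc C \<times>\<^sub>c C) A) x = x"
    using Phi_functor unfolding is_setfun_def by blast
  from this[rule_format, of "(X, A, B)" x]
  show ?thesis using assms by (auto simp: triple_simps)
qed

lemma PhiA_PhiA:
  assumes "t \<in> Arr M" "f \<in> Arr C" "g \<in> Arr C" "t' \<in> Arr M" "f' \<in> Arr C" "g' \<in> Arr C"
    "Cod M t' = Dom M t" "Cod C f' = Dom C f" "Dom C g' = Cod C g"
    "x \<in> PhiO P (Cod M t) (Cod C f) (Dom C g)"
  shows "PhiA P t' f' g' (PhiA P t f g x) = PhiA P (t \<cdot>\<^bsub>M\<^esub> t') (f \<cdot>\<^bsub>C\<^esub> f') (g' \<cdot>\<^bsub>C\<^esub> g) x"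
proof -
  let ?Q = "opc M \<times>\<^sub>c opc C \<times>\<^sub>c C"
  have "\<forall>A\<in>Obj ?Q. \<forall>B\<in>Obj ?Q. \<forall>E\<in>Obj ?Q. \<forall>f\<in>hom ?Q A B. \<forall>g\<in>hom ?Q B E.
      \<forall>x\<in>on_obj (mm_fun P) A. on_arr (mm_fun P) (g \<cdot>\<^bsub>?Q\<^esub> f) x = on_arr (mm_fun P) g (on_arr (mm_fun P) f x)"
    using Phi_functor unfolding is_setfun_def by blast
  from this[rule_format, of "(Cod M t, Cod C f, Dom C g)" "(Dom M t, Dom C f, Cod C g)"
      "(Dom M t', Dom C f', Cod C g')" "(t, f, g)" "(t', f', g')" x]
  show ?thesis using assms by (auto simp: triple_simps)
qed

lemma mm_unit_in [simp]: "A \<in> Obj C \<Longrightarrow> mm_unit P A \<in> PhiO P (unit M) A A"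
  by (rule unit_in_Phi)

lemma mm_mult_in [simp]:
  "\<lbrakk>y \<in> PhiO P Y B D; x \<in> PhiO P X A B; X \<in> Obj M; Y \<in> Obj M; A \<in> Obj C; B \<in> Obj C; D \<in> Obj C;
    Y \<otimes>\<^bsub>M\<^esub> X = Z\<rbrakk> \<Longrightarrow> mm_mult P X Y A B D y x \<in> PhiO P Z A D"
  using mult_in_Phi by auto

lemma mm_mult_PhiA:
  assumes "s \<in> Arr M" "t \<in> Arr M" "a \<in> Arr C" "d \<in> Arr C" "B \<in> Obj C"
    "y \<in> PhiO P (Cod M t) B (Dom C d)" "x \<in> PhiO P (Cod M s) (Cod C a) B"
    "Dom M s = X" "Dom M t = Y" "Dom C a = A" "Cod C d = D"
  shows "mm_mult P X Y A B D (PhiA P t (ide C B) d y) (PhiA P s a (ide C B) x)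
    = PhiA P (t \<odot>\<^bsub>M\<^esub> s) a d (mm_mult P (Cod M s) (Cod M t) (Cod C a) B (Dom C d) y x)"
  using assms by (intro mult_nat) (auto intro: homI)

lemma mm_mult_PhiA_left:
  assumes "t \<in> Arr M" "d \<in> Arr C" "A \<in> Obj C" "B \<in> Obj C" "X \<in> Obj M"
    "y \<in> PhiO P (Cod M t) B (Dom C d)" "x \<in> PhiO P X A B"
    "Dom M t = Y" "Cod C d = D"
  shows "mm_mult P X Y A B D (PhiA P t (ide C B) d y) x
    = PhiA P (t \<odot>\<^bsub>M\<^esub> ide M X) (ide C A) d (mm_mult P X (Cod M t) A B (Dom C d) y x)"
  using mm_mult_PhiA[of "ide M X" t "ide C A" d B y x X Y A D] assms by simp

lemma mm_mult_PhiA_right: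
  assumes "s \<in> Arr M" "a \<in> Arr C" "B \<in> Obj C" "D \<in> Obj C" "Y \<in> Obj M"
    "y \<in> PhiO P Y B D" "x \<in> PhiO P (Cod M s) (Cod C a) B"
    "Dom M s = X" "Dom C a = A"
  shows "mm_mult P X Y A B D y (PhiA P s a (ide C B) x)
    = PhiA P (ide M Y \<odot>\<^bsub>M\<^esub> s) a (ide C D) (mm_mult P (Cod M s) Y (Cod C a) B D y x)"
  using mm_mult_PhiA[of s "ide M Y" a "ide C D" B y x X Y A D] assms by simp

lemma mm_mult_extranatural:
  assumes "b \<in> Arr C" "X \<in> Obj M" "Y \<in> Obj M" "A \<in> Obj C" "D \<in> Obj C"
    "y \<in> PhiO P Y (Cod C b) D" "x \<in> PhiO P X A (Dom C b)"
  shows "mm_mult P X Y A (Cod C b) D y (PhiA P (ide M X) (ide C A) b x)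
    = mm_mult P X Y A (Dom C b) D (PhiA P (ide M Y) b (ide C D) y) x"
  using assms by (intro mult_extranat) (auto intro: homI)

lemma mm_unit_extranatural:
  "f \<in> Arr C \<Longrightarrow> PhiA P (ide M (unit M)) f (ide C (Cod C f)) (mm_unit P (Cod C f))
    = PhiA P (ide M (unit M)) (ide C (Dom C f)) f (mm_unit P (Dom C f))"
  using unit_extranat[of f "Dom C f" "Cod C f"] by (simp add: hom_def)

end

section \<open>Strong monoidal functors and their inverted coherence laws\<close>

context strong_monoidal_functor
begin

lemma fobj_obj [simp]: "n \<in> Obj N \<Longrightarrow> fobj S n \<in> Obj M"
  using S_functor by (auto simp: is_functor_def)

lemma farr_arr [simp]:
  assumes "w \<in> Arr N"
  shows "farr S w \<in> Arr M" "Dom M (farr S w) = fobj S (Dom N w)" "Cod M (farr S w) = fobj S (Cod N w)"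
proof -
  have "farr S w \<in> hom M (fobj S (Dom N w)) (fobj S (Cod N w))"
    using S_functor assms homI[OF assms refl refl] unfolding is_functor_def by (meson N.dom_cod_in)
  from homD[OF this] show "farr S w \<in> Arr M" "Dom M (farr S w) = fobj S (Dom N w)"
    "Cod M (farr S w) = fobj S (Cod N w)" by auto
qed

lemma farr_ide [simp]: "n \<in> Obj N \<Longrightarrow> farr S (ide N n) = ide M (fobj S n)"
  using S_functor by (auto simp: is_functor_def)

lemma farr_cmp [simp]:
  assumes "w \<in> Arr N" "v \<in> Arr N" "Cod N w = Dom N v"
  shows "farr S (v \<cdot>\<^bsub>N\<^esub> w) = farr S v \<cdot>\<^bsub>M\<^esub> farr S w"
proof -
  have "w \<in> hom N (Dom N w) (Cod N w)" "v \<in> hom N (Cod N w) (Cod N v)"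
    using assms by (auto intro: homI)
  then show ?thesis
    using S_functor assms unfolding is_functor_def by (meson N.dom_cod_in)
qed

lemma mf_unit_arr [simp]:
  "is_iso M (mf_unit S)" "mf_unit S \<in> Arr M" "Dom M (mf_unit S) = unit M" "Cod M (mf_unit S) = fobj S (unit N)"
  using iso_homD[OF S_unit_iso] by auto

lemma mf_ten_arr [simp]:
  assumes "n \<in> Obj N" "m \<in> Obj N"
  shows "is_iso M (mf_ten S n m)" "mf_ten S n m \<in> Arr M"
    "Dom M (mf_ten S n m) = fobj S n \<otimes>\<^bsub>M\<^esub> fobj S m" "Cod M (mf_ten S n m) = fobj S (n \<otimes>\<^bsub>N\<^esub> m)"
  using iso_homD[OF S_ten_iso[OF assms]] by auto

text \<open>Contravariance of Phi in \<open>M\<close> puts the inverse of \<open>mf_ten\<close> into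
  the composition constraint; this and the next three lemmas are the laws of \<open>S\<close> in the
  form needed there.\<close>

lemma mf_ten_inv_natural:
  assumes "w \<in> Arr N" "v \<in> Arr N"
  shows "arr_inv M (mf_ten S (Cod N w) (Cod N v)) \<cdot>\<^bsub>M\<^esub> farr S (w \<odot>\<^bsub>N\<^esub> v)
    = (farr S w \<odot>\<^bsub>M\<^esub> farr S v) \<cdot>\<^bsub>M\<^esub> arr_inv M (mf_ten S (Dom N w) (Dom N v))"
proof (rule M.iso_cancel_left)
  let ?k = "mf_ten S (Cod N w) (Cod N v)" and ?h = "mf_ten S (Dom N w) (Dom N v)"
  have "?k \<cdot>\<^bsub>M\<^esub> (farr S w \<odot>\<^bsub>M\<^esub> farr S v) = farr S (w \<odot>\<^bsub>N\<^esub> v) \<cdot>\<^bsub>M\<^esub> ?h"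
    using assms by (intro S_ten_nat) (auto intro: homI)
  then have "(?k \<cdot>\<^bsub>M\<^esub> (farr S w \<odot>\<^bsub>M\<^esub> farr S v)) \<cdot>\<^bsub>M\<^esub> arr_inv M ?h = (farr S (w \<odot>\<^bsub>N\<^esub> v) \<cdot>\<^bsub>M\<^esub> ?h) \<cdot>\<^bsub>M\<^esub> arr_inv M ?h"
    by simp
  then show "?k \<cdot>\<^bsub>M\<^esub> (arr_inv M ?k \<cdot>\<^bsub>M\<^esub> farr S (w \<odot>\<^bsub>N\<^esub> v))
    = ?k \<cdot>\<^bsub>M\<^esub> ((farr S w \<odot>\<^bsub>M\<^esub> farr S v) \<cdot>\<^bsub>M\<^esub> arr_inv M ?h)"
    using assms by (simp add: M.cmp_cmp)
qed (use assms in simp_all)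

lemma mf_ten_inv_assoc:
  assumes [simp]: "n \<in> Obj N" "m \<in> Obj N" "k \<in> Obj N"
  shows "(ide M (fobj S n) \<odot>\<^bsub>M\<^esub> arr_inv M (mf_ten S m k)) \<cdot>\<^bsub>M\<^esub>
      (arr_inv M (mf_ten S n (m \<otimes>\<^bsub>N\<^esub> k)) \<cdot>\<^bsub>M\<^esub> farr S (assoc N n m k))
    = assoc M (fobj S n) (fobj S m) (fobj S k) \<cdot>\<^bsub>M\<^esub>
      ((arr_inv M (mf_ten S n m) \<odot>\<^bsub>M\<^esub> ide M (fobj S k)) \<cdot>\<^bsub>M\<^esub> arr_inv M (mf_ten S (n \<otimes>\<^bsub>N\<^esub> m) k))"
    (is "?L = ?R")
proof (rule M.iso_cancel_right)
  \<comment> \<open>On the source of \<open>?h\<close> all inverses cancel, and both sides become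
    the associator of \<open>M\<close>.\<close>
  let ?h = "mf_ten S (n \<otimes>\<^bsub>N\<^esub> m) k \<cdot>\<^bsub>M\<^esub> (mf_ten S n m \<odot>\<^bsub>M\<^esub> ide M (fobj S k))"
  let ?i = "(ide M (fobj S n) \<odot>\<^bsub>M\<^esub> arr_inv M (mf_ten S m k)) \<cdot>\<^bsub>M\<^esub> arr_inv M (mf_ten S n (m \<otimes>\<^bsub>N\<^esub> k))"
  have "?L \<cdot>\<^bsub>M\<^esub> ?h = ?i \<cdot>\<^bsub>M\<^esub> (farr S (assoc N n m k) \<cdot>\<^bsub>M\<^esub> mf_ten S (n \<otimes>\<^bsub>N\<^esub> m) k
            \<cdot>\<^bsub>M\<^esub> (mf_ten S n m \<odot>\<^bsub>M\<^esub> ide M (fobj S k)))"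
    by (simp add: M.cmp_cmp)
  also have "\<dots> = assoc M (fobj S n) (fobj S m) (fobj S k)"
    by (subst S_assoc) (simp_all add: M.cmp_cmp M.interchange_cmp)
  also have "\<dots> = ?R \<cdot>\<^bsub>M\<^esub> ?h"
    by (simp add: M.cmp_cmp M.interchange M.interchange_cmp)
  finally show "?L \<cdot>\<^bsub>M\<^esub> ?h = ?R \<cdot>\<^bsub>M\<^esub> ?h" .
qed simp_all

lemma mf_ten_inv_lunit:
  assumes [simp]: "n \<in> Obj N"
  shows "lunit M (fobj S n) \<cdot>\<^bsub>M\<^esub> ((arr_inv M (mf_unit S) \<odot>\<^bsub>M\<^esub> ide M (fobj S n)) \<cdot>\<^bsub>M\<^esub> arr_inv M (mf_ten S (unit N) n))
    = farr S (lunit N n)"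
  by (subst S_lunit[symmetric]) (simp_all add: M.cmp_cmp M.interchange_cmp)

lemma mf_ten_inv_runit:
  assumes [simp]: "n \<in> Obj N"
  shows "runit M (fobj S n) \<cdot>\<^bsub>M\<^esub> ((ide M (fobj S n) \<odot>\<^bsub>M\<^esub> arr_inv M (mf_unit S)) \<cdot>\<^bsub>M\<^esub> arr_inv M (mf_ten S n (unit N)))
    = farr S (runit N n)"
  by (subst S_runit[symmetric]) (simp_all add: M.cmp_cmp M.interchange_cmp)

end

section \<open>The lax double functor of a metamodel and a strong monoidal functor\<close>

locale metamodel_pullback = metamodel M C P + S: strong_monoidal_functor N M S
  for M :: "('mo, 'ma, 'z) moncat_scheme" and C :: "('co, 'ca) cat"
    and P :: "('mo, 'ma, 'co, 'ca, 'x) metamodel_data"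
    and N :: "('n, 'w, 'y) moncat_scheme" and S :: "('n, 'w, 'mo, 'ma) monftor"
begin

abbreviation F :: "('n, 'w, 'co, 'ca, 'x) lax_data" where "F \<equiv> Phi_lax M C P S"

text \<open>The composition constraint on a representative of a coend class. By
  \<open>lf_apply_eq\<close> the naturality, associativity and unit laws can be checked without
  mentioning coends.\<close>

definition app :: "'n \<Rightarrow> 'n \<Rightarrow> 'co \<Rightarrow> 'co \<Rightarrow> 'co \<Rightarrow> 'x \<Rightarrow> 'x \<Rightarrow> 'x" where
  "app n m A B D y x = PhiA P (arr_inv M (mf_ten S n m)) (ide C A) (ide C D)
     (mm_mult P (fobj S m) (fobj S n) A B D y x)"

lemma lf_simps [simp]:
  "lf_cat F = C" "on_obj (lf_hor F n) (A, B) = PhiO P (fobj S n) A B"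
  "on_arr (lf_hor F n) (a, b) = PhiA P (ide M (fobj S n)) a b"
  "lf_sq F w A B = PhiA P (farr S w) (ide C A) (ide C B)"
  by (simp_all add: Phi_lax_def)

lemma lf_unit_eq:
  assumes "f \<in> hom C A B"
  shows "lf_unit F A B f = PhiA P (arr_inv M (mf_unit S)) (ide C A) f (mm_unit P A)"
  using homD[OF assms] by (auto simp: Phi_lax_def mm_phi_def PhiA_PhiA)

lemma hor_is_prof: "n \<in> Obj N \<Longrightarrow> is_prof C C (lf_hor F n)"
  by (rule is_profI[OF C.category_axioms]) (auto simp: hom_def PhiA_PhiA)

text \<open>Compatibility with the generating relation of the coend is precisely extranaturality of
  \<open>mm_mult\<close> in the middle object.\<close>

lemma mm_mult_coend_step:
  assumes "n \<in> Obj N" "m \<in> Obj N" "A \<in> Obj C" "D \<in> Obj C"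
    and "(q, r) \<in> coend_step C C C (lf_hor F n) (lf_hor F m) A D"
  shows "(\<lambda>(B, y, x). mm_mult P (fobj S m) (fobj S n) A B D y x) q
    = (\<lambda>(B, y, x). mm_mult P (fobj S m) (fobj S n) A B D y x) r"
  using assms by (auto simp: coend_step_def hom_def mm_mult_extranatural)

lemma mm_mult_coend_class:
  assumes "n \<in> Obj N" "m \<in> Obj N" "A \<in> Obj C" "D \<in> Obj C"
  shows "(\<lambda>(B, y, x). mm_mult P (fobj S m) (fobj S n) A B D y x) `
      coend_class C C C (lf_hor F n) (lf_hor F m) A D p
    = {(\<lambda>(B, y, x). mm_mult P (fobj S m) (fobj S n) A B D y x) p}"
  by (rule coend_class_image) (rule mm_mult_coend_step[OF assms])

lemma lf_comp_class:
  assumes "n \<in> Obj N" "m \<in> Obj N" "A \<in> Obj C" "D \<in> Obj C"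
  shows "lf_comp F n m A D (coend_class C C C (lf_hor F n) (lf_hor F m) A D (B, y, x)) = app n m A B D y x"
proof -
  have "lf_comp F n m A D c = PhiA P (arr_inv M (mf_ten S n m)) (ide C A) (ide C D)
         (the_elem ((\<lambda>(B, y, x). mm_mult P (fobj S m) (fobj S n) A B D y x) ` c))" for c
    by (simp add: Phi_lax_def)
  then show ?thesis by (simp only: mm_mult_coend_class[OF assms]) (simp add: app_def)
qed

lemma lf_apply_eq:
  assumes "n \<in> Obj N" "m \<in> Obj N" "A \<in> Obj C" "B \<in> Obj C" "D \<in> Obj C"
  shows "lf_apply F n m A B D y x = app n m A B D y x"
  using assms by (simp add: lf_apply_def lf_comp_class)

lemma app_in [simp]:
  assumes "n \<in> Obj N" "m \<in> Obj N" "A \<in> Obj C" "B \<in> Obj C" "D \<in> Obj C"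
    "y \<in> PhiO P (fobj S n) B D" "x \<in> PhiO P (fobj S m) A B" "Z = fobj S (n \<otimes>\<^bsub>N\<^esub> m)"
  shows "app n m A B D y x \<in> PhiO P Z A D"
  using assms by (simp add: app_def)

lemma app_PhiA:
  assumes "w \<in> Arr N" "v \<in> Arr N" "a \<in> Arr C" "d \<in> Arr C" "B \<in> Obj C"
    "y \<in> PhiO P (fobj S (Cod N w)) B (Dom C d)" "x \<in> PhiO P (fobj S (Cod N v)) (Cod C a) B"
    "Dom N w = n" "Dom N v = m" "Dom C a = A" "Cod C d = D"
  shows "app n m A B D (PhiA P (farr S w) (ide C B) d y) (PhiA P (farr S v) a (ide C B) x)
    = PhiA P (farr S (w \<odot>\<^bsub>N\<^esub> v)) a d (app (Cod N w) (Cod N v) (Cod C a) B (Dom C d) y x)"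
  using assms by (auto simp: app_def mm_mult_PhiA PhiA_PhiA S.mf_ten_inv_natural)

lemma app_natural:
  assumes "n \<in> Obj N" "m \<in> Obj N" "a \<in> Arr C" "d \<in> Arr C" "B \<in> Obj C"
    "y \<in> PhiO P (fobj S n) B (Dom C d)" "x \<in> PhiO P (fobj S m) (Cod C a) B"
  shows "app n m (Dom C a) B (Cod C d) (PhiA P (ide M (fobj S n)) (ide C B) d y)
      (PhiA P (ide M (fobj S m)) a (ide C B) x)
    = PhiA P (ide M (fobj S (n \<otimes>\<^bsub>N\<^esub> m))) a d (app n m (Cod C a) B (Dom C d) y x)"
  using app_PhiA[of "ide N n" "ide N m" a d B y x n m] assms by simp

lemma app_extranatural:
  assumes "n \<in> Obj N" "m \<in> Obj N" "A \<in> Obj C" "b \<in> Arr C" "D \<in> Obj C"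
    "y \<in> PhiO P (fobj S n) (Cod C b) D" "x \<in> PhiO P (fobj S m) A (Dom C b)"
  shows "app n m A (Cod C b) D y (PhiA P (ide M (fobj S m)) (ide C A) b x)
    = app n m A (Dom C b) D (PhiA P (ide M (fobj S n)) b (ide C D) y) x"
  using assms by (simp add: app_def mm_mult_extranatural)

lemma app_assoc:
  assumes [simp]: "n \<in> Obj N" "m \<in> Obj N" "k \<in> Obj N" "A \<in> Obj C" "B \<in> Obj C" "D \<in> Obj C" "E \<in> Obj C"
    and z: "z \<in> PhiO P (fobj S n) D E" and y: "y \<in> PhiO P (fobj S m) B D" and x: "x \<in> PhiO P (fobj S k) A B"
  shows "PhiA P (farr S (assoc N n m k)) (ide C A) (ide C E)
      (app n (m \<otimes>\<^bsub>N\<^esub> k) A D E z (app m k A B D y x))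
    = app (n \<otimes>\<^bsub>N\<^esub> m) k A B E (app n m B D E z y) x"
  using assms(8-10)
  by (simp add: app_def mm_mult_PhiA_left mm_mult_PhiA_right PhiA_PhiA S.mf_ten_inv_assoc
      M.cmp_cmp flip: mult_assoc)

lemma app_unit_left:
  assumes [simp]: "n \<in> Obj N" and f: "f \<in> hom C B D" and x: "x \<in> PhiO P (fobj S n) A B" and A: "A \<in> Obj C"
  shows "app (unit N) n A B D (lf_unit F B D f) x = PhiA P (farr S (lunit N n)) (ide C A) f x"
  using homD[OF f] x A
  by (auto simp: lf_unit_eq[OF f] app_def mm_mult_PhiA_left mult_unit_left PhiA_PhiA S.mf_ten_inv_lunit M.cmp_cmp)

lemma app_unit_right:
  assumes [simp]: "n \<in> Obj N" and f: "f \<in> hom C A B" and x: "x \<in> PhiO P (fobj S n) B D" and D: "D \<in> Obj C"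
  shows "app n (unit N) A B D x (lf_unit F A B f) = PhiA P (farr S (runit N n)) f (ide C D) x"
proof -
  note [simp] = homD[OF f]
  have [simp]: "A \<in> Obj C" "B \<in> Obj C" using C.dom_cod_in[of f] by simp_all
  \<comment> \<open>\<open>lf_unit\<close> lets \<open>f\<close> act covariantly on the unit at
    \<open>A\<close>. Extranaturality makes it act contravariantly on the unit at \<open>B\<close>,
    from where naturality of the multiplication carries it outside.\<close>
  have "lf_unit F A B f = PhiA P (arr_inv M (mf_unit S)) (ide C A) (ide C B)
      (PhiA P (ide M (unit M)) (ide C A) f (mm_unit P A))"
    by (simp add: lf_unit_eq[OF f] PhiA_PhiA)
  also have "PhiA P (ide M (unit M)) (ide C A) f (mm_unit P A) = PhiA P (ide M (unit M)) f (ide C B) (mm_unit P B)"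
    using mm_unit_extranatural[of f] by simp
  finally have "lf_unit F A B f = PhiA P (arr_inv M (mf_unit S)) f (ide C B) (mm_unit P B)"
    by (simp add: PhiA_PhiA)
  then show ?thesis
    using x D
    by (simp add: app_def mm_mult_PhiA_right mult_unit_right PhiA_PhiA S.mf_ten_inv_runit M.cmp_cmp)
qed

lemma lf_unit_in [simp]:
  "f \<in> hom C A B \<Longrightarrow> lf_unit F A B f \<in> PhiO P (fobj S (unit N)) A B"
  using C.dom_cod_in[of f] by (auto simp: lf_unit_eq hom_def)

lemma lf_unit_natural:
  assumes f: "f \<in> hom C A B" and a: "a \<in> hom C A' A" and b: "b \<in> hom C B B'"
  shows "lf_unit F A' B' (b \<cdot>\<^bsub>C\<^esub> f \<cdot>\<^bsub>C\<^esub> a) = PhiA P (ide M (fobj S (unit N))) a b (lf_unit F A B f)"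
proof -
  note [simp] = homD[OF f] homD[OF a] homD[OF b]
  have [simp]: "A \<in> Obj C" "A' \<in> Obj C" using C.dom_cod_in[of a] by simp_all
  have "lf_unit F A' B' (b \<cdot>\<^bsub>C\<^esub> f \<cdot>\<^bsub>C\<^esub> a) = PhiA P (arr_inv M (mf_unit S)) (ide C A') (b \<cdot>\<^bsub>C\<^esub> f)
      (PhiA P (ide M (unit M)) (ide C A') a (mm_unit P A'))"
    by (subst lf_unit_eq) (auto simp: PhiA_PhiA intro: homI)
  also have "PhiA P (ide M (unit M)) (ide C A') a (mm_unit P A') = PhiA P (ide M (unit M)) a (ide C A) (mm_unit P A)"
    using mm_unit_extranatural[of a] by simp
  finally show ?thesis by (simp add: PhiA_PhiA lf_unit_eq[OF f])
qed

lemma comp_is_square: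
  assumes n [simp]: "n \<in> Obj N" and m [simp]: "m \<in> Obj N"
  shows "square C C C C id_ftor id_ftor (prof_comp C C C (lf_hor F n) (lf_hor F m))
      (lf_hor F (n \<otimes>\<^bsub>N\<^esub> m)) (lf_comp F n m)"
proof -
  let ?K = "lf_hor F n" and ?H = "lf_hor F m"
  let ?cl = "coend_class C C C ?K ?H"
  \<comment> \<open>\<open>prof_comp\<close> sends a class to the union of the classes of all its
    translated members. Each of these classes has the same one-element image under
    \<open>?g A' D'\<close>, so \<open>the_elem\<close> is applied to a singleton.\<close>
  have nat: "lf_comp F n m A' D' (on_arr (prof_comp C C C ?K ?H) (a, d) (?cl A D (B, y, x)))
      = PhiA P (ide M (fobj S (n \<otimes>\<^bsub>N\<^esub> m))) a d (app n m A B D y x)"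
    if a: "a \<in> hom C A' A" and d: "d \<in> hom C D D'" and B: "B \<in> Obj C"
      and y: "y \<in> PhiO P (fobj S n) B D" and x: "x \<in> PhiO P (fobj S m) A B" for A A' B D D' a d y x
  proof -
    note [simp] = homD[OF a] homD[OF d]
    have [simp]: "A \<in> Obj C" "A' \<in> Obj C" "D \<in> Obj C" "D' \<in> Obj C"
      using C.dom_cod_in[of a] C.dom_cod_in[of d] by simp_all
    let ?g = "\<lambda>A D (B, y, x). mm_mult P (fobj S m) (fobj S n) A B D y x"
    have "(B, y, x) \<in> coend_elems C ?K ?H A D" using B x y by (simp add: coend_elems_def)
    then have sub: "?cl A D (B, y, x) \<subseteq> coend_elems C ?K ?H A D"
      by (intro coend_class_elems hor_is_prof C.category_axioms) simp_all
    have img: "?g A D ` ?cl A D (B, y, x) = {?g A D (B, y, x)}"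
      by (rule mm_mult_coend_class) simp_all
    let ?tr = "\<lambda>(B, y, x). (B, PhiA P (ide M (fobj S n)) (ide C B) d y, PhiA P (ide M (fobj S m)) a (ide C B) x)"
    have each: "?g A' D' ` ?cl A' D' (?tr q) = {PhiA P (ide M (fobj S n \<otimes>\<^bsub>M\<^esub> fobj S m)) a d (?g A D (B, y, x))}"
      if q: "q \<in> ?cl A D (B, y, x)" for q
    proof -
      obtain B' y' x' where q': "q = (B', y', x')" by (cases q)
      then have e: "B' \<in> Obj C" "y' \<in> PhiO P (fobj S n) B' D" "x' \<in> PhiO P (fobj S m) A B'"
        using sub q by (auto simp: coend_elems_def)
      have "?g A D q = ?g A D (B, y, x)" using img q by blast
      moreover have "?g A' D' (?tr q) = PhiA P (ide M (fobj S n \<otimes>\<^bsub>M\<^esub> fobj S m)) a d (?g A D q)"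
        using e mm_mult_PhiA[of "ide M (fobj S m)" "ide M (fobj S n)" a d B' y' x'] unfolding q' by simp
      moreover have "?g A' D' ` ?cl A' D' (?tr q) = {?g A' D' (?tr q)}"
        by (rule mm_mult_coend_class) simp_all
      ultimately show ?thesis by simp
    qed
    have "on_arr (prof_comp C C C ?K ?H) (a, d) (?cl A D (B, y, x)) = (\<Union>q\<in>?cl A D (B, y, x). ?cl A' D' (?tr q))"
      by (auto simp: prof_comp_def case_prod_beta)
    moreover have "?g A' D' ` (\<Union>q\<in>?cl A D (B, y, x). ?cl A' D' (?tr q))
        = {PhiA P (ide M (fobj S n \<otimes>\<^bsub>M\<^esub> fobj S m)) a d (?g A D (B, y, x))}"
    proof -
      \<comment> \<open>A union of equal singletons is a singleton only over a nonempty index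
        set.\<close>
      have "?cl A D (B, y, x) \<noteq> {}" using img by auto
      then show ?thesis unfolding image_UN by (simp only: SUP_cong[OF refl each]) simp
    qed
    ultimately have "lf_comp F n m A' D' (on_arr (prof_comp C C C ?K ?H) (a, d) (?cl A D (B, y, x)))
      = PhiA P (arr_inv M (mf_ten S n m)) (ide C A') (ide C D')
          (PhiA P (ide M (fobj S n \<otimes>\<^bsub>M\<^esub> fobj S m)) a d (?g A D (B, y, x)))"
      by (simp add: Phi_lax_def)
    also have "\<dots> = PhiA P (ide M (fobj S (n \<otimes>\<^bsub>N\<^esub> m))) a d (app n m A B D y x)"
      using B x y by (simp add: app_def PhiA_PhiA)
    finally show ?thesis .
  qed
  show ?thesis
    unfolding square_def
    by (auto simp: prof_comp_def coend_elems_def id_ftor_def lf_comp_class nat[unfolded prof_comp_def, simplified])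
qed

theorem lax_double_functor_Phi_lax: "lax_double_functor N F"
proof (intro lax_double_functor.intro lax_double_functor_axioms.intro)
  show "monoidal_category N" by (rule S.N.monoidal_category_axioms)
  show "category (lf_cat F)" using C.category_axioms by simp
  fix n assume "n \<in> Obj N"
  then show "is_prof (lf_cat F) (lf_cat F) (lf_hor F n)" by (simp add: hor_is_prof)
next
  fix w n n' assume "w \<in> hom N n n'"
  then show "square (lf_cat F) (lf_cat F) (lf_cat F) (lf_cat F) id_ftor id_ftor (lf_hor F n') (lf_hor F n) (lf_sq F w)"
    using S.N.dom_cod_in[of w] unfolding square_def by (auto simp: id_ftor_def hom_def PhiA_PhiA)
next
  show "square (lf_cat F) (lf_cat F) (lf_cat F) (lf_cat F) id_ftor id_ftor
          (hom_prof (lf_cat F)) (lf_hor F (unit N)) (lf_unit F)"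
    unfolding square_def by (auto simp: id_ftor_def hom_prof_def lf_unit_natural)
next
  fix n m assume "n \<in> Obj N" "m \<in> Obj N"
  then show "square (lf_cat F) (lf_cat F) (lf_cat F) (lf_cat F) id_ftor id_ftor
          (prof_comp (lf_cat F) (lf_cat F) (lf_cat F) (lf_hor F n) (lf_hor F m))
          (lf_hor F (n \<otimes>\<^bsub>N\<^esub> m)) (lf_comp F n m)"
    using comp_is_square by simp
next
  fix w n n' v m m' A B D y x
  assume w: "w \<in> hom N n n'" and v: "v \<in> hom N m m'"
    and "A \<in> Obj (lf_cat F)" "B \<in> Obj (lf_cat F)" "D \<in> Obj (lf_cat F)"
    and "y \<in> on_obj (lf_hor F n') (B, D)" "x \<in> on_obj (lf_hor F m') (A, B)"
  then show "lf_sq F (w \<odot>\<^bsub>N\<^esub> v) A D (lf_apply F n' m' A B D y x)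
          = lf_apply F n m A B D (lf_sq F w B D y) (lf_sq F v A B x)"
    using S.N.dom_cod_in[of w] S.N.dom_cod_in[of v] homD[OF w] homD[OF v]
      app_PhiA[of w v "ide C A" "ide C D" B y x n m A D]
    by (simp add: lf_apply_eq)
next
  fix n m k A B D E z y x
  assume "n \<in> Obj N" "m \<in> Obj N" "k \<in> Obj N"
        "A \<in> Obj (lf_cat F)" "B \<in> Obj (lf_cat F)" "D \<in> Obj (lf_cat F)" "E \<in> Obj (lf_cat F)"
        "z \<in> on_obj (lf_hor F n) (D, E)" "y \<in> on_obj (lf_hor F m) (B, D)"
        "x \<in> on_obj (lf_hor F k) (A, B)"
  then show "lf_sq F (assoc N n m k) A E
              (lf_apply F n (m \<otimes>\<^bsub>N\<^esub> k) A D E z (lf_apply F m k A B D y x))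
          = lf_apply F (n \<otimes>\<^bsub>N\<^esub> m) k A B E (lf_apply F n m B D E z y) x"
    using app_assoc by (simp add: lf_apply_eq)
next
  fix n A B D f x
  assume "n \<in> Obj N" "A \<in> Obj (lf_cat F)" "B \<in> Obj (lf_cat F)" "D \<in> Obj (lf_cat F)"
    and f: "f \<in> hom (lf_cat F) B D" and "x \<in> on_obj (lf_hor F n) (A, B)"
  then show "lf_apply F (unit N) n A B D (lf_unit F B D f) x
          = lf_sq F (lunit N n) A D (on_arr (lf_hor F n) (ide (lf_cat F) A, f) x)"
    using homD[of f C B D] by (simp add: lf_apply_eq app_unit_left PhiA_PhiA)
next
  fix n A B D f x
  assume "n \<in> Obj N" "A \<in> Obj (lf_cat F)" "B \<in> Obj (lf_cat F)" "D \<in> Obj (lf_cat F)"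
    and f: "f \<in> hom (lf_cat F) A B" and "x \<in> on_obj (lf_hor F n) (B, D)"
  then show "lf_apply F n (unit N) A B D x (lf_unit F A B f)
          = lf_sq F (runit N n) A D (on_arr (lf_hor F n) (f, ide (lf_cat F) D) x)"
    using homD[of f C A B] by (simp add: lf_apply_eq app_unit_right PhiA_PhiA)
qed (auto simp: hom_def PhiA_PhiA)

end

section \<open>Models and the double limit\<close>

lemma mod_simps [simp]:
  "Obj (Mod M T C P) = models M T C P" "Dom (Mod M T C P) (s, f, t) = s" "Cod (Mod M T C P) (s, f, t) = t"
  "ide (Mod M T C P) s = (s, ide C (fst s), s)" "(t, g, r) \<cdot>\<^bsub>(Mod M T C P)\<^esub> (s, f, t') = (s, g \<cdot>\<^bsub>C\<^esub> f, r)"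
  "fobj Mod_forget s = fst s" "farr Mod_forget (s, f, t) = f"
  by (simp_all add: Mod_def Mod_forget_def)

lemma mod_hom:
  "x \<in> hom (Mod M T C P) s t \<longleftrightarrow>
     s \<in> models M T C P \<and> t \<in> models M T C P \<and> (\<exists>f \<in> model_hom M T C P s t. x = (s, f, t))"
  by (cases x) (auto simp: hom_def Mod_def)

definition factor_obj :: "('p, 'q) cat \<Rightarrow> ('p, 'q, 'co, 'ca) ftor \<Rightarrow> (nat \<Rightarrow> 'p \<Rightarrow> 'p \<Rightarrow> 'q \<Rightarrow> 'x) \<Rightarrow> 'p \<Rightarrow> 'co \<times> 'x" where
  "factor_obj A V v X = (fobj V X, v (Suc 0) X X (ide A X))"

definition factor :: "('p, 'q) cat \<Rightarrow> ('p, 'q, 'co, 'ca) ftor \<Rightarrow> (nat \<Rightarrow> 'p \<Rightarrow> 'p \<Rightarrow> 'q \<Rightarrow> 'x)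
    \<Rightarrow> ('p, 'q, 'co \<times> 'x, ('co \<times> 'x) \<times> 'ca \<times> ('co \<times> 'x)) ftor" where
  "factor A V v = \<lparr>fobj = factor_obj A V v,
     farr = (\<lambda>f. (factor_obj A V v (Dom A f), farr V f, factor_obj A V v (Cod A f)))\<rparr>"

locale monoid_metamodel = metamodel M C P + monoid_in_monoidal_category M T
  for M :: "('mo, 'ma, 'z) moncat_scheme" and C :: "('co, 'ca) cat"
    and P :: "('mo, 'ma, 'co, 'ca, 'x) metamodel_data" and T :: "('mo, 'ma) monoid_data" +
  fixes S :: "(nat, nat \<times> nat \<times> (nat \<Rightarrow> nat), 'mo, 'ma) monftor"
  assumes corresponds: "corresponds_to_monoid M T S"
begin

sublocale metamodel_pullback M C P Delta_a S
  using corresponds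
  by (intro metamodel_pullback.intro metamodel_axioms) (simp add: corresponds_to_monoid_def)

lemma S_one: "fobj S (Suc 0) = mon_obj T"
  using corresponds by (simp add: corresponds_to_monoid_def tensor_power.simps)

lemma S_to_one_0: "farr S (to_one 0) = mon_unit T \<cdot>\<^bsub>M\<^esub> arr_inv M (mf_unit S)"
proof -
  have "mon_unit T = farr S (to_one 0) \<cdot>\<^bsub>M\<^esub> mf_unit S"
    using corresponds by (simp add: corresponds_to_monoid_def)
  then show ?thesis using homD[OF to_one_hom] by (simp add: M.cmp_cmp)
qed

lemma S_to_one_2: "farr S (to_one 2) = mon_mult T \<cdot>\<^bsub>M\<^esub> arr_inv M (mf_ten S (Suc 0) (Suc 0))"
proof -
  have "mon_mult T = farr S (to_one 2) \<cdot>\<^bsub>M\<^esub> mf_ten S (Suc 0) (Suc 0)"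
    using corresponds by (simp add: corresponds_to_monoid_def)
  then show ?thesis using homD[OF to_one_hom] by (simp add: M.cmp_cmp numeral_2_eq_2)
qed

text \<open>The model axioms live over \<open>unit M\<close> and \<open>\<X> \<otimes> \<X>\<close>,
  the cone conditions over \<open>S\<close> of \<open>0\<close> and \<open>2\<close>. Phi of an
  inverse structure isomorphism is injective, so the two forms are equivalent.\<close>

lemma models_iff:
  "(A, \<xi>) \<in> models M T C P \<longleftrightarrow> A \<in> Obj C \<and> \<xi> \<in> PhiO P (fobj S (Suc 0)) A A \<and>
     PhiA P (farr S (to_one 0)) (ide C A) (ide C A) \<xi> = lf_unit F A A (ide C A) \<and>
     PhiA P (farr S (to_one 2)) (ide C A) (ide C A) \<xi> = app (Suc 0) (Suc 0) A A A \<xi> \<xi>"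
proof (cases "A \<in> Obj C \<and> \<xi> \<in> PhiO P (fobj S (Suc 0)) A A")
  case True
  then have A [simp]: "A \<in> Obj C" and \<xi>: "\<xi> \<in> PhiO P \<X> A A" by (simp_all add: S_one)
  let ?u = "mf_unit S" and ?t = "mf_ten S (Suc 0) (Suc 0)" and ?i = "ide C A"
  have cancel: "PhiA P (arr_inv M h) ?i ?i y = PhiA P (arr_inv M h) ?i ?i z \<longleftrightarrow> y = z"
    if [simp]: "is_iso M h" and y: "y \<in> PhiO P (Dom M h) A A" and z: "z \<in> PhiO P (Dom M h) A A" for h y z
  proof
    assume "PhiA P (arr_inv M h) ?i ?i y = PhiA P (arr_inv M h) ?i ?i z"
    then have "PhiA P h ?i ?i (PhiA P (arr_inv M h) ?i ?i y) = PhiA P h ?i ?i (PhiA P (arr_inv M h) ?i ?i z)"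
      by simp
    then show "y = z" using y z M.is_iso_arr[of h] by (simp add: PhiA_PhiA)
  qed simp
  have "PhiA P (farr S (to_one 0)) ?i ?i \<xi> = PhiA P (arr_inv M ?u) ?i ?i (PhiA P (mon_unit T) ?i ?i \<xi>)"
    using \<xi> by (simp add: S_to_one_0 PhiA_PhiA)
  moreover have "lf_unit F A A ?i = PhiA P (arr_inv M ?u) ?i ?i (mm_unit P A)"
    by (simp add: lf_unit_eq C.ide_in)
  moreover have "PhiA P (farr S (to_one 2)) ?i ?i \<xi> = PhiA P (arr_inv M ?t) ?i ?i (PhiA P (mon_mult T) ?i ?i \<xi>)"
    using \<xi> by (simp add: S_to_one_2 PhiA_PhiA S_one)
  ultimately show ?thesis
    using \<xi> by (simp add: models_def app_def cancel S_one)
qed (auto simp: models_def S_one)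

lemma model_hom_iff:
  "f \<in> model_hom M T C P s t \<longleftrightarrow> f \<in> hom C (fst s) (fst t) \<and>
     PhiA P (ide M (fobj S (Suc 0))) (ide C (fst s)) f (snd s)
     = PhiA P (ide M (fobj S (Suc 0))) f (ide C (fst t)) (snd t)"
  by (simp add: model_hom_def S_one case_prod_beta)

section \<open>Powers of a model structure\<close>

primrec iter :: "nat \<Rightarrow> 'co \<Rightarrow> 'x \<Rightarrow> 'x" where
  "iter 0 A \<xi> = lf_unit F A A (ide C A)"
| "iter (Suc n) A \<xi> = app n (Suc 0) A A A (iter n A \<xi>) \<xi>"

context
  fixes A \<xi>
  assumes A [simp]: "A \<in> Obj C" and \<xi> [simp]: "\<xi> \<in> PhiO P (fobj S (Suc 0)) A A"
begin

lemma iter_in [simp]: "iter n A \<xi> \<in> PhiO P (fobj S n) A A"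
proof (induction n)
  case 0
  show ?case using lf_unit_in[OF C.ide_in[OF A]] by simp
qed simp

text \<open>The recursion starts at the unit constraint, so this is the left unit law of
  \<open>app\<close>.\<close>

lemma iter_1 [simp]: "iter (Suc 0) A \<xi> = \<xi>"
  using app_unit_left[of "Suc 0" "ide C A" A A \<xi> A] by (simp add: C.ide_in S.farr_ide[simplified])

text \<open>Since \<open>Delta_a\<close> is strict, the coherence maps in
  \<open>app_unit_right\<close> and \<open>app_assoc\<close> act as identities, and these laws give
  the base case and the step of an induction on \<open>k\<close>.\<close>

lemma app_iter: "app n k A A A (iter n A \<xi>) (iter k A \<xi>) = iter (n + k) A \<xi>"
proof (induction k)
  case 0
  show ?case
    using app_unit_right[of n "ide C A" A A "iter n A \<xi>" A] by (simp add: C.ide_in S.farr_ide[simplified])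
next
  case (Suc k)
  then show ?case
    using app_assoc[of n k "Suc 0" A A A A "iter n A \<xi>" "iter k A \<xi>" \<xi>] by (simp add: S.farr_ide[simplified])
qed

text \<open>The map from \<open>k + 1\<close> to \<open>1\<close> factors through
  \<open>1 + 1 = 2\<close> by collapsing the first \<open>k\<close> elements. The multiplication
  axiom handles \<open>to_one 2\<close>, and the induction hypothesis the collapsed summand.\<close>

lemma iter_to_one:
  assumes "(A, \<xi>) \<in> models M T C P"
  shows "PhiA P (farr S (to_one k)) (ide C A) (ide C A) \<xi> = iter k A \<xi>"
proof (induction k)
  case 0
  show ?case using assms by (simp add: models_iff)
next
  case (Suc k)
  let ?s = "ord_sum (to_one k) (ord_id (Suc 0))"
  have s: "?s \<in> hom Delta_a (Suc k) 2" and two: "to_one 2 \<in> hom Delta_a 2 1"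
    using ord_sum_hom[OF to_one_hom[of k] ord_id_hom[of "Suc 0"]] to_one_hom[of 2] by (simp_all add: numeral_2_eq_2)
  have "to_one 2 \<cdot>\<^bsub>Delta_a\<^esub> ?s = to_one (Suc k)"
    using cmp_hom_Delta_a[OF s two] by (simp only: hom_Delta_a_1)
  then have "farr S (to_one (Suc k)) = farr S (to_one 2) \<cdot>\<^bsub>M\<^esub> farr S ?s"
    using S.farr_cmp[of ?s "to_one 2"] homD[OF s] homD[OF two] by simp
  then have "PhiA P (farr S (to_one (Suc k))) (ide C A) (ide C A) \<xi>
      = PhiA P (farr S ?s) (ide C A) (ide C A) (PhiA P (farr S (to_one 2)) (ide C A) (ide C A) \<xi>)"
    using homD[OF s] homD[OF two] by (simp add: PhiA_PhiA)
  also have "\<dots> = PhiA P (farr S ?s) (ide C A) (ide C A) (app (Suc 0) (Suc 0) A A A \<xi> \<xi>)"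
    using assms by (simp add: models_iff)
  also have "\<dots> = app k (Suc 0) A A A (iter k A \<xi>) \<xi>"
    using app_PhiA[of "to_one k" "ord_id (Suc 0)" "ide C A" "ide C A" A \<xi> \<xi> k "Suc 0" A A]
      homD[OF to_one_hom[of k]] homD[OF ord_id_hom[of "Suc 0"]]
    by (simp add: Suc S.farr_ide[simplified])
  finally show ?case by simp
qed

text \<open>Blockwise: \<open>app_iter\<close> splits the power along the blocks of
  \<open>w\<close>, and \<open>iter_to_one\<close> treats each block.\<close>

lemma iter_arr:
  assumes "(A, \<xi>) \<in> models M T C P" "w \<in> hom Delta_a n n'"
  shows "iter n A \<xi> = PhiA P (farr S w) (ide C A) (ide C A) (iter n' A \<xi>)"
  using assms(2)
proof (induction rule: hom_Delta_a_induct)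
  case empty
  show ?case using iter_in[of 0] by (simp add: S.farr_ide[simplified] del: iter.simps)
next
  case (snoc p n' w k)
  note w = homD[OF snoc.hyps]
  have "iter (p + k) A \<xi> = app p k A A A (iter p A \<xi>) (iter k A \<xi>)"
    by (simp add: app_iter)
  also have "\<dots> = app p k A A A (PhiA P (farr S w) (ide C A) (ide C A) (iter n' A \<xi>))
      (PhiA P (farr S (to_one k)) (ide C A) (ide C A) \<xi>)"
    by (simp only: iter_to_one[OF assms(1)] snoc.IH[symmetric])
  also have "\<dots> = PhiA P (farr S (ord_sum w (to_one k))) (ide C A) (ide C A) (iter (Suc n') A \<xi>)"
    using app_PhiA[of w "to_one k" "ide C A" "ide C A" A "iter n' A \<xi>" \<xi> p k A A]
      w homD[OF to_one_hom[of k]] by simp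
  finally show ?case .
qed

end

text \<open>\<open>f\<close> passes through the composite one factor at a time: the induction
  hypothesis changes its side on the first \<open>n\<close> factors, extranaturality carries it
  across the middle object, and \<open>eq\<close> changes its side on the last factor.\<close>

lemma iter_hom:
  assumes f: "f \<in> hom C A B" and \<xi>: "\<xi> \<in> PhiO P (fobj S (Suc 0)) A A" and \<zeta>: "\<zeta> \<in> PhiO P (fobj S (Suc 0)) B B"
    and eq: "PhiA P (ide M (fobj S (Suc 0))) (ide C A) f \<xi> = PhiA P (ide M (fobj S (Suc 0))) f (ide C B) \<zeta>"
  shows "PhiA P (ide M (fobj S n)) (ide C A) f (iter n A \<xi>) = PhiA P (ide M (fobj S n)) f (ide C B) (iter n B \<zeta>)"
proof -
  note [simp] = homD[OF f]
  have [simp]: "A \<in> Obj C" "B \<in> Obj C" using C.dom_cod_in[of f] by simp_all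
  note [simp] = iter_in[OF _ \<xi>] iter_in[OF _ \<zeta>] \<xi> \<zeta>
  show ?thesis
  proof (induction n)
    case 0
    \<comment> \<open>Both sides are \<open>lf_unit F A B f\<close>, by naturality of the unit
      constraint in either variable.\<close>
    show ?case
      using lf_unit_natural[OF C.ide_in[of A] C.ide_in[of A] f] lf_unit_natural[OF C.ide_in[of B] f C.ide_in[of B]]
      by simp
  next
    case (Suc n)
    let ?i = "ide M (fobj S n)" and ?j = "ide M (fobj S (Suc 0))" and ?k = "ide M (fobj S (Suc n))"
    have "PhiA P ?k (ide C A) f (app n (Suc 0) A A A (iter n A \<xi>) \<xi>)
        = app n (Suc 0) A A B (PhiA P ?i (ide C A) f (iter n A \<xi>)) \<xi>"
      using app_natural[of n "Suc 0" "ide C A" f A "iter n A \<xi>" \<xi>] by simp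
    also have "\<dots> = app n (Suc 0) A A B (PhiA P ?i f (ide C B) (iter n B \<zeta>)) \<xi>"
      by (simp only: Suc)
    also have "\<dots> = app n (Suc 0) A B B (iter n B \<zeta>) (PhiA P ?j (ide C A) f \<xi>)"
      using app_extranatural[of n "Suc 0" A f B "iter n B \<zeta>" \<xi>] by simp
    also have "\<dots> = app n (Suc 0) A B B (iter n B \<zeta>) (PhiA P ?j f (ide C B) \<zeta>)"
      by (simp only: eq)
    also have "\<dots> = PhiA P ?k f (ide C B) (app n (Suc 0) B B B (iter n B \<zeta>) \<zeta>)"
      using app_natural[of n "Suc 0" f "ide C B" B "iter n B \<zeta>" \<zeta>] by simp
    finally show ?case by simp
  qed
qed

section \<open>The category of models\<close>

abbreviation L :: "('co \<times> 'x, ('co \<times> 'x) \<times> 'ca \<times> ('co \<times> 'x)) cat" where "L \<equiv> Mod M T C P"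

lemma model_in:
  assumes "s \<in> models M T C P"
  shows "fst s \<in> Obj C" "snd s \<in> PhiO P (fobj S (Suc 0)) (fst s) (fst s)" "(fst s, snd s) \<in> models M T C P"
  using assms models_iff[of "fst s" "snd s"] by simp_all

lemma model_hom_ide: "s \<in> models M T C P \<Longrightarrow> ide C (fst s) \<in> model_hom M T C P s s"
  using model_in[of s] by (simp add: model_hom_iff C.ide_in)

lemma model_hom_cmp:
  assumes s: "s \<in> models M T C P" and t: "t \<in> models M T C P" and r: "r \<in> models M T C P"
    and f: "f \<in> model_hom M T C P s t" and g: "g \<in> model_hom M T C P t r"
  shows "g \<cdot>\<^bsub>C\<^esub> f \<in> model_hom M T C P s r"
proof -
  note [simp] = model_in(1,2)[OF s] model_in(1,2)[OF t] model_in(1,2)[OF r]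
  have fg: "f \<in> hom C (fst s) (fst t)" "g \<in> hom C (fst t) (fst r)" using f g by (simp_all add: model_hom_iff)
  note [simp] = homD[OF fg(1)] homD[OF fg(2)]
  let ?i = "ide M (fobj S (Suc 0))"
  have "PhiA P ?i (ide C (fst s)) (g \<cdot>\<^bsub>C\<^esub> f) (snd s)
      = PhiA P ?i (ide C (fst s)) g (PhiA P ?i (ide C (fst s)) f (snd s))"
    by (simp add: PhiA_PhiA)
  also have "\<dots> = PhiA P ?i (ide C (fst s)) g (PhiA P ?i f (ide C (fst t)) (snd t))"
    using f by (simp add: model_hom_iff)
  also have "\<dots> = PhiA P ?i f (ide C (fst r)) (PhiA P ?i (ide C (fst t)) g (snd t))"
    by (simp add: PhiA_PhiA)
  also have "\<dots> = PhiA P ?i f (ide C (fst r)) (PhiA P ?i g (ide C (fst r)) (snd r))"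
    using g by (simp add: model_hom_iff)
  also have "\<dots> = PhiA P ?i (g \<cdot>\<^bsub>C\<^esub> f) (ide C (fst r)) (snd r)"
    by (simp add: PhiA_PhiA)
  finally show ?thesis using C.cmp_in[OF fg] by (simp add: model_hom_iff)
qed

lemma category_Mod: "category L"
proof
  fix f assume "f \<in> Arr L"
  then show "Dom L f \<in> Obj L" "Cod L f \<in> Obj L" by (auto simp: Mod_def)
next
  fix A assume "A \<in> Obj L"
  then show "ide L A \<in> hom L A A" by (simp add: mod_hom model_hom_ide)
next
  fix f A B g D assume "f \<in> hom L A B" "g \<in> hom L B D"
  then show "g \<cdot>\<^bsub>L\<^esub> f \<in> hom L A D" by (auto simp: mod_hom intro: model_hom_cmp)
next
  fix f A B assume "f \<in> hom L A B"
  then show "ide L B \<cdot>\<^bsub>L\<^esub> f = f" "f \<cdot>\<^bsub>L\<^esub> ide L A = f"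
    by (auto simp: mod_hom model_hom_iff C.ide_left C.ide_right)
next
  fix f A B g D h E assume "f \<in> hom L A B" "g \<in> hom L B D" "h \<in> hom L D E"
  then show "(h \<cdot>\<^bsub>L\<^esub> g) \<cdot>\<^bsub>L\<^esub> f = h \<cdot>\<^bsub>L\<^esub> (g \<cdot>\<^bsub>L\<^esub> f)"
    by (auto simp: mod_hom model_hom_iff intro!: C.cmp_assoc)
qed

lemma Mod_forget_functor: "is_functor L C Mod_forget"
  unfolding is_functor_def
  by (auto simp: mod_hom model_hom_iff model_in(1) split: prod.splits)

section \<open>The universal cone\<close>

definition limit_cone :: "nat \<Rightarrow> 'co \<times> 'x \<Rightarrow> 'co \<times> 'x \<Rightarrow> ('co \<times> 'x) \<times> 'ca \<times> ('co \<times> 'x) \<Rightarrow> 'x" where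
  "limit_cone n s t f = PhiA P (ide M (fobj S n)) (ide C (fst s)) (fst (snd f)) (iter n (fst s) (snd s))"

text \<open>\<open>limit_cone\<close> is defined by a covariant action on the source model; for
  homomorphisms \<open>iter_hom\<close> yields this contravariant description on the target
  model.\<close>

lemma limit_cone_alt:
  assumes "s \<in> models M T C P" "t \<in> models M T C P" "f \<in> model_hom M T C P s t"
  shows "limit_cone n s t (s, f, t) = PhiA P (ide M (fobj S n)) f (ide C (fst t)) (iter n (fst t) (snd t))"
  unfolding limit_cone_def
  using assms iter_hom[of f "fst s" "fst t" "snd s" "snd t" n] by (simp add: model_hom_iff model_in)

lemma limit_cone_in:
  assumes "s \<in> models M T C P" "f \<in> model_hom M T C P s t"
  shows "limit_cone n s t (s, f, t) \<in> PhiO P (fobj S n) (fst s) (fst t)"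
  unfolding limit_cone_def using assms by (simp add: model_hom_iff model_in hom_def)

lemma limit_cone_ide:
  "s \<in> models M T C P \<Longrightarrow> limit_cone n s s (ide L s) = iter n (fst s) (snd s)"
  by (simp add: limit_cone_def model_in)

lemma limit_cone_cone: "vertical_double_cone Delta_a F L Mod_forget limit_cone"
  unfolding vertical_double_cone_def
proof (intro conjI ballI)
  show "category L" by (rule category_Mod)
  show "is_functor L (lf_cat F) Mod_forget" using Mod_forget_functor by simp
next
  fix n assume "n \<in> Obj Delta_a"
  have "limit_cone n s' t' ((t, b, t') \<cdot>\<^bsub>L\<^esub> (s, f, t) \<cdot>\<^bsub>L\<^esub> (s', a, s)) = PhiA P (ide M (fobj S n)) a b (limit_cone n s t (s, f, t))"
    if "s \<in> models M T C P" "s' \<in> models M T C P" "t \<in> models M T C P" "t' \<in> models M T C P"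
      and a: "a \<in> model_hom M T C P s' s" and b: "b \<in> model_hom M T C P t t'" and f: "f \<in> model_hom M T C P s t"
    for s s' t t' a b f
  proof -
    note [simp] = model_in(1,2)[OF that(1)] model_in(1,2)[OF that(2)] model_in(1,2)[OF that(3)] model_in(1,2)[OF that(4)]
    have h: "a \<in> hom C (fst s') (fst s)" "b \<in> hom C (fst t) (fst t')" "f \<in> hom C (fst s) (fst t)"
      using a b f by (simp_all add: model_hom_iff)
    note [simp] = homD[OF h(1)] homD[OF h(2)] homD[OF h(3)]
    \<comment> \<open>The component at \<open>a\<close> is isolated because \<open>a\<close> acts
      covariantly by definition but has to act contravariantly in the end;
      \<open>limit_cone_alt\<close> makes the change.\<close>
    have "limit_cone n s' t' ((t, b, t') \<cdot>\<^bsub>L\<^esub> (s, f, t) \<cdot>\<^bsub>L\<^esub> (s', a, s))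
        = PhiA P (ide M (fobj S n)) (ide C (fst s')) (b \<cdot>\<^bsub>C\<^esub> f) (limit_cone n s' s (s', a, s))"
      by (simp add: limit_cone_def PhiA_PhiA)
    also have "\<dots> = PhiA P (ide M (fobj S n)) a b (limit_cone n s t (s, f, t))"
      by (simp add: limit_cone_alt[OF that(2,1) a] PhiA_PhiA) (simp add: limit_cone_def PhiA_PhiA)
    finally show ?thesis .
  qed
  then have nat: "limit_cone n s' t' (b \<cdot>\<^bsub>L\<^esub> f \<cdot>\<^bsub>L\<^esub> a) = PhiA P (ide M (fobj S n)) (farr Mod_forget a) (farr Mod_forget b) (limit_cone n s t f)"
    if "a \<in> hom L s' s" "b \<in> hom L t t'" "f \<in> hom L s t" for s s' t t' a b f
    using that unfolding mod_hom by (elim conjE bexE) (simp only: mod_simps)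
  have "limit_cone n s t f \<in> PhiO P (fobj S n) (fst s) (fst t)" if "f \<in> hom L s t" for s t f
    using that unfolding mod_hom by (elim conjE bexE) (simp only: limit_cone_in)
  then show "square L L (lf_cat F) (lf_cat F) Mod_forget Mod_forget (hom_prof L) (lf_hor F n) (limit_cone n)"
    unfolding square_def by (simp add: hom_prof_def nat del: mod_simps(5) split_paired_All)
next
  fix s t f assume "f \<in> hom L s t"
  then obtain g where f: "f = (s, g, t)" and s: "s \<in> models M T C P" and g: "g \<in> hom C (fst s) (fst t)"
    by (auto simp: mod_hom model_hom_iff)
  show "limit_cone (unit Delta_a) s t f = lf_unit F (fobj Mod_forget s) (fobj Mod_forget t) (farr Mod_forget f)"
    using f model_in[OF s] homD[OF g] lf_unit_natural[OF C.ide_in C.ide_in g]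
    by (simp add: limit_cone_def C.ide_in)
next
  fix n m s t r h g assume "h \<in> hom L s t" "g \<in> hom L t r"
  then obtain h' g' where h: "h = (s, h', t)" "h' \<in> model_hom M T C P s t" and g: "g = (t, g', r)" "g' \<in> model_hom M T C P t r"
    and m: "s \<in> models M T C P" "t \<in> models M T C P" "r \<in> models M T C P"
    by (auto simp: mod_hom)
  note [simp] = model_in(1,2)[OF m(1)] model_in(1,2)[OF m(2)] model_in(1,2)[OF m(3)]
  have hom: "h' \<in> hom C (fst s) (fst t)" "g' \<in> hom C (fst t) (fst r)" using h g by (simp_all add: model_hom_iff)
  note [simp] = homD[OF hom(1)] homD[OF hom(2)]
  let ?s = "iter m (fst s) (snd s)" and ?s' = "iter n (fst s) (snd s)" and ?t = "iter n (fst t) (snd t)"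
  let ?n = "ide M (fobj S n)" and ?m = "ide M (fobj S m)"
  \<comment> \<open>Extranaturality moves \<open>h'\<close> across the middle object, and
    \<open>limit_cone_alt\<close> makes it act covariantly there. Both arrows then act on one
    factor, over two powers of the same structure, which \<open>app_iter\<close> merges.\<close>
  have "app n m (fst s) (fst t) (fst r) (PhiA P ?n (ide C (fst t)) g' ?t) (PhiA P ?m (ide C (fst s)) h' ?s)
      = app n m (fst s) (fst s) (fst r) (PhiA P ?n (ide C (fst s)) g' (PhiA P ?n h' (ide C (fst t)) ?t)) ?s"
    using app_extranatural[of n m "fst s" h' "fst r" "PhiA P ?n (ide C (fst t)) g' ?t" ?s]
    by (simp add: PhiA_PhiA)
  also have "PhiA P ?n h' (ide C (fst t)) ?t = PhiA P ?n (ide C (fst s)) h' ?s'"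
    using limit_cone_alt[OF m(1,2) h(2)] by (simp add: limit_cone_def)
  also have "PhiA P ?n (ide C (fst s)) g' (PhiA P ?n (ide C (fst s)) h' ?s') = PhiA P ?n (ide C (fst s)) (g' \<cdot>\<^bsub>C\<^esub> h') ?s'"
    by (simp add: PhiA_PhiA)
  also have "app n m (fst s) (fst s) (fst r) (PhiA P ?n (ide C (fst s)) (g' \<cdot>\<^bsub>C\<^esub> h') ?s') ?s
      = PhiA P (ide M (fobj S (n + m))) (ide C (fst s)) (g' \<cdot>\<^bsub>C\<^esub> h') (iter (n + m) (fst s) (snd s))"
    using app_natural[of n m "ide C (fst s)" "g' \<cdot>\<^bsub>C\<^esub> h'" "fst s" ?s' ?s] by (simp add: app_iter)
  finally show "limit_cone (n \<otimes>\<^bsub>Delta_a\<^esub> m) s r (g \<cdot>\<^bsub>L\<^esub> h) = lf_apply F n m (fobj Mod_forget s) (fobj Mod_forget t)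
      (fobj Mod_forget r) (limit_cone n t r g) (limit_cone m s t h)"
    unfolding h g by (simp add: limit_cone_def lf_apply_eq)
next
  fix n n' w s t f assume w: "w \<in> hom Delta_a n n'" and "f \<in> hom L s t"
  then obtain g where f: "f = (s, g, t)" and s: "s \<in> models M T C P" and g: "g \<in> hom C (fst s) (fst t)"
    by (auto simp: mod_hom model_hom_iff)
  note [simp] = model_in(1,2)[OF s] homD[OF g] homD[OF w]
  have [simp]: "fst t \<in> Obj C" using C.dom_cod_in(2)[of g] by simp
  have "limit_cone n s t f = PhiA P (ide M (fobj S n)) (ide C (fst s)) g
      (PhiA P (farr S w) (ide C (fst s)) (ide C (fst s)) (iter n' (fst s) (snd s)))"
    using iter_arr[OF model_in[OF s] w] f by (simp add: limit_cone_def)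
  then show "limit_cone n s t f = lf_sq F w (fobj Mod_forget s) (fobj Mod_forget t) (limit_cone n' s t f)"
    by (simp add: PhiA_PhiA) (simp add: f limit_cone_def PhiA_PhiA)
qed

section \<open>Factorization of an arbitrary vertical double cone\<close>

context
  fixes A :: "('p, 'q) cat" and V :: "('p, 'q, 'co, 'ca) ftor" and v :: "nat \<Rightarrow> 'p \<Rightarrow> 'p \<Rightarrow> 'q \<Rightarrow> 'x"
  assumes cone: "vertical_double_cone Delta_a F A V v"
begin

interpretation A: category A
  using cone by (simp add: vertical_double_cone_def)

lemma V_obj: "X \<in> Obj A \<Longrightarrow> fobj V X \<in> Obj C"
  using cone by (simp add: vertical_double_cone_def is_functor_def)

lemma V_ide: "X \<in> Obj A \<Longrightarrow> farr V (ide A X) = ide C (fobj V X)"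
  using cone by (simp add: vertical_double_cone_def is_functor_def)

lemma V_hom:
  assumes "f \<in> hom A X Y"
  shows "farr V f \<in> hom C (fobj V X) (fobj V Y)"
proof -
  have "X \<in> Obj A" "Y \<in> Obj A" using A.dom_cod_in[of f] homD[OF assms] by auto
  then show ?thesis using cone assms by (simp add: vertical_double_cone_def is_functor_def)
qed

lemma V_cmp:
  assumes "f \<in> hom A X Y" "g \<in> hom A Y Z"
  shows "farr V (g \<cdot>\<^bsub>A\<^esub> f) = farr V g \<cdot>\<^bsub>C\<^esub> farr V f"
proof -
  have "X \<in> Obj A" "Y \<in> Obj A" "Z \<in> Obj A"
    using A.dom_cod_in[of f] A.dom_cod_in[of g] homD[OF assms(1)] homD[OF assms(2)] by auto
  moreover have "is_functor A C V" using cone by (simp add: vertical_double_cone_def)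
  ultimately show ?thesis using assms unfolding is_functor_def by blast
qed

lemma cone_in:
  assumes "f \<in> hom A X Y"
  shows "v n X Y f \<in> PhiO P (fobj S n) (fobj V X) (fobj V Y)"
proof -
  have "X \<in> Obj A" "Y \<in> Obj A" using A.dom_cod_in[of f] homD[OF assms] by auto
  then show ?thesis using cone assms by (simp add: vertical_double_cone_def square_def hom_prof_def)
qed

lemma cone_natural:
  assumes "f \<in> hom A X Y" "a \<in> hom A X' X" "b \<in> hom A Y Y'"
  shows "v n X' Y' (b \<cdot>\<^bsub>A\<^esub> f \<cdot>\<^bsub>A\<^esub> a) = PhiA P (ide M (fobj S n)) (farr V a) (farr V b) (v n X Y f)"
proof -
  have "X \<in> Obj A" "Y \<in> Obj A" "X' \<in> Obj A" "Y' \<in> Obj A"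
    using A.dom_cod_in[of a] A.dom_cod_in[of b] homD[OF assms(2)] homD[OF assms(3)] by auto
  then show ?thesis using cone assms by (simp add: vertical_double_cone_def square_def hom_prof_def)
qed

text \<open>Naturality applied to an identity with \<open>f\<close> composed on one side. For the
  component at \<open>1\<close>, comparing the two formulas makes \<open>farr V f\<close> a
  homomorphism, as \<open>factor_hom\<close> records.\<close>

lemma cone_left: "f \<in> hom A X Y \<Longrightarrow> v n X Y f = PhiA P (ide M (fobj S n)) (ide C (fobj V X)) (farr V f) (v n X X (ide A X))"
  and cone_right: "f \<in> hom A X Y \<Longrightarrow> v n X Y f = PhiA P (ide M (fobj S n)) (farr V f) (ide C (fobj V Y)) (v n Y Y (ide A Y))"
proof -
  assume f: "f \<in> hom A X Y"
  have [simp]: "X \<in> Obj A" "Y \<in> Obj A" using A.dom_cod_in[of f] homD[OF f] by auto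
  show "v n X Y f = PhiA P (ide M (fobj S n)) (ide C (fobj V X)) (farr V f) (v n X X (ide A X))"
    using cone_natural[OF A.ide_in A.ide_in f, of n] homD[OF f] by (simp add: V_ide)
  show "v n X Y f = PhiA P (ide M (fobj S n)) (farr V f) (ide C (fobj V Y)) (v n Y Y (ide A Y))"
    using cone_natural[OF A.ide_in f A.ide_in, of n] homD[OF f] by (simp add: V_ide)
qed

lemma cone_0: "X \<in> Obj A \<Longrightarrow> v 0 X X (ide A X) = lf_unit F (fobj V X) (fobj V X) (ide C (fobj V X))"
  using cone by (simp add: vertical_double_cone_def A.ide_in V_ide)

lemma cone_add:
  assumes "X \<in> Obj A"
  shows "v (n + m) X X (ide A X)
    = app n m (fobj V X) (fobj V X) (fobj V X) (v n X X (ide A X)) (v m X X (ide A X))"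
proof -
  have "\<forall>n\<in>Obj Delta_a. \<forall>m\<in>Obj Delta_a. \<forall>X\<in>Obj A. \<forall>Y\<in>Obj A. \<forall>Z\<in>Obj A. \<forall>h\<in>hom A X Y. \<forall>g\<in>hom A Y Z.
        v (n \<otimes>\<^bsub>Delta_a\<^esub> m) X Z (g \<cdot>\<^bsub>A\<^esub> h)
        = lf_apply F n m (fobj V X) (fobj V Y) (fobj V Z) (v n Y Z g) (v m X Y h)"
    using cone unfolding vertical_double_cone_def by blast
  from this[rule_format, OF _ _ assms assms assms A.ide_in A.ide_in] assms
  show ?thesis by (simp add: lf_apply_eq V_obj)
qed

lemma cone_arr:
  assumes "w \<in> hom Delta_a n n'" "X \<in> Obj A"
  shows "v n X X (ide A X) = PhiA P (farr S w) (ide C (fobj V X)) (ide C (fobj V X)) (v n' X X (ide A X))"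
proof -
  have "\<forall>n\<in>Obj Delta_a. \<forall>n'\<in>Obj Delta_a. \<forall>w\<in>hom Delta_a n n'. \<forall>X\<in>Obj A. \<forall>Y\<in>Obj A. \<forall>f\<in>hom A X Y.
        v n X Y f = lf_sq F w (fobj V X) (fobj V Y) (v n' X Y f)"
    using cone unfolding vertical_double_cone_def by blast
  from this[rule_format, OF _ _ assms(1,2) assms(2) A.ide_in] assms(2)
  show ?thesis by simp
qed

lemma cone_iter:
  "X \<in> Obj A \<Longrightarrow> v n X X (ide A X) = iter n (fobj V X) (v (Suc 0) X X (ide A X))"
proof (induction n)
  case (Suc n)
  then show ?case using cone_add[of X n "Suc 0"] by simp
qed (simp add: cone_0)

text \<open>The components at \<open>0\<close> and \<open>2\<close> are each computed twice at the
  identity: through the arrow into \<open>1\<close>, and through the unit or sum condition. The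
  comparison is the form of the model axioms in \<open>models_iff\<close>.\<close>

lemma factor_obj_model: "X \<in> Obj A \<Longrightarrow> factor_obj A V v X \<in> models M T C P"
  using cone_in[OF A.ide_in, of X "Suc 0"] cone_arr[OF to_one_hom[of 0], of X] cone_0[of X]
    cone_arr[OF to_one_hom[of 2], of X] cone_add[of X "Suc 0" "Suc 0"]
  by (simp add: factor_obj_def models_iff V_obj numeral_2_eq_2)

lemma factor_hom: "f \<in> hom A X Y \<Longrightarrow> farr V f \<in> model_hom M T C P (factor_obj A V v X) (factor_obj A V v Y)"
  using V_hom[of f X Y] cone_left[of f X Y "Suc 0"] cone_right[of f X Y "Suc 0"]
  by (simp add: model_hom_iff factor_obj_def)

lemma factor_cone_factor: "cone_factor Delta_a L Mod_forget limit_cone A V v (factor A V v)"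
  unfolding cone_factor_def
proof (intro conjI ballI)
  show "is_functor A L (factor A V v)"
    unfolding is_functor_def
  proof (intro conjI ballI)
    fix X Y f assume f: "X \<in> Obj A" "Y \<in> Obj A" "f \<in> hom A X Y"
    then show "farr (factor A V v) f \<in> hom L (fobj (factor A V v) X) (fobj (factor A V v) Y)"
      using homD[OF f(3)] by (simp add: factor_def mod_hom factor_obj_model factor_hom)
  next
    fix X Y Z f g assume "f \<in> hom A X Y" "g \<in> hom A Y Z"
    then show "farr (factor A V v) (g \<cdot>\<^bsub>A\<^esub> f) = farr (factor A V v) g \<cdot>\<^bsub>L\<^esub> farr (factor A V v) f"
      using V_cmp[of f X Y g Z] homD[of f A X Y] homD[of g A Y Z] by (simp add: factor_def)
  qed (simp_all add: factor_def factor_obj_model V_ide, simp add: factor_obj_def)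
next
  fix n X Y f assume f: "f \<in> hom A X Y" and X: "X \<in> Obj A"
  have "limit_cone n (factor_obj A V v X) (factor_obj A V v Y) (factor_obj A V v X, farr V f, factor_obj A V v Y)
      = PhiA P (ide M (fobj S n)) (ide C (fobj V X)) (farr V f) (v n X X (ide A X))"
    by (simp add: limit_cone_def factor_obj_def cone_iter[OF X, of n])
  then show "limit_cone n (fobj (factor A V v) X) (fobj (factor A V v) Y) (farr (factor A V v) f) = v n X Y f"
    using homD[OF f] by (simp add: factor_def cone_left[OF f, of n])
qed (simp_all add: factor_def factor_obj_def)

text \<open>On the identity of a model, \<open>limit_cone\<close> at \<open>1\<close> returns the
  model structure, so objects are forced. Arrows are forced because an arrow of \<open>L\<close> is
  its underlying arrow with source and target.\<close>

lemma cone_factor_unique: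
  assumes K: "cone_factor Delta_a L Mod_forget limit_cone A V v K"
  shows "X \<in> Obj A \<Longrightarrow> fobj K X = factor_obj A V v X"
    and "f \<in> hom A X Y \<Longrightarrow> farr K f = (factor_obj A V v X, farr V f, factor_obj A V v Y)"
proof -
  have K': "is_functor A L K" "\<forall>X\<in>Obj A. fobj Mod_forget (fobj K X) = fobj V X"
    "\<forall>f\<in>Arr A. farr Mod_forget (farr K f) = farr V f"
    "\<forall>n\<in>Obj Delta_a. \<forall>X\<in>Obj A. \<forall>Y\<in>Obj A. \<forall>f\<in>hom A X Y.
        limit_cone n (fobj K X) (fobj K Y) (farr K f) = v n X Y f"
    using K by (simp_all add: cone_factor_def)
  have obj: "fobj K X = factor_obj A V v X" if X: "X \<in> Obj A" for X
  proof -
    have m: "fobj K X \<in> models M T C P" and "farr K (ide A X) = ide L (fobj K X)"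
      using K'(1) X by (simp_all add: is_functor_def)
    then have "v (Suc 0) X X (ide A X) = snd (fobj K X)"
      using K'(4)[rule_format, of "Suc 0" X X "ide A X"] X limit_cone_ide[OF m, of "Suc 0"] model_in[OF m]
      by (simp add: A.ide_in del: iter.simps(2))
    then show ?thesis using K'(2) X by (simp add: factor_obj_def prod_eq_iff)
  qed
  show "X \<in> Obj A \<Longrightarrow> fobj K X = factor_obj A V v X" by (rule obj)
  assume f: "f \<in> hom A X Y"
  have [simp]: "X \<in> Obj A" "Y \<in> Obj A" using A.dom_cod_in[of f] homD[OF f] by auto
  have "farr K f \<in> hom L (factor_obj A V v X) (factor_obj A V v Y)"
    using K'(1) f by (simp add: is_functor_def flip: obj)
  moreover have "farr Mod_forget (farr K f) = farr V f"
    using K'(3) homD[OF f] by simp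
  ultimately show "farr K f = (factor_obj A V v X, farr V f, factor_obj A V v Y)"
    by (auto simp: mod_hom)
qed

end

section \<open>The two-dimensional universal property\<close>

lemma limit_lift:
  fixes A :: "('p, 'q) cat" and A' :: "('p2, 'q2) cat" and H :: "('p, 'q, 'p2, 'q2, 'h) prof"
  assumes cone: "vertical_double_cone Delta_a F A V v" "vertical_double_cone Delta_a F A' V' v'"
    and K: "cone_factor Delta_a L Mod_forget limit_cone A V v K" "cone_factor Delta_a L Mod_forget limit_cone A' V' v' K'"
    and H: "is_prof A A' H"
    and sq: "square A A' C C V V' H (hom_prof C) \<theta>"
    and eq: "\<And>X X' x. \<lbrakk>X \<in> Obj A; X' \<in> Obj A'; x \<in> on_obj H (X, X')\<rbrakk> \<Longrightarrow>
      PhiA P (ide M (fobj S (Suc 0))) (ide C (fobj V X)) (\<theta> X X' x) (v (Suc 0) X X (ide A X))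
      = PhiA P (ide M (fobj S (Suc 0))) (\<theta> X X' x) (ide C (fobj V' X')) (v' (Suc 0) X' X' (ide A' X'))"
  shows "square A A' L L K K' H (hom_prof L) (\<lambda>X X' x. (fobj K X, \<theta> X X' x, fobj K' X'))"
proof -
  note u = cone_factor_unique[OF cone(1) K(1)] and u' = cone_factor_unique[OF cone(2) K(2)]
  note m = factor_obj_model[OF cone(1)] and m' = factor_obj_model[OF cone(2)]
  have hom: "\<theta> X X' x \<in> hom C (fobj V X) (fobj V' X')"
    if "X \<in> Obj A" "X' \<in> Obj A'" "x \<in> on_obj H (X, X')" for X X' x
    using sq that unfolding square_def by (simp add: hom_prof_def)
  have nat: "\<theta> X' Y' (on_arr H (a, b) x) = farr V' b \<cdot>\<^bsub>C\<^esub> \<theta> X Y x \<cdot>\<^bsub>C\<^esub> farr V a"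
    if "X \<in> Obj A" "X' \<in> Obj A" "Y \<in> Obj A'" "Y' \<in> Obj A'" "a \<in> hom A X' X" "b \<in> hom A' Y Y'" "x \<in> on_obj H (X, Y)"
    for X X' Y Y' a b x
    using sq that unfolding square_def by (simp add: hom_prof_def)
  \<comment> \<open>By definition of \<open>factor_obj\<close>, \<open>eq\<close> is the
    homomorphism condition between the models assigned to \<open>X\<close> and
    \<open>X'\<close>.\<close>
  have in_hom: "\<theta> X X' x \<in> model_hom M T C P (factor_obj A V v X) (factor_obj A' V' v' X')"
    if "X \<in> Obj A" "X' \<in> Obj A'" "x \<in> on_obj H (X, X')" for X X' x
    using hom[OF that] eq[OF that]
    by (simp add: model_hom_iff factor_obj_def)
  show ?thesis
    unfolding square_def
    by (auto simp: hom_prof_def mod_hom u u' m m' in_hom nat)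
qed

theorem Mod_double_limit:
  "double_limit TYPE('p \<times> 'q \<times> 'p2 \<times> 'q2 \<times> 'h) Delta_a F L Mod_forget limit_cone"
  unfolding double_limit_def
proof (intro conjI allI impI)
  show "lax_double_functor Delta_a F" by (rule lax_double_functor_Phi_lax)
  show "vertical_double_cone Delta_a F L Mod_forget limit_cone" by (rule limit_cone_cone)
next
  fix A :: "('p, 'q) cat" and V v assume cone: "vertical_double_cone Delta_a F A V v"
  show "\<exists>K. cone_factor Delta_a L Mod_forget limit_cone A V v K \<and>
      (\<forall>K'. cone_factor Delta_a L Mod_forget limit_cone A V v K' \<longrightarrow> functor_eq A K' K)"
  proof (intro exI conjI allI impI)
    show "cone_factor Delta_a L Mod_forget limit_cone A V v (factor A V v)"
      by (rule factor_cone_factor[OF cone])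
    fix K' assume "cone_factor Delta_a L Mod_forget limit_cone A V v K'"
    from cone_factor_unique[OF cone this]
    show "functor_eq A K' (factor A V v)"
      by (auto simp: functor_eq_def factor_def hom_def)
  qed
next
  fix A :: "('p, 'q) cat" and V v K and A' :: "('p2, 'q2) cat" and V' v' K'
    and H :: "('p, 'q, 'p2, 'q2, 'h) prof" and \<theta>
  assume asm: "vertical_double_cone Delta_a F A V v \<and> cone_factor Delta_a L Mod_forget limit_cone A V v K \<and>
      vertical_double_cone Delta_a F A' V' v' \<and> cone_factor Delta_a L Mod_forget limit_cone A' V' v' K' \<and>
      is_prof A A' H \<and>
      square A A' (lf_cat F) (lf_cat F) V V' H (hom_prof (lf_cat F)) \<theta> \<and>
      (\<forall>n\<in>Obj Delta_a. \<forall>X\<in>Obj A. \<forall>X'\<in>Obj A'. \<forall>x\<in>on_obj H (X, X').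
           on_arr (lf_hor F n) (ide (lf_cat F) (fobj V X), \<theta> X X' x) (v n X X (ide A X))
           = on_arr (lf_hor F n) (\<theta> X X' x, ide (lf_cat F) (fobj V' X')) (v' n X' X' (ide A' X')))"
  let ?\<sigma> = "\<lambda>X X' x. (fobj K X, \<theta> X X' x, fobj K' X')"
  have lift: "square A A' L L K K' H (hom_prof L) ?\<sigma>"
    by (rule limit_lift[of A V v A' V' v']) (use asm in simp_all)
  have unique: "\<tau> X X' x = ?\<sigma> X X' x"
    if "square A A' L L K K' H (hom_prof L) \<tau>"
      and "\<forall>X\<in>Obj A. \<forall>X'\<in>Obj A'. \<forall>x\<in>on_obj H (X, X'). farr Mod_forget (\<tau> X X' x) = \<theta> X X' x"
      and "X \<in> Obj A" "X' \<in> Obj A'" "x \<in> on_obj H (X, X')" for \<tau> X X' x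
  proof -
    have "\<tau> X X' x \<in> hom L (fobj K X) (fobj K' X')"
      using that unfolding square_def by (simp add: hom_prof_def)
    moreover have "farr Mod_forget (\<tau> X X' x) = \<theta> X X' x"
      using that(2-) by blast
    ultimately show ?thesis by (auto simp: mod_hom)
  qed
  show "let lifts = (\<lambda>\<sigma>. square A A' L L K K' H (hom_prof L) \<sigma> \<and>
               (\<forall>X\<in>Obj A. \<forall>X'\<in>Obj A'. \<forall>x\<in>on_obj H (X, X'). farr Mod_forget (\<sigma> X X' x) = \<theta> X X' x))
         in \<exists>\<sigma>. lifts \<sigma> \<and>
              (\<forall>\<tau>. lifts \<tau> \<longrightarrow>
                 (\<forall>X\<in>Obj A. \<forall>X'\<in>Obj A'. \<forall>x\<in>on_obj H (X, X'). \<tau> X X' x = \<sigma> X X' x))"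
    unfolding Let_def
  proof (intro exI[of _ ?\<sigma>] conjI allI impI ballI)
    show "square A A' L L K K' H (hom_prof L) ?\<sigma>" by (rule lift)
  qed (simp_all add: unique)
qed

end

text \<open>The clause on \<open>u 1\<close> ties the limit cone to the models: its component at
  \<open>1\<close> reads off the structure of a model, so more than the apex is identified.\<close>

theorem corollary5p8:
  fixes M :: "('mo, 'ma) moncat" and T :: "('mo, 'ma) monoid_data"
    and C :: "('co, 'ca) cat" and \<Phi> :: "('mo, 'ma, 'co, 'ca, 'x) metamodel_data"
  assumes "monoidal_category M"
    and "monoid_object M T"
    and "category C"
    and "metamodel M C \<Phi>"
  shows "(\<exists>S. corresponds_to_monoid M T S) \<and>
    (\<forall>S. corresponds_to_monoid M T S \<longrightarrow>
      (\<exists>u. double_limit TYPE('p \<times> 'q \<times> 'p2 \<times> 'q2 \<times> 'h) Delta_a (Phi_lax M C \<Phi> S)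
             (Mod M T C \<Phi>) Mod_forget u \<and>
           (\<forall>(A, \<xi>) \<in> models M T C \<Phi>.
              u 1 (A, \<xi>) (A, \<xi>) (ide (Mod M T C \<Phi>) (A, \<xi>)) = \<xi>)))"
proof (intro conjI allI impI)
  interpret monoid_in_monoidal_category M T
    using assms(1,2) by (simp add: monoid_in_monoidal_category_def monoid_in_monoidal_category_axioms_def)
  show "\<exists>S. corresponds_to_monoid M T S"
    using corresponds_monoid_functor by blast
next
  fix S assume "corresponds_to_monoid M T S"
  then interpret monoid_metamodel M C \<Phi> T S
    using assms
    by (simp add: monoid_metamodel_def monoid_in_monoidal_category_def
        monoid_in_monoidal_category_axioms_def monoid_metamodel_axioms_def)
  have "limit_cone 1 (A, \<xi>) (A, \<xi>) (ide L (A, \<xi>)) = \<xi>" if "(A, \<xi>) \<in> models M T C \<Phi>" for A \<xi>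
    using limit_cone_ide[OF that, of 1] model_in[OF that] by (simp del: iter.simps(2))
  then show "\<exists>u. double_limit TYPE('p \<times> 'q \<times> 'p2 \<times> 'q2 \<times> 'h) Delta_a F L Mod_forget u \<and>
           (\<forall>(A, \<xi>) \<in> models M T C \<Phi>. u 1 (A, \<xi>) (A, \<xi>) (ide L (A, \<xi>)) = \<xi>)"
    using Mod_double_limit by blast
qed

end
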